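(* Let $s\in\mathbb Z$, let $\alpha:\mathbb R_+\to\mathbb R_+$ be a weight function, piecewise continuous and bounded on compact sets, and let $\{{}_s\Psi_\rho\}_{\rho\in\mathbb R_+}\subseteq\mathcal L_s^2(\mathcal S)$ be an admissible spherical wavelet of spin weight $s$ with respect to $\alpha$, with wavelet transform $\mathcal W_\Psi$. Then the wavelet transform is invertible: for every ${}_sf\in\mathcal L_s^2(\mathcal S)$, $$ {}_sf(x)=\lim_{R\to 0}\int_R^{1/R}\!\!\int_{SO(3)}(\mathcal R_\Upsilon\,{}_s\Psi_\rho)(x)\cdot(\mathcal W_\Psi\,{}_sf)(\rho,\Upsilon)\,d\nu(\Upsilon)\cdot\alpha(\rho)\,d\rho, $$ where the limit is taken in the $\mathcal L^2$-sense.
   Context: $\mathcal S$ is the unit sphere in $\mathbb R^3$ with spherical coordinates $(\vartheta,\varphi)\in[0,\pi]\times[0,2\pi)$, $x=(\sin\vartheta\cos\varphi,\sin\vartheta\sin\varphi,\cos\vartheta)$, and surface measure $d\sigma=\sin\vartheta\,d\vartheta\,d\varphi$. Scalar product: $\langle f,g\rangle=\int_{\mathcal S}\overline{f}\,g\,d\sigma$. $\mathbb R_+=(0,\infty)$. Spherical harmonics: for $l\in\mathbb N_0$, $Y_l^m(\vartheta,\varphi)=(-1)^m\sqrt{\frac{2l+1}{4\pi}\frac{(l-m)!}{(l+m)!}}\,P_l^m(\cos\vartheta)\,e^{im\varphi}$ for $0\le m\le l$ ($P_l^m$ the associated Legendre function), and $Y_l^m=\overline{Y_l^{-m}}$ for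 $-l\le m<0$. A spin weight $s$ function ($s\in\mathbb Z$) is represented as a scalar function of $(\vartheta,\varphi)$; $\mathcal L_s^2(\mathcal S)$ is the space of square integrable functions of spin weight $s$. The spin-raising and spin-lowering operators, acting on a function ${}_sf$ of spin weight $s$, are $$\eth\,{}_sf=-\left(\partial_\vartheta+\tfrac{i}{\sin\vartheta}\partial_\varphi-s\cot\vartheta\right){}_sf,\qquad \bar\eth\,{}_sf=-\left(\partial_\vartheta-\tfrac{i}{\sin\vartheta}\partial_\varphi+s\cot\vartheta\right){}_sf,$$ which raise, respectively lower, the spin weight by $1$; scalar functions have spin weight $0$. The spin weighted spherical harmonics are ${}_sY_l^m=\sqrt{\frac{(l-s)!}{(l+s)!}}\,\eth^sY_l^m$ for $0\le s\le l$ and ${}_sY_l^m=\sqrt{\frac{(l+s)!}{(l-s)!}}\,(-1)^s\,\bar\eth^{-s}Y_l^m$ for $-l\le s\le0$. For each $s$, $\{{}_sY_l^m: l\ge|s|,\ -l\le m\le l\}$ is an orthonormal basis of $\mathcal L_s^2(\mathcal S)$. Fourier coefficients: ${}_s\widehat f_l^m=\langle{}_sY_l^m,{}_sf\rangle$. Rotations: $\Upsilon=(\alpha,\beta,\gamma)\in SO(3)$ in Euler angles denotes the rotation of points, in a fixed coordinate system, about the $z$-, $y$-, $z$-axes by $\gamma,\beta,\alpha$ (in this order). The rotation of a spin weight $s$ function is $$(\mathcal R_\Upsilon\,{}_sf)(x)=\exp(-is\kappa)\cdot{}_sf(\Upsilon^{-1}x),$$ where $\kappa\in[0,2\pi)$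 is the third Euler angle of $\Upsilon^{-1}\Xi$, and $\Xi$ is the rotation with Euler angles $(\varphi,\vartheta,0)$ for $x=(\vartheta,\varphi)$. $d\nu$ is the Haar measure on $SO(3)$ normalized so that $\int_{SO(3)}d\nu=8\pi^2$. Admissible wavelet: given a weight function $\alpha:\mathbb R_+\to\mathbb R_+$, piecewise continuous and bounded on compact sets, a family $\{{}_s\Psi_\rho\}_{\rho\in\mathbb R_+}\subseteq\mathcal L_s^2(\mathcal S)$ is an admissible spherical wavelet of spin weight $s$ if (1) for every $l\in\mathbb N_0$ with $l\ge|s|$, $\sum_{m=-l}^{l}\int_0^\infty|{}_s(\widehat{\Psi_\rho})_l^m|^2\,\alpha(\rho)\,d\rho=\frac{2l+1}{8\pi^2}$; and (2) for each fixed $\rho$, $\sum_{l=|s|}^\infty l^{2|s|}\sum_{m=-l}^{l}|{}_s(\widehat{\Psi_\rho})_l^m|^2<\infty$. Wavelet transform: for ${}_sf\in\mathcal L_s^2(\mathcal S)$, $(\mathcal W_\Psi\,{}_sf)(\rho,\Upsilon)=\int_{\mathcal S}\overline{(\mathcal R_\Upsilon\,{}_s\Psi_\rho)(x)}\cdot{}_sf(x)\,d\sigma(x)$, for $\rho\in\mathbb R_+$, $\Upsilon\in SO(3)$. *)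

theory Defs
  imports "HOL-Analysis.Analysis"
begin

section \<open>The sphere in spherical coordinates\<close>

text \<open>A point of the sphere is given by a pair of coordinates (theta, phi).\<close>

type_synonym sph = "real \<times> real"

definition sph_dom :: "sph set" where
  "sph_dom = {0..pi} \<times> {0..<2*pi}"

definition sph_point :: "sph \<Rightarrow> real^3" where
  "sph_point = (\<lambda>(\<theta>, \<phi>). vector [sin \<theta> * cos \<phi>, sin \<theta> * sin \<phi>, cos \<theta>])"

text \<open>At the two poles, where the azimuth is not determined, it is set to 0.\<close>

definition sph_coords :: "real^3 \<Rightarrow> sph" where
  "sph_coords v = (THE p. p \<in> sph_dom \<and> sph_point p = v \<and> (sin (fst p) = 0 \<longrightarrow> snd p = 0))"

definition sph_measure :: "sph measure" where
  "sph_measure = density (restrict_space lborel sph_dom) (\<lambda>(\<theta>, \<phi>). ennreal (sin \<theta>))"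

text \<open>A function of spin weight s is a scalar function of the coordinates. The weight plays no
  role in square integrability; it enters only through the differential operators and the rotations
  below, so the same set of functions serves as the L2 space of every spin weight. Elements of the
  L2 space are Borel representatives.\<close>

definition L2_sphere :: "(sph \<Rightarrow> complex) set" where
  "L2_sphere = {f. f \<in> borel_measurable sph_measure \<and>
                   integrable sph_measure (\<lambda>x. (cmod (f x))\<^sup>2)}"

definition sprod :: "(sph \<Rightarrow> complex) \<Rightarrow> (sph \<Rightarrow> complex) \<Rightarrow> complex" where
  "sprod f g = (LINT x|sph_measure. cnj (f x) * g x)"

definition L2_norm :: "(sph \<Rightarrow> complex) \<Rightarrow> real" where
  "L2_norm f = sqrt (LINT x|sph_measure. (cmod (f x))\<^sup>2)"


section \<open>Spin weighted spherical harmonics\<close>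

text \<open>Legendre polynomials by Rodrigues' formula. The associated Legendre functions carry no
  Condon-Shortley phase: the sign (-1)^m is part of the definition of the spherical harmonics.\<close>

definition legendre_poly :: "nat \<Rightarrow> real poly" where
  "legendre_poly l = smult (1 / (2 ^ l * fact l)) ((pderiv ^^ l) ([:-1, 0, 1:] ^ l))"

definition assoc_legendre :: "nat \<Rightarrow> nat \<Rightarrow> real \<Rightarrow> real" where
  "assoc_legendre l m t = sqrt (1 - t\<^sup>2) ^ m * poly ((pderiv ^^ m) (legendre_poly l)) t"

definition sph_harm_nonneg :: "nat \<Rightarrow> nat \<Rightarrow> sph \<Rightarrow> complex" where
  "sph_harm_nonneg l m = (\<lambda>(\<theta>, \<phi>).
     (-1) ^ m * of_real (sqrt ((2 * real l + 1) / (4 * pi) * (fact (l - m) / fact (l + m)))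
       * assoc_legendre l m (cos \<theta>)) * cis (real m * \<phi>))"

definition sph_harm :: "nat \<Rightarrow> int \<Rightarrow> sph \<Rightarrow> complex" where
  "sph_harm l m x = (if 0 \<le> m then sph_harm_nonneg l (nat m) x
                     else cnj (sph_harm_nonneg l (nat (- m)) x))"

definition d_theta :: "(sph \<Rightarrow> complex) \<Rightarrow> sph \<Rightarrow> complex" where
  "d_theta f = (\<lambda>(\<theta>, \<phi>). vector_derivative (\<lambda>t. f (t, \<phi>)) (at \<theta>))"

definition d_phi :: "(sph \<Rightarrow> complex) \<Rightarrow> sph \<Rightarrow> complex" where
  "d_phi f = (\<lambda>(\<theta>, \<phi>). vector_derivative (\<lambda>t. f (\<theta>, t)) (at \<phi>))"

text \<open>The first argument is the spin weight of the function the operator is applied to. The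
  functions are differentiated as functions on the whole plane; the values at the poles are
  irrelevant.\<close>

definition eth :: "int \<Rightarrow> (sph \<Rightarrow> complex) \<Rightarrow> sph \<Rightarrow> complex" where
  "eth s f = (\<lambda>(\<theta>, \<phi>). - (d_theta f (\<theta>, \<phi>) + \<i> / of_real (sin \<theta>) * d_phi f (\<theta>, \<phi>)
                            - of_int s * of_real (cot \<theta>) * f (\<theta>, \<phi>)))"

definition eth_bar :: "int \<Rightarrow> (sph \<Rightarrow> complex) \<Rightarrow> sph \<Rightarrow> complex" where
  "eth_bar s f = (\<lambda>(\<theta>, \<phi>). - (d_theta f (\<theta>, \<phi>) - \<i> / of_real (sin \<theta>) * d_phi f (\<theta>, \<phi>)
                                + of_int s * of_real (cot \<theta>) * f (\<theta>, \<phi>)))"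

text \<open>Powers of the operators, starting from a scalar function (spin weight 0).\<close>

fun eth_pow :: "nat \<Rightarrow> (sph \<Rightarrow> complex) \<Rightarrow> sph \<Rightarrow> complex" where
  "eth_pow 0 f = f"
| "eth_pow (Suc k) f = eth (int k) (eth_pow k f)"

fun eth_bar_pow :: "nat \<Rightarrow> (sph \<Rightarrow> complex) \<Rightarrow> sph \<Rightarrow> complex" where
  "eth_bar_pow 0 f = f"
| "eth_bar_pow (Suc k) f = eth_bar (- int k) (eth_bar_pow k f)"

text \<open>Only meaningful for l at least |s| and |m| at most l.\<close>

definition spin_harm :: "int \<Rightarrow> nat \<Rightarrow> int \<Rightarrow> sph \<Rightarrow> complex" where
  "spin_harm s l m x =
     (if 0 \<le> s
      then of_real (sqrt (fact (nat (int l - s)) / fact (nat (int l + s))))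
             * eth_pow (nat s) (sph_harm l m) x
      else of_real (sqrt (fact (nat (int l + s)) / fact (nat (int l - s))))
             * (-1) ^ nat (- s) * eth_bar_pow (nat (- s)) (sph_harm l m) x)"

definition fourier_coeff :: "int \<Rightarrow> (sph \<Rightarrow> complex) \<Rightarrow> nat \<Rightarrow> int \<Rightarrow> complex" where
  "fourier_coeff s f l m = sprod (spin_harm s l m) f"


section \<open>Rotations\<close>

definition SO3 :: "(real^3^3) set" where
  "SO3 = {A. rotation_matrix A}"

definition rot_y :: "real \<Rightarrow> real^3^3" where
  "rot_y b = vector [vector [cos b, 0, sin b], vector [0, 1, 0], vector [- sin b, 0, cos b]]"

definition rot_z :: "real \<Rightarrow> real^3^3" where
  "rot_z a = vector [vector [cos a, - sin a, 0], vector [sin a, cos a, 0], vector [0, 0, 1]]"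

definition euler :: "real \<Rightarrow> real \<Rightarrow> real \<Rightarrow> real^3^3" where
  "euler a b c = rot_z a ** rot_y b ** rot_z c"

text \<open>If the second angle is 0 or pi, only a combination of the other two is determined; then the
  first one is set to 0. For a product of an inverse rotation and Xi as below this happens only on a
  null set, both in the rotation and in the point of the sphere.\<close>

definition third_euler :: "real^3^3 \<Rightarrow> real" where
  "third_euler A = (THE c. c \<in> {0..<2*pi} \<and>
     (\<exists>a\<in>{0..<2*pi}. \<exists>b\<in>{0..pi}. A = euler a b c \<and> (sin b = 0 \<longrightarrow> a = 0)))"

definition rotate_spin :: "int \<Rightarrow> real^3^3 \<Rightarrow> (sph \<Rightarrow> complex) \<Rightarrow> sph \<Rightarrow> complex" where
  "rotate_spin s \<Upsilon> f = (\<lambda>(\<theta>, \<phi>).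
     exp (- \<i> * of_int s * of_real (third_euler (matrix_inv \<Upsilon> ** euler \<phi> \<theta> 0)))
       * f (sph_coords (matrix_inv \<Upsilon> *v sph_point (\<theta>, \<phi>))))"

text \<open>Left invariance determines the measure, since the total mass is prescribed.\<close>

definition haar_SO3 :: "(real^3^3) measure \<Rightarrow> bool" where
  "haar_SO3 \<nu> \<longleftrightarrow> sets \<nu> = sets (restrict_space borel SO3) \<and>
     emeasure \<nu> SO3 = ennreal (8 * pi\<^sup>2) \<and>
     (\<forall>B\<in>SO3. \<forall>E\<in>sets \<nu>. emeasure \<nu> ((\<lambda>A. B ** A) ` E) = emeasure \<nu> E)"


section \<open>Wavelets\<close>

definition weight_function :: "(real \<Rightarrow> real) \<Rightarrow> bool" where
  "weight_function \<alpha> \<longleftrightarrow> (\<forall>\<rho>>0. 0 < \<alpha> \<rho>) \<and>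
     (\<forall>a b. 0 < a \<longrightarrow> (\<exists>T. finite T \<and> continuous_on ({a..b} - T) \<alpha>)) \<and>
     (\<forall>K. compact K \<and> K \<subseteq> {0<..} \<longrightarrow> bounded (\<alpha> ` K))"

text \<open>The last condition is the summability over l at least |s|, written with l = k + |s|.\<close>

definition admissible_wavelet ::
    "int \<Rightarrow> (real \<Rightarrow> real) \<Rightarrow> (real \<Rightarrow> sph \<Rightarrow> complex) \<Rightarrow> bool" where
  "admissible_wavelet s \<alpha> \<Psi> \<longleftrightarrow>
     (\<forall>\<rho>>0. \<Psi> \<rho> \<in> L2_sphere) \<and>
     (\<forall>l. \<bar>s\<bar> \<le> int l \<longrightarrow>
        (\<forall>m\<in>{- int l..int l}.
           set_integrable lebesgue {0<..} (\<lambda>\<rho>. (cmod (fourier_coeff s (\<Psi> \<rho>) l m))\<^sup>2 * \<alpha> \<rho>)) \<and>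
        (\<Sum>m\<in>{- int l..int l}.
           LINT \<rho>:{0<..}|lebesgue. (cmod (fourier_coeff s (\<Psi> \<rho>) l m))\<^sup>2 * \<alpha> \<rho>)
          = (2 * real l + 1) / (8 * pi\<^sup>2)) \<and>
     (\<forall>\<rho>>0. summable (\<lambda>k. let l = k + nat \<bar>s\<bar> in
        real l ^ (2 * nat \<bar>s\<bar>)
          * (\<Sum>m\<in>{- int l..int l}. (cmod (fourier_coeff s (\<Psi> \<rho>) l m))\<^sup>2)))"

definition wavelet_transform ::
    "int \<Rightarrow> (real \<Rightarrow> sph \<Rightarrow> complex) \<Rightarrow> (sph \<Rightarrow> complex) \<Rightarrow> real \<Rightarrow> real^3^3 \<Rightarrow> complex" where
  "wavelet_transform s \<Psi> f \<rho> \<Upsilon> = (LINT x|sph_measure. cnj (rotate_spin s \<Upsilon> (\<Psi> \<rho>) x) * f x)"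

text \<open>The inner integral of the reconstruction formula.\<close>

definition synthesis ::
    "int \<Rightarrow> (real^3^3) measure \<Rightarrow> (real \<Rightarrow> sph \<Rightarrow> complex) \<Rightarrow> (sph \<Rightarrow> complex)
      \<Rightarrow> real \<Rightarrow> sph \<Rightarrow> complex" where
  "synthesis s \<nu> \<Psi> f \<rho> x =
     (LINT \<Upsilon>|\<nu>. rotate_spin s \<Upsilon> (\<Psi> \<rho>) x * wavelet_transform s \<Psi> f \<rho> \<Upsilon>)"

text \<open>The function F is the integral over I of the family G of L2 functions, as a (weak) integral
  with values in the L2 space. The admissibility conditions do not make the integrals of G at
  single points x converge: they allow wavelets for which, with rho running through a bounded
  interval, the functions G rho run through all multipole components of f, one after the other,
  and the sum of these components converges to f in L2 but in general absolutely at almost no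
  point. Wherever the pointwise integral does converge absolutely, its value is required to be
  that of F (up to a null set).\<close>

definition L2_integral_on ::
    "real set \<Rightarrow> (real \<Rightarrow> sph \<Rightarrow> complex) \<Rightarrow> (sph \<Rightarrow> complex) \<Rightarrow> bool" where
  "L2_integral_on I G F \<longleftrightarrow> F \<in> L2_sphere \<and> (\<forall>\<rho>\<in>I. G \<rho> \<in> L2_sphere) \<and>
     (\<forall>h\<in>L2_sphere. set_integrable lebesgue I (\<lambda>\<rho>. sprod h (G \<rho>)) \<and>
                     sprod h F = (LINT \<rho>:I|lebesgue. sprod h (G \<rho>))) \<and>
     (AE x in sph_measure. set_integrable lebesgue I (\<lambda>\<rho>. G \<rho> x) \<longrightarrow>
                           F x = (LINT \<rho>:I|lebesgue. G \<rho> x))"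

end

theory Submission
  imports Defs
begin

text \<open>At a fixed scale, synthesis after analysis is a Fourier multiplier. Lifted to SO(3), the
  spin weighted harmonics become matrix coefficients of the irreducible representations, and the
  Schur orthogonality of these turns the integral over the rotations into multiplication of the
  component of degree l of f by 8 pi^2 / (2 l + 1) times the power of the wavelet in degree l. By
  admissibility these factors, integrated over all scales with weight alpha, give 1. The integral
  over the scales from R to 1 / R is therefore a multiplier with values between 0 and 1 which tend to 1
  as R tends to 0, and dominated convergence for the series of the powers of f gives the limit in L2.

  The harmonics are accessible through the representations of SU(2) on homogeneous polynomials:
  with half angles, the matrix coefficients are coefficients of products of powers of linear
  polynomials, on which the operators eth and eth-bar act by shifting the exponents.\<close>

section \<open>Representations of SU(2)\<close>

text \<open>Three obstacles shape the proof. Spin rotations involve the third Euler angle, which is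
  discontinuous; lifted to SO(3), they are left translations, and the phase becomes the torus weight
  of column l - s. Next, rotation invariance of the measure in coordinates, completeness and
  orthonormality of the harmonics are derived algebraically: for fixed s and m the harmonics are one
  function times polynomials in cos theta of every degree, so a functional that vanishes on all
  harmonics vanishes on suitable moments, and moments determine measures on the sphere;
  orthonormality follows by averaging over SO(3). Finally, the derivatives behind the harmonics may
  fail to exist at the poles, which calls for measurability of default values, and the integrals
  over the scales may diverge pointwise, which calls for weak integrals.

  Schur orthogonality is obtained without Schur's lemma: rotations about the z-axis separate the
  weights, and one quarter turn about the y-axis, whose top row has no zero entry, links them
  all.\<close>

definition homogenize :: "nat \<Rightarrow> complex poly \<Rightarrow> complex poly \<Rightarrow> complex poly \<Rightarrow> complex poly" where
  "homogenize n F X Y = (\<Sum>i\<le>n. smult (coeff F i) (X ^ (n - i) * Y ^ i))"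

text \<open>Formally \<open>homogenize n F X Y\<close> is X^n F(Y / X), the form of degree n that
  belongs to F, evaluated at X and Y. The bound on the degree of F makes the term i = n + 1 of the
  first sum vanish, so that every remaining term has a factor X to split off.\<close>

lemma homogenize_linear_mult:
  assumes "degree F \<le> n"
  shows "homogenize (Suc n) ([:a, b:] * F) X Y = (smult a X + smult b Y) * homogenize n F X Y"
proof -
  have F0: "coeff F (Suc n) = 0" using assms by (simp add: coeff_eq_0)
  have c: "coeff ([:a, b:] * F) i = a * coeff F i + (case i of 0 \<Rightarrow> 0 | Suc k \<Rightarrow> b * coeff F k)" for i
    by (simp add: coeff_pCons split: nat.split)
  have "homogenize (Suc n) ([:a, b:] * F) X Y =
     (\<Sum>i\<le>Suc n. smult (a * coeff F i) (X ^ (Suc n - i) * Y ^ i)) +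
     (\<Sum>i\<le>Suc n. smult (case i of 0 \<Rightarrow> 0 | Suc k \<Rightarrow> b * coeff F k) (X ^ (Suc n - i) * Y ^ i))"
    unfolding homogenize_def c by (simp add: smult_add_left sum.distrib del: sum.atMost_Suc)
  also have "(\<Sum>i\<le>Suc n. smult (a * coeff F i) (X ^ (Suc n - i) * Y ^ i)) = smult a X * homogenize n F X Y"
    unfolding homogenize_def sum_distrib_left by (auto simp: F0 Suc_diff_le mult_ac intro!: sum.cong)
  also have "(\<Sum>i\<le>Suc n. smult (case i of 0 \<Rightarrow> 0 | Suc k \<Rightarrow> b * coeff F k) (X ^ (Suc n - i) * Y ^ i))
      = smult b Y * homogenize n F X Y"
    unfolding homogenize_def sum_distrib_left sum.atMost_Suc_shift by (auto simp: mult_ac intro!: sum.cong)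
  finally show ?thesis by (simp add: algebra_simps)
qed

lemma degree_linear_power_mult_le:
  "degree ([:a, b:] ^ p * [:c, d:] ^ q) \<le> p + q" for a b c d :: complex
proof -
  have "degree ([:a, b:] ^ p) \<le> p" for p and a b :: complex
    by (rule order.trans[OF degree_power_le]) simp
  then show ?thesis by (meson add_mono degree_mult_le order.trans)
qed

text \<open>Evaluation of forms is multiplicative; peeling off one linear factor at a time keeps the
  formal degree in step with the number of factors.\<close>

lemma homogenize_linear_power_mult:
  "homogenize (p + q) ([:a, b:] ^ p * [:c, d:] ^ q) X Y =
     (smult a X + smult b Y) ^ p * (smult c X + smult d Y) ^ q"
proof (induction p)
  case 0
  show ?case
  proof (induction q)
    case 0
    show ?case by (simp add: homogenize_def)
  next
    case (Suc q)
    have "degree ([:c, d:] ^ q) \<le> q" using degree_linear_power_mult_le[of a b 0 c d q] by simp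
    from homogenize_linear_mult[OF this, of c d X Y] Suc show ?case by (simp add: mult_ac)
  qed
next
  case (Suc p)
  from homogenize_linear_mult[of "[:a, b:] ^ p * [:c, d:] ^ q" "p + q" a b X Y, OF degree_linear_power_mult_le] Suc
  show ?case by (simp only: power_Suc add_Suc mult.assoc)
qed

text \<open>The image of the monomial x^p y^q under the substitution x -> a x + b y, y -> - cnj b x
  + cnj a y, dehomogenized by x = 1, y = t.\<close>

definition spin_poly :: "complex \<Rightarrow> complex \<Rightarrow> nat \<Rightarrow> nat \<Rightarrow> complex poly" where
  "spin_poly a b p q = [:a, b:] ^ p * [:- cnj b, cnj a:] ^ q"

text \<open>Matrix coefficients of the representation of SU(2) on homogeneous polynomials of degree n,
  in a basis that is orthonormal for the invariant inner product. The pair (a, b) is the first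
  column of an element of SU(2), and the multiplication of such elements is spin_mult.\<close>

definition dmat :: "nat \<Rightarrow> nat \<Rightarrow> nat \<Rightarrow> complex \<times> complex \<Rightarrow> complex" where
  "dmat n j k u = of_real (sqrt (fact j * fact (n - j) / (fact k * fact (n - k)))) *
     coeff (spin_poly (fst u) (snd u) (n - k) k) j"

definition spin_mult :: "complex \<times> complex \<Rightarrow> complex \<times> complex \<Rightarrow> complex \<times> complex" where
  "spin_mult h u = (fst h * fst u - cnj (snd h) * snd u, snd h * fst u + cnj (fst h) * snd u)"

text \<open>The first column of the conjugate transpose of the matrix represented by u, hence the
  inverse on SU(2).\<close>

definition spin_adj :: "complex \<times> complex \<Rightarrow> complex \<times> complex" where
  "spin_adj u = (cnj (fst u), - snd u)"

definition SU2 :: "(complex \<times> complex) set" where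
  "SU2 = {u. (cmod (fst u))\<^sup>2 + (cmod (snd u))\<^sup>2 = 1}"

lemma spin_poly_spin_mult:
  "spin_poly (fst (spin_mult h u)) (snd (spin_mult h u)) p q =
     homogenize (p + q) (spin_poly (fst u) (snd u) p q) [:fst h, snd h:] [:- cnj (snd h), cnj (fst h):]"
  unfolding spin_poly_def homogenize_linear_power_mult by (simp add: spin_mult_def algebra_simps)

lemma dmat_spin_mult:
  assumes "k \<le> n"
  shows "dmat n j k (spin_mult h u) = (\<Sum>i\<le>n. dmat n j i h * dmat n i k u)"
proof -
  let ?c = "\<lambda>i. fact i * fact (n - i) :: real"
  \<comment> \<open>The normalizing factors telescope: the intermediate index i cancels between the
    two matrices.\<close>
  have s: "complex_of_real (sqrt (?c j / ?c i)) * of_real (sqrt (?c i / ?c k)) = of_real (sqrt (?c j / ?c k))" for i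
    unfolding of_real_mult[symmetric] real_sqrt_mult[symmetric] by simp
  have "coeff (spin_poly (fst (spin_mult h u)) (snd (spin_mult h u)) (n - k) k) j =
     (\<Sum>i\<le>n. coeff (spin_poly (fst u) (snd u) (n - k) k) i * coeff (spin_poly (fst h) (snd h) (n - i) i) j)"
    unfolding spin_poly_spin_mult homogenize_def using assms
    by (simp add: coeff_sum spin_poly_def[of "fst h"])
  then have "dmat n j k (spin_mult h u) = (\<Sum>i\<le>n. of_real (sqrt (?c j / ?c k)) *
      (coeff (spin_poly (fst u) (snd u) (n - k) k) i * coeff (spin_poly (fst h) (snd h) (n - i) i) j))"
    by (simp only: dmat_def sum_distrib_left)
  also have "\<dots> = (\<Sum>i\<le>n. dmat n j i h * dmat n i k u)"
  proof (intro sum.cong refl)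
    fix i
    show "of_real (sqrt (?c j / ?c k)) * (coeff (spin_poly (fst u) (snd u) (n - k) k) i *
        coeff (spin_poly (fst h) (snd h) (n - i) i) j) = dmat n j i h * dmat n i k u"
      unfolding s[of i, symmetric] dmat_def by (simp only: mult_ac)
  qed
  finally show ?thesis .
qed

lemma dmat_one:
  assumes "j \<le> n" "k \<le> n"
  shows "dmat n j k (1, 0) = (if j = k then 1 else 0)"
proof -
  have "spin_poly 1 0 (n - k) k = monom 1 k"
    by (simp add: spin_poly_def monom_altdef one_pCons[symmetric])
  then show ?thesis by (simp add: dmat_def)
qed

lemma dmat_diag:
  assumes "j \<le> n" "k \<le> n"
  shows "dmat n j k (w, 0) = (if j = k then w ^ (n - k) * cnj w ^ k else 0)"
proof -
  have "[:w:] ^ (n - k) = [:w ^ (n - k):]"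
    by (metis poly_const_pow)
  moreover have "[:0, cnj w:] = smult (cnj w) [:0, 1:]" by simp
  ultimately have "spin_poly w 0 (n - k) k = smult (w ^ (n - k) * cnj w ^ k) (monom 1 k)"
    by (simp add: spin_poly_def monom_altdef smult_power del: smult_pCons) (simp only: mult.commute)
  then show ?thesis by (simp add: dmat_def)
qed

text \<open>Both sides are coefficients of the same polynomial
  (h + g t + u (- cnj g + cnj h t)) ^ n in two variables t, u.\<close>

lemma binomial_coeff_spin_poly_adj:
  assumes "j \<le> n" "k \<le> n"
  shows "of_nat (n choose k) * coeff (spin_poly h g (n - k) k) j =
    of_nat (n choose j) * cnj (coeff (spin_poly (cnj h) (- g) (n - j) j) k)"
proof -
  define A where "A j = [:h, - cnj g:] ^ (n - j) * [:g, cnj h:] ^ j" for j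
  have A: "cnj (coeff (spin_poly (cnj h) (- g) (n - j) j) k) = coeff (A j) k" for j k
  proof -
    have mm: "map_poly cnj (p * q) = map_poly cnj p * map_poly cnj q" for p q
      by (simp add: poly_eq_iff coeff_mult coeff_map_poly)
    have m: "map_poly cnj (p ^ m) = map_poly cnj p ^ m" for p m
      by (induction m) (simp_all add: mm)
    have "map_poly cnj (spin_poly (cnj h) (- g) (n - j) j) = A j"
      unfolding spin_poly_def A_def mm m by (simp add: map_poly_pCons del: mult_pCons_left mult_pCons_right)
    then show ?thesis by (metis coeff_map_poly complex_cnj_zero)
  qed
  have "poly (smult (of_nat (n choose k)) (spin_poly h g (n - k) k)) t =
     poly (\<Sum>j\<le>n. monom (of_nat (n choose j) * coeff (A j) k) j) t" for t
  proof -
    have l: "[:0, x:] = smult x [:0, 1:]" for x :: complex by simp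
    define F where "F = [:h + g * t, - cnj g + cnj h * t:] ^ n"
    have "F = ([:h + g * t:] + [:0, - cnj g + cnj h * t:]) ^ n" by (simp add: F_def)
    also have "\<dots> = (\<Sum>k\<le>n. of_nat (n choose k) * [:h + g * t:] ^ (n - k) * [:0, - cnj g + cnj h * t:] ^ k)"
      by (subst add.commute, subst binomial_ring) (simp add: mult_ac)
    also have "\<dots> = (\<Sum>k\<le>n. monom (of_nat (n choose k) * (h + g * t) ^ (n - k) * (- cnj g + cnj h * t) ^ k) k)"
      unfolding l[of "- cnj g + cnj h * t"]
      by (intro sum.cong refl)
        (simp add: poly_const_pow of_nat_poly monom_altdef smult_power mult_ac del: smult_pCons)
    finally have "coeff F k = of_nat (n choose k) * (h + g * t) ^ (n - k) * (- cnj g + cnj h * t) ^ k"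
      using assms by (simp add: coeff_sum)
    moreover have "F = ([:h, - cnj g:] + smult t [:g, cnj h:]) ^ n" by (simp add: F_def mult_ac)
    then have "F = (\<Sum>j\<le>n. smult (of_nat (n choose j) * t ^ j) (A j))"
      unfolding A_def by (subst (asm) add.commute, subst (asm) binomial_ring)
        (simp add: mult_ac smult_power of_nat_poly del: smult_pCons)
    then have "coeff F k = (\<Sum>j\<le>n. of_nat (n choose j) * t ^ j * coeff (A j) k)" by (simp add: coeff_sum)
    ultimately show ?thesis by (simp add: spin_poly_def poly_sum poly_monom mult_ac)
  qed
  then have "smult (of_nat (n choose k)) (spin_poly h g (n - k) k) =
     (\<Sum>j\<le>n. monom (of_nat (n choose j) * coeff (A j) k) j)"
    by (intro poly_ext)
  from arg_cong[OF this, of "\<lambda>p. coeff p j"] assms show ?thesis by (simp add: coeff_sum A)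
qed

text \<open>The binomial coefficients in the preceding symmetry are n! / (i! (n - i)!). The square
  roots in \<open>dmat\<close> distribute these factorials evenly over rows and columns, which turns
  the symmetry into unitarity.\<close>

lemma dmat_adj:
  assumes "j \<le> n" "k \<le> n"
  shows "dmat n j k (spin_adj u) = cnj (dmat n k j u)"
proof -
  let ?c = "\<lambda>i. fact i * fact (n - i) :: real"
  have b: "real (n choose i) = fact n / ?c i" if "i \<le> n" for i
    using that by (simp add: binomial_fact)
  define X where "X = coeff (spin_poly (cnj (fst u)) (- snd u) (n - k) k) j"
  define Y where "Y = cnj (coeff (spin_poly (fst u) (snd u) (n - j) j) k)"
  have "of_real (real (n choose k)) * X = of_real (real (n choose j)) * Y"
    using binomial_coeff_spin_poly_adj[OF assms, of "cnj (fst u)" "- snd u"] by (simp add: X_def Y_def)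
  then have "complex_of_real (fact n / ?c k) * X = of_real (fact n / ?c j) * Y"
    by (simp only: b[OF assms(1)] b[OF assms(2)])
  then have *: "X = of_real (?c k / ?c j) * Y"
    by (simp add: field_simps)
  have **: "a * X = c * Y" if "X = b * Y" "a * b = c" for a b c :: complex
    using that by (simp add: mult.assoc[symmetric])
  have "sqrt (?c j / ?c k) * (?c k / ?c j) = sqrt (?c k / ?c j)"
    by (simp add: real_sqrt_divide real_div_sqrt field_simps)
  then have sq: "complex_of_real (sqrt (?c j / ?c k)) * of_real (?c k / ?c j) = of_real (sqrt (?c k / ?c j))"
    by (metis of_real_mult)
  show ?thesis
    using **[OF * sq] unfolding dmat_def X_def Y_def spin_adj_def
    by (simp only: fst_conv snd_conv complex_cnj_mult complex_cnj_complex_of_real)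
qed

lemma spin_adj_SU2: "u \<in> SU2 \<Longrightarrow> spin_adj u \<in> SU2"
  by (auto simp: SU2_def spin_adj_def)

lemma SU2_alt: "u \<in> SU2 \<longleftrightarrow> fst u * cnj (fst u) + snd u * cnj (snd u) = 1"
  unfolding SU2_def mem_Collect_eq complex_norm_square[symmetric]
  by (metis (mono_tags) of_real_1 of_real_add of_real_eq_iff of_real_power)

lemma spin_adj_mult: "u \<in> SU2 \<Longrightarrow> spin_mult (spin_adj u) u = (1, 0)"
  by (auto simp: SU2_alt spin_adj_def spin_mult_def mult_ac)

lemma dmat_orthonormal_columns:
  assumes "u \<in> SU2" "j \<le> n" "k \<le> n"
  shows "(\<Sum>i\<le>n. cnj (dmat n i j u) * dmat n i k u) = (if j = k then 1 else 0)"
proof -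
  have "(\<Sum>i\<le>n. cnj (dmat n i j u) * dmat n i k u) = (\<Sum>i\<le>n. dmat n j i (spin_adj u) * dmat n i k u)"
    using assms by (intro sum.cong) (auto simp: dmat_adj)
  also have "\<dots> = dmat n j k (1, 0)"
    using assms by (simp add: dmat_spin_mult[symmetric] spin_adj_mult)
  finally show ?thesis using assms by (simp add: dmat_one)
qed

lemma dmat_orthonormal_rows:
  assumes "u \<in> SU2" "j \<le> n" "k \<le> n"
  shows "(\<Sum>i\<le>n. dmat n j i u * cnj (dmat n k i u)) = (if j = k then 1 else 0)"
  using dmat_orthonormal_columns[OF spin_adj_SU2[OF assms(1)] assms(2,3)] assms
  by (simp add: dmat_adj cong: sum.cong_simp)

text \<open>Multiplying u from the right by the diagonal element with entries w,
  \<open>cnj w\<close> only scales the two linear factors, so each column is a weight vector of the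
  torus. The value w = -1 gives the parity of the representation, and w = exp(- i c / 2) the phase
  of spin rotations.\<close>

lemma dmat_phase:
  "dmat n j k (fst u * w, snd u * w) = w ^ (n - k) * cnj w ^ k * dmat n j k u"
proof -
  have "[:a * w, b * w:] = smult w [:a, b:]" for a b by (simp add: mult_ac)
  moreover have "[:- (cnj b * cnj w), cnj a * cnj w:] = smult (cnj w) [:- cnj b, cnj a:]" for a b by (simp add: mult_ac)
  ultimately have "spin_poly (a * w) (b * w) p q = smult (w ^ p * cnj w ^ q) (spin_poly a b p q)" for a b p q
    by (simp add: spin_poly_def smult_power mult_ac del: smult_pCons)
  then show ?thesis by (simp add: dmat_def)
qed

text \<open>The factor is (-1)^n. A representation of even degree therefore does not separate the
  two preimages of a rotation and descends to SO(3).\<close>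

lemma dmat_uminus:
  assumes "even n" "k \<le> n"
  shows "dmat n j k (- u) = dmat n j k u"
  using dmat_phase[of n j k u "-1"] assms
  by (simp add: power_add[symmetric] prod_eq_iff uminus_prod_def)

text \<open>Only the leading coefficients of the two powers reach degree n, so the last row consists
  of monomials in the entries of u. It has no zero if both entries of u are nonzero, which is what
  the orthogonality argument relies on.\<close>

lemma dmat_top_row:
  assumes "k \<le> n"
  shows "dmat n n k u = of_real (sqrt (fact n / (fact k * fact (n - k)))) * snd u ^ (n - k) * cnj (fst u) ^ k"
proof -
  have lin: "coeff ([:a, b:] ^ m) m = b ^ m" for a b :: complex and m
  proof (induction m)
    case (Suc m)
    have "coeff ([:a, b:] ^ m) (Suc m) = 0"
      using degree_linear_power_mult_le[of a b m a b 0] by (intro coeff_eq_0) simp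
    with Suc show ?case by simp
  qed simp
  have deg: "degree ([:a, b:] ^ m) \<le> m" for a b :: complex and m
    using degree_linear_power_mult_le[of a b m a b 0] by simp
  have "coeff ([:a, b:] ^ p * [:c, d:] ^ q) (p + q) = b ^ p * d ^ q" for a b c d :: complex and p q
  proof -
    have "coeff ([:a, b:] ^ p * [:c, d:] ^ q) (p + q) =
      (\<Sum>i\<le>p + q. if i = p then b ^ p * d ^ q else 0)"
      unfolding coeff_mult
    proof (intro sum.cong refl)
      fix i assume "i \<in> {..p + q}"
      then show "coeff ([:a, b:] ^ p) i * coeff ([:c, d:] ^ q) (p + q - i) = (if i = p then b ^ p * d ^ q else 0)"
        using deg[of a b p] deg[of c d q] lin
        by (cases i p rule: linorder_cases) (auto simp: coeff_eq_0)
    qed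
    then show ?thesis by simp
  qed
  from this[of "fst u" "snd u" "n - k" "- cnj (snd u)" "cnj (fst u)" k] assms show ?thesis
    by (simp add: dmat_def spin_poly_def)
qed

section \<open>Spin weighted harmonics as matrix coefficients\<close>

text \<open>A lift to SU(2) of the rotation with Euler angles (phi, theta, 0), which takes the north
  pole to the point with coordinates (theta, phi).\<close>

definition spinor :: "real \<Rightarrow> real \<Rightarrow> complex \<times> complex" where
  "spinor \<theta> \<phi> = (of_real (cos (\<theta> / 2)) * cis (- \<phi> / 2), of_real (sin (\<theta> / 2)) * cis (\<phi> / 2))"

text \<open>A matrix coefficient without its normalization, as a function on the sphere. For spin
  weight s, degree l and order m the indices are p = l + s, q = l - s, j = l + m.\<close>

definition spin_fun :: "nat \<Rightarrow> nat \<Rightarrow> nat \<Rightarrow> real \<Rightarrow> real \<Rightarrow> complex" where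
  "spin_fun p q j \<theta> \<phi> = coeff (spin_poly (fst (spinor \<theta> \<phi>)) (snd (spinor \<theta> \<phi>)) p q) j"

definition spin_fun_real :: "nat \<Rightarrow> nat \<Rightarrow> nat \<Rightarrow> real \<Rightarrow> real" where
  "spin_fun_real p q j \<theta> = coeff ([:cos (\<theta> / 2), sin (\<theta> / 2):] ^ p * [:- sin (\<theta> / 2), cos (\<theta> / 2):] ^ q) j"

lemma spinor_SU2: "spinor \<theta> \<phi> \<in> SU2"
  by (simp add: SU2_def spinor_def norm_mult)

lemma coeff_linear_power:
  fixes a b :: "'a :: comm_ring_1"
  shows "coeff ([:a, b:] ^ n) i = of_nat (n choose i) * b ^ i * a ^ (n - i)"
proof (cases "i \<le> n")
  case False
  have "degree ([:a, b:] ^ n) \<le> n"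
    by (rule order.trans[OF degree_power_le]) simp
  with False show ?thesis by (simp add: coeff_eq_0 binomial_eq_0)
qed (rule coeff_linear_poly_power)

lemma pcompose_power: "pcompose (p ^ n) r = pcompose p r ^ n" for p r :: "'a :: comm_ring_1 poly"
  by (induction n) (simp_all add: pcompose_mult pcompose_1)

text \<open>With w = exp(i phi / 2), both linear factors arise from their values at phi = 0 by the
  substitution t -> w^2 t and a factor \<open>cnj w\<close>. The coefficient of t^j thus acquires
  w^(2 j - p - q), which is exp(i m phi) for the indices of a harmonic of order m.\<close>

lemma spin_fun_eq:
  "spin_fun p q j \<theta> \<phi> = cis ((real j - real (p + q) / 2) * \<phi>) * of_real (spin_fun_real p q j \<theta>)"
proof -
  define w where "w = cis (\<phi> / 2)"
  have w: "cis (- (\<phi> / 2)) = cnj w" "cnj w * w = 1" "cnj w * w\<^sup>2 = w"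
    by (simp_all add: w_def cis_cnj cis_mult power2_eq_square)
  define a b where "a = complex_of_real (cos (\<theta> / 2))" and "b = complex_of_real (sin (\<theta> / 2))"
  have P: "[:a * cnj w, b * w:] = smult (cnj w) (pcompose [:a, b:] [:0, w\<^sup>2:])"
    and Q: "[:- (cnj b * cnj w), cnj a * w:] = smult (cnj w) (pcompose [:- cnj b, cnj a:] [:0, w\<^sup>2:])"
    using w by (simp_all add: pcompose_pCons mult_ac)
  have "spin_fun p q j \<theta> \<phi> = cnj w ^ (p + q) * (w\<^sup>2) ^ j * coeff ([:a, b:] ^ p * [:- cnj b, cnj a:] ^ q) j"
    using P Q w(1) unfolding spin_fun_def spin_poly_def spinor_def a_def[symmetric] b_def[symmetric] w_def[symmetric]
    by (simp add: smult_power pcompose_power[symmetric] pcompose_mult[symmetric] coeff_pcompose_linear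
        power_add mult_ac minus_divide_left[symmetric] w_def[symmetric] del: smult_pCons pcompose_pCons)
  also have "cnj w ^ (p + q) * (w\<^sup>2) ^ j = cis ((real j - real (p + q) / 2) * \<phi>)"
  proof -
    have "cnj w ^ (p + q) = cis (real (p + q) * (- (\<phi> / 2)))" "(w\<^sup>2) ^ j = cis (real (2 * j) * (\<phi> / 2))"
      unfolding w_def cis_cnj power_mult[symmetric] by (rule Complex.DeMoivre)+
    then show ?thesis by (simp only: cis_mult) (simp add: algebra_simps)
  qed
  also have "coeff ([:a, b:] ^ p * [:- cnj b, cnj a:] ^ q) j = of_real (spin_fun_real p q j \<theta>)"
    by (simp add: spin_fun_real_def coeff_mult coeff_linear_power a_def b_def)
  finally show ?thesis .
qed

text \<open>Up to a constant, a Jacobi polynomial in z = cos theta. It is what remains of the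
  convolution sum for coefficient j once the powers of cos(theta / 2) and sin(theta / 2) common to
  all terms are removed, with (1 + z) / 2 and (1 - z) / 2 in place of the squares of these
  functions.\<close>

definition jacobi_poly :: "nat \<Rightarrow> nat \<Rightarrow> nat \<Rightarrow> complex poly" where
  "jacobi_poly p q j = (\<Sum>i = j - q..min p j.
     smult ((-1) ^ (q - (j - i)) * of_nat (p choose i) * of_nat (q choose (j - i)))
       ([:1 / 2, 1 / 2:] ^ (min p j - i) * [:1 / 2, - 1 / 2:] ^ (i - (j - q))))"

text \<open>Term i contains cos(theta / 2) to the power p + j - 2 i and sin(theta / 2) to the power
  q - j + 2 i. The parities do not depend on i, so beyond the lowest powers |p - j| and |q - j| only
  squares occur. The sums of truncated differences in the exponents encode these absolute
  values.\<close>

lemma spin_fun_real_eq_jacobi: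
  assumes "j \<le> p + q"
  shows "of_real (spin_fun_real p q j \<theta>) =
    of_real (cos (\<theta> / 2)) ^ ((p - j) + (j - p)) * of_real (sin (\<theta> / 2)) ^ ((q - j) + (j - q)) *
      poly (jacobi_poly p q j) (of_real (cos \<theta>))"
proof -
  define a b where "a = complex_of_real (cos (\<theta> / 2))" and "b = complex_of_real (sin (\<theta> / 2))"
  have "complex_of_real (cos \<theta>) = of_real (2 * (cos (\<theta> / 2))\<^sup>2 - 1)"
    and "complex_of_real (cos \<theta>) = of_real (1 - 2 * (sin (\<theta> / 2))\<^sup>2)"
    using cos_double_cos[of "\<theta> / 2"] cos_double_sin[of "\<theta> / 2"] by simp_all
  then have ca: "complex_of_real (cos \<theta>) = 2 * a\<^sup>2 - 1" and cb: "complex_of_real (cos \<theta>) = 1 - 2 * b\<^sup>2"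
    by (simp_all add: a_def b_def)
  have ha: "poly [:1 / 2, 1 / 2:] (complex_of_real (cos \<theta>)) = a\<^sup>2" unfolding ca by (simp add: field_simps)
  have hb: "poly [:1 / 2, - 1 / 2:] (complex_of_real (cos \<theta>)) = b\<^sup>2" unfolding cb by (simp add: field_simps)
  have "of_real (spin_fun_real p q j \<theta>) = (\<Sum>i\<le>j. of_nat (p choose i) * b ^ i * a ^ (p - i) *
      (of_nat (q choose (j - i)) * a ^ (j - i) * (- b) ^ (q - (j - i))))"
    by (simp add: spin_fun_real_def coeff_mult coeff_linear_power a_def b_def)
  also have "\<dots> = (\<Sum>i = j - q..min p j. of_nat (p choose i) * b ^ i * a ^ (p - i) *
      (of_nat (q choose (j - i)) * a ^ (j - i) * (- b) ^ (q - (j - i))))"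
    by (intro sum.mono_neutral_right) (auto simp: binomial_eq_0)
  also have "\<dots> = (\<Sum>i = j - q..min p j. a ^ ((p - j) + (j - p)) * b ^ ((q - j) + (j - q)) *
      ((-1) ^ (q - (j - i)) * of_nat (p choose i) * of_nat (q choose (j - i)) *
       ((a\<^sup>2) ^ (min p j - i) * (b\<^sup>2) ^ (i - (j - q)))))"
  proof (intro sum.cong refl)
    fix i assume i: "i \<in> {j - q..min p j}"
    have ea: "(p - i) + (j - i) = ((p - j) + (j - p)) + 2 * (min p j - i)"
      and eb: "i + (q - (j - i)) = ((q - j) + (j - q)) + 2 * (i - (j - q))"
      using i by auto
    have "a ^ (p - i) * a ^ (j - i) = a ^ ((p - j) + (j - p)) * (a\<^sup>2) ^ (min p j - i)"
      unfolding power_mult[symmetric] power_add[symmetric] ea ..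
    note ha = this
    have "b ^ i * (- b) ^ (q - (j - i)) = (-1) ^ (q - (j - i)) * (b ^ ((q - j) + (j - q)) * (b\<^sup>2) ^ (i - (j - q)))"
      unfolding power_mult[symmetric] power_add[symmetric] eb[symmetric] power_minus[of b]
      by (simp add: power_add mult_ac)
    note hb = this
    have "c * x * y * (d * z * w) = c * d * (y * z) * (x * w)" for c d x y z w :: complex
      by (simp add: mult_ac)
    note hc = this
    show "of_nat (p choose i) * b ^ i * a ^ (p - i) *
      (of_nat (q choose (j - i)) * a ^ (j - i) * (- b) ^ (q - (j - i))) =
      a ^ ((p - j) + (j - p)) * b ^ ((q - j) + (j - q)) *
      ((-1) ^ (q - (j - i)) * of_nat (p choose i) * of_nat (q choose (j - i)) *
       ((a\<^sup>2) ^ (min p j - i) * (b\<^sup>2) ^ (i - (j - q))))"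
      unfolding hc ha hb by (simp only: mult_ac)
  qed
  finally show ?thesis
    unfolding jacobi_poly_def poly_sum poly_smult poly_mult poly_power ha hb a_def[symmetric] b_def[symmetric]
    by (simp only: sum_distrib_left)
qed

text \<open>All summands have the same degree, and their leading coefficients share the sign (-1)^(q
  - j): the alternating signs of the sum are compensated by those of the factors (1 - z) / 2. Hence
  nothing cancels.\<close>

lemma jacobi_poly_degree:
  assumes "j \<le> p + q"
  shows "degree (jacobi_poly p q j) = min p j - (j - q)" and "jacobi_poly p q j \<noteq> 0"
proof -
  define N where "N = min p j - (j - q)"
  have eN: "N = min p j - i + (i - (j - q))" if "i \<in> {j - q..min p j}" for i
    using that by (auto simp: N_def)
  have degN: "degree ([:1 / 2, 1 / 2:] ^ (min p j - i) * [:1 / 2, - 1 / 2:] ^ (i - (j - q)) :: complex poly) \<le> N"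
    if "i \<in> {j - q..min p j}" for i
    unfolding eN[OF that] by (rule degree_linear_power_mult_le)
  have le: "degree (jacobi_poly p q j) \<le> min p j - (j - q)"
    unfolding jacobi_poly_def N_def[symmetric]
    by (intro degree_sum_le finite_atLeastAtMost order.trans[OF degree_smult_le degN])
  have top: "coeff ([:1 / 2, 1 / 2:] ^ r * [:1 / 2, - 1 / 2:] ^ t :: complex poly) (r + t) = (-1) ^ t / 2 ^ (r + t)" for r t
  proof -
    have "lead_coeff ([:1 / 2, 1 / 2:] ^ r * [:1 / 2, - 1 / 2:] ^ t :: complex poly) = (1 / 2) ^ r * (- 1 / 2) ^ t"
      by (simp add: lead_coeff_mult lead_coeff_power)
    moreover have "degree ([:1 / 2, 1 / 2:] ^ r * [:1 / 2, - 1 / 2:] ^ t :: complex poly) = r + t"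
      by (simp add: degree_mult_eq degree_power_eq)
    ultimately show ?thesis by (simp add: power_minus[of "1 / 2 :: complex"] power_divide power_add)
  qed
  have "coeff (jacobi_poly p q j) N = (\<Sum>i = j - q..min p j.
      ((-1) ^ (q - (j - i)) * of_nat (p choose i) * of_nat (q choose (j - i))) * ((-1) ^ (i - (j - q)) / 2 ^ N))"
    unfolding jacobi_poly_def coeff_sum coeff_smult
    by (intro sum.cong refl arg_cong2[of _ _ _ _ "(*)"]) (metis eN top)
  also have "\<dots> = (\<Sum>i = j - q..min p j. (-1) ^ (q - j) * of_nat ((p choose i) * (q choose (j - i))) / 2 ^ N)"
  proof (intro sum.cong refl)
    fix i assume i: "i \<in> {j - q..min p j}"
    have "q - (j - i) + (i - (j - q)) = q - j + 2 * (i - (j - q))"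
      using i by auto
    then have "(-1) ^ (q - (j - i)) * (-1) ^ (i - (j - q)) = ((-1) ^ (q - j) :: complex)"
      unfolding power_add[symmetric] by (simp add: power_add)
    then show "(-1) ^ (q - (j - i)) * of_nat (p choose i) * of_nat (q choose (j - i)) * ((-1) ^ (i - (j - q)) / 2 ^ N)
       = (-1) ^ (q - j) * of_nat ((p choose i) * (q choose (j - i))) / (2 ^ N :: complex)"
      by (simp add: mult_ac)
  qed
  also have "\<dots> = (-1) ^ (q - j) / 2 ^ N * of_nat (\<Sum>i = j - q..min p j. (p choose i) * (q choose (j - i)))"
    by (simp add: sum_distrib_left)
  finally have c: "coeff (jacobi_poly p q j) N =
    (-1) ^ (q - j) / 2 ^ N * of_nat (\<Sum>i = j - q..min p j. (p choose i) * (q choose (j - i)))" .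
  have "(\<Sum>i = j - q..min p j. (p choose i) * (q choose (j - i))) > 0"
    using assms by (intro sum_pos) auto
  then have "(of_nat (\<Sum>i = j - q..min p j. (p choose i) * (q choose (j - i))) :: complex) \<noteq> 0"
    by (simp only: of_nat_eq_0_iff)
  then have nz: "coeff (jacobi_poly p q j) N \<noteq> 0"
    unfolding c by (simp del: of_nat_sum of_nat_mult)
  then show "degree (jacobi_poly p q j) = min p j - (j - q)"
    using le le_degree[OF nz] by (simp add: N_def)
  show "jacobi_poly p q j \<noteq> 0" using nz by auto
qed

section \<open>The operators eth and eth-bar on matrix coefficients\<close>

text \<open>Differentiation of curves of polynomials, coefficient by coefficient; it allows the
  product rule to be applied to the linear factors before a coefficient is extracted.\<close>

definition has_poly_derivative :: "(real \<Rightarrow> complex poly) \<Rightarrow> complex poly \<Rightarrow> real \<Rightarrow> bool" where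
  "has_poly_derivative F D x \<longleftrightarrow> (\<forall>j. ((\<lambda>t. coeff (F t) j) has_vector_derivative coeff D j) (at x))"

lemma has_poly_derivative_mult:
  assumes "has_poly_derivative F D x" "has_poly_derivative G E x"
  shows "has_poly_derivative (\<lambda>t. F t * G t) (F x * E + D * G x) x"
  unfolding has_poly_derivative_def coeff_mult coeff_add sum.distrib[symmetric]
  using assms unfolding has_poly_derivative_def
  by (auto intro!: has_vector_derivative_sum has_vector_derivative_mult)

lemma has_poly_derivative_power:
  assumes "has_poly_derivative F D x"
  shows "has_poly_derivative (\<lambda>t. F t ^ n) (of_nat n * (F x ^ (n - 1) * D)) x"
proof (induction n)
  case 0
  show ?case by (simp add: has_poly_derivative_def)
next
  case (Suc n)
  have *: "F x * (of_nat n * (F x ^ (n - 1) * D)) + D * F x ^ n = of_nat (Suc n) * (F x ^ (Suc n - 1) * D)"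
    by (cases n) (simp_all add: algebra_simps)
  from has_poly_derivative_mult[OF assms Suc] show ?case by (simp only: * power_Suc)
qed

text \<open>The linear factors rotate into each other: P' = Q / 2 and Q' = - P / 2. Each term of the
  product rule therefore trades one factor for one of the other kind, which shifts the exponents (p,
  q).\<close>

lemma spin_fun_deriv_theta:
  "((\<lambda>t. spin_fun p q j t \<phi>) has_vector_derivative
     (of_nat p * spin_fun (p - 1) (Suc q) j \<theta> \<phi> - of_nat q * spin_fun (Suc p) (q - 1) j \<theta> \<phi>) / 2) (at \<theta>)"
proof -
  define P where "P t = [:fst (spinor t \<phi>), snd (spinor t \<phi>):]" for t
  define Q where "Q t = [:- cnj (snd (spinor t \<phi>)), cnj (fst (spinor t \<phi>)):]" for t
  have dc: "((\<lambda>t. complex_of_real (cos (t / 2))) has_vector_derivative of_real (- sin (\<theta> / 2) / 2)) (at \<theta>)"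
    and ds: "((\<lambda>t. complex_of_real (sin (t / 2))) has_vector_derivative of_real (cos (\<theta> / 2) / 2)) (at \<theta>)"
    by (auto intro!: has_vector_derivative_of_real derivative_eq_intros)
  have cm: "((\<lambda>t. f t * c) has_vector_derivative D * c) (at \<theta>)"
    if "(f has_vector_derivative D) (at \<theta>)" for f D and c :: complex
    using has_vector_derivative_mult[OF that has_vector_derivative_const[of c]] by simp
  have dP: "has_poly_derivative P (smult (1 / 2) (Q \<theta>)) \<theta>"
    unfolding has_poly_derivative_def P_def Q_def spinor_def fst_conv snd_conv
    using cm[OF dc, of "cis (- \<phi> / 2)"] cm[OF ds, of "cis (\<phi> / 2)"]
    by (auto simp: coeff_pCons cis_cnj split: nat.split)
  have dQ: "has_poly_derivative Q (smult (- 1 / 2) (P \<theta>)) \<theta>"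
    unfolding has_poly_derivative_def P_def Q_def spinor_def fst_conv snd_conv
    using cm[OF dc, of "cis (\<phi> / 2)"] cm[OF ds, of "- cis (- \<phi> / 2)"]
    by (auto simp: coeff_pCons cis_cnj split: nat.split)
  have "has_poly_derivative (\<lambda>t. P t ^ p * Q t ^ q)
     (P \<theta> ^ p * (of_nat q * (Q \<theta> ^ (q - 1) * smult (- 1 / 2) (P \<theta>))) +
      of_nat p * (P \<theta> ^ (p - 1) * smult (1 / 2) (Q \<theta>)) * Q \<theta> ^ q) \<theta>" (is "has_poly_derivative _ ?D _")
    by (intro has_poly_derivative_mult has_poly_derivative_power dP dQ)
  also have "?D = smult (1 / 2) (smult (of_nat p) (P \<theta> ^ (p - 1) * Q \<theta> ^ Suc q) - smult (of_nat q) (P \<theta> ^ Suc p * Q \<theta> ^ (q - 1)))"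
    by (simp add: of_nat_poly algebra_simps smult_diff_right)
  finally show ?thesis
    unfolding has_poly_derivative_def spin_fun_def spin_poly_def P_def[symmetric] Q_def[symmetric] by simp
qed

lemma spin_fun_deriv_phi:
  "((\<lambda>t. spin_fun p q j \<theta> t) has_vector_derivative
     \<i> * of_real (real j - real (p + q) / 2) * spin_fun p q j \<theta> \<phi>) (at \<phi>)"
proof -
  define c where "c = real j - real (p + q) / 2"
  have "((\<lambda>t. cis (c * t)) has_vector_derivative \<i> * of_real c * cis (c * \<phi>)) (at \<phi>)"
    using exp_scaleR_has_vector_derivative_right[of "\<i> * of_real c" \<phi> UNIV]
    by (simp add: cis_conv_exp scaleR_conv_of_real mult_ac)
  from has_vector_derivative_mult[OF this has_vector_derivative_const[of "of_real (spin_fun_real p q j \<theta>)"]]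
  show ?thesis unfolding spin_fun_eq c_def[symmetric] by (simp add: mult_ac)
qed

text \<open>Compares the coefficients of t F'(t) for F = spin_poly.\<close>

lemma spin_fun_recurrence:
  "(2 * of_nat j - of_nat (p + q)) * spin_fun p q j \<theta> \<phi> =
     (of_nat q - of_nat p) * of_real (cos \<theta>) * spin_fun p q j \<theta> \<phi> +
     of_real (sin \<theta>) * (of_nat p * spin_fun (p - 1) (Suc q) j \<theta> \<phi> + of_nat q * spin_fun (Suc p) (q - 1) j \<theta> \<phi>)"
proof -
  define P where "P = [:fst (spinor \<theta> \<phi>), snd (spinor \<theta> \<phi>):]"
  define Q where "Q = [:- cnj (snd (spinor \<theta> \<phi>)), cnj (fst (spinor \<theta> \<phi>)):]"
  define w where "w = cis (\<phi> / 2)"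
  have w: "cis (- (\<phi> / 2)) = cnj w" by (simp add: w_def cis_cnj)
  define a b where "a = complex_of_real (cos (\<theta> / 2))" and "b = complex_of_real (sin (\<theta> / 2))"
  have ab: "a\<^sup>2 + b\<^sup>2 = 1"
    by (simp add: a_def b_def flip: of_real_power of_real_add)
  have c: "of_real (cos \<theta>) = a\<^sup>2 - b\<^sup>2"
    using cos_double[of "\<theta> / 2"] by (simp add: a_def b_def flip: of_real_power of_real_diff)
  have s: "of_real (sin \<theta>) = 2 * a * b"
  proof -
    have "complex_of_real (sin \<theta>) = of_real (2 * sin (\<theta> / 2) * cos (\<theta> / 2))"
      using sin_double[of "\<theta> / 2"] by simp
    then show ?thesis by (simp add: a_def b_def)
  qed
  let ?c = "complex_of_real (cos \<theta>)" and ?s = "complex_of_real (sin \<theta>)"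
  have PQ: "P = [:a * cnj w, b * w:]" "Q = [:- (b * cnj w), a * w:]"
    using w by (simp_all add: P_def Q_def spinor_def a_def b_def w_def)
  have e1: "- a = - ((a\<^sup>2 - b\<^sup>2) * a) - 2 * a * b * b" "b = - ((a\<^sup>2 - b\<^sup>2) * b) + 2 * a * b * a" if "a\<^sup>2 + b\<^sup>2 = 1"
    using ab by algebra+
  \<comment> \<open>The operator t d/dt preserves the span of P and Q: twice this operator minus the
    identity maps P to sin(theta) Q - cos(theta) P and Q to sin(theta) P + cos(theta) Q.\<close>
  have tP: "pCons 0 (pderiv P) = smult (1 / 2) (P + (smult ?s Q - smult ?c P))"
    using e1(1,2)[OF ab] unfolding PQ c s
    by (simp add: pderiv_pCons field_simps) (algebra | (intro conjI; algebra))
  have tQ: "pCons 0 (pderiv Q) = smult (1 / 2) (Q + (smult ?s P + smult ?c Q))"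
    using e1(1,2)[OF ab] unfolding PQ c s
    by (simp add: pderiv_pCons field_simps) (algebra | (intro conjI; algebra))
  define F where "F = P ^ p * Q ^ q"
  \<comment> \<open>For p = 0 or q = 0 the truncated exponent does no harm, because the numerical
    factor vanishes.\<close>
  have pp: "P * (of_nat p * P ^ (p - 1)) = of_nat p * P ^ p" "Q * (of_nat q * Q ^ (q - 1)) = of_nat q * Q ^ q"
    by (cases p; simp) (cases q; simp)
  have "pCons 0 (pderiv F) = [:0, 1:] * pderiv F" by simp
  also have "\<dots> = of_nat q * (P ^ p * Q ^ (q - 1)) * ([:0, 1:] * pderiv Q) + of_nat p * (P ^ (p - 1) * Q ^ q) * ([:0, 1:] * pderiv P)"
    unfolding F_def pderiv_mult pderiv_power of_nat_poly by (simp add: algebra_simps)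
  finally have "smult 2 (pCons 0 (pderiv F)) = of_nat q * (P ^ p * Q ^ (q - 1)) * (smult 2 (pCons 0 (pderiv Q))) +
      of_nat p * (P ^ (p - 1) * Q ^ q) * (smult 2 (pCons 0 (pderiv P)))"
    by (simp add: smult_add_right)
  also have "\<dots> = of_nat q * (P ^ p * Q ^ (q - 1)) * (Q + (smult ?s P + smult ?c Q)) +
      of_nat p * (P ^ (p - 1) * Q ^ q) * (P + (smult ?s Q - smult ?c P))"
    unfolding tP tQ by simp
  also have "\<dots> = P ^ p * (Q * (of_nat q * Q ^ (q - 1))) * (1 + [:?c:]) + [:?s:] * (of_nat q * (P ^ Suc p * Q ^ (q - 1))) +
      (P * (of_nat p * P ^ (p - 1))) * Q ^ q * (1 - [:?c:]) + [:?s:] * (of_nat p * (P ^ (p - 1) * Q ^ Suc q))"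
    by (simp add: algebra_simps)
  also note pp(1)
  also note pp(2)
  finally have "smult 2 (pCons 0 (pderiv F)) = smult (of_nat (p + q)) F + smult ((of_nat q - of_nat p) * ?c) F +
      smult ?s (smult (of_nat p) (P ^ (p - 1) * Q ^ Suc q) + smult (of_nat q) (P ^ Suc p * Q ^ (q - 1)))"
    unfolding F_def of_nat_poly by (simp add: algebra_simps smult_add_left smult_diff_left smult_add_right smult_diff_right del: One_nat_def)
  from arg_cong[OF this, of "\<lambda>p. coeff p j"]
  have "2 * coeff (pCons 0 (pderiv F)) j = of_nat (p + q) * coeff F j + (of_nat q - of_nat p) * ?c * coeff F j +
     ?s * (of_nat p * coeff (P ^ (p - 1) * Q ^ Suc q) j + of_nat q * coeff (P ^ Suc p * Q ^ (q - 1)) j)"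
    by (simp only: coeff_smult coeff_add)
  moreover have "coeff (pCons 0 (pderiv F)) j = of_nat j * coeff F j"
    by (cases j) (simp_all add: coeff_pderiv)
  ultimately show ?thesis
    unfolding spin_fun_def spin_poly_def P_def[symmetric] Q_def[symmetric] F_def[symmetric]
    by (simp add: algebra_simps)
qed

text \<open>The recurrence rewrites the azimuthal term as a multiple of cot theta and the two
  shifted functions. The cotangent cancels the spin term of the operator, and one of the two shifts
  cancels against the derivative in theta.\<close>

lemma spin_fun_eth_aux:
  fixes S K C A B F :: complex
  assumes "S \<noteq> 0" "of_nat p - of_nat q = 2 * \<sigma>"
    and "J * F = (of_nat q - of_nat p) * K * F + S * (of_nat p * A + of_nat q * B)"
  shows "- (C * ((of_nat p * A - of_nat q * B) / 2) + \<i> / S * (C * (\<i> * (J / 2) * F)) - \<sigma> * (K / S) * (C * F)) = C * of_nat q * B"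
    and "- (C * ((of_nat p * A - of_nat q * B) / 2) - \<i> / S * (C * (\<i> * (J / 2) * F)) + \<sigma> * (K / S) * (C * F)) = - C * of_nat p * A"
proof -
  have \<sigma>: "\<sigma> = (of_nat p - of_nat q) / 2" using assms(2) by simp
  have "\<i> / S * (C * (\<i> * (J / 2) * F)) = - (C / (2 * S)) * (J * F)"
  proof -
    have "a / S * (C * (a * (J / 2) * F)) = (a * a) * (C / (2 * S) * (J * F))" for a
      using assms(1) by (simp add: field_simps)
    from this[of \<i>] show ?thesis by simp
  qed
  also have "\<dots> = - (C / (2 * S)) * ((of_nat q - of_nat p) * K * F) - C * ((of_nat p * A + of_nat q * B) / 2)"
    unfolding assms(3) using assms(1) by (simp add: field_simps)
  finally have *: "\<i> / S * (C * (\<i> * (J / 2) * F)) = \<sigma> * (K / S) * (C * F) - C * ((of_nat p * A + of_nat q * B) / 2)"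
    unfolding \<sigma> using assms(1) by (simp add: field_simps)
  show "- (C * ((of_nat p * A - of_nat q * B) / 2) + \<i> / S * (C * (\<i> * (J / 2) * F)) - \<sigma> * (K / S) * (C * F)) = C * of_nat q * B"
    and "- (C * ((of_nat p * A - of_nat q * B) / 2) - \<i> / S * (C * (\<i> * (J / 2) * F)) + \<sigma> * (K / S) * (C * F)) = - C * of_nat p * A"
    unfolding * by (simp_all add: field_simps)
qed

text \<open>With p = l + s and q = l - s the condition on p - q says that s is the spin weight.
  Raising it by one means replacing a linear factor of the second kind by one of the first kind.
  Agreement on an open set of theta and for all phi is what the two partial derivatives see.\<close>

lemma
  assumes U: "open U" and f: "\<And>\<theta> \<phi>. \<theta> \<in> U \<Longrightarrow> f (\<theta>, \<phi>) = C * spin_fun p q j \<theta> \<phi>"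
    and s: "int p - int q = 2 * s" and \<theta>: "\<theta> \<in> U" "sin \<theta> \<noteq> 0"
  shows eth_spin_fun: "eth s f (\<theta>, \<phi>) = C * of_nat q * spin_fun (Suc p) (q - 1) j \<theta> \<phi>"
    and eth_bar_spin_fun: "eth_bar s f (\<theta>, \<phi>) = - C * of_nat p * spin_fun (p - 1) (Suc q) j \<theta> \<phi>"
proof -
  have cm: "((\<lambda>t. C * g t) has_vector_derivative C * D) (at x)"
    if "(g has_vector_derivative D) (at x)" for g D x
    using has_vector_derivative_mult[OF has_vector_derivative_const[of C] that] by simp
  have "((\<lambda>t. f (t, \<phi>)) has_vector_derivative C * ((of_nat p * spin_fun (p - 1) (Suc q) j \<theta> \<phi> -
      of_nat q * spin_fun (Suc p) (q - 1) j \<theta> \<phi>) / 2)) (at \<theta>)"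
    by (rule has_vector_derivative_transform_within_open[OF cm[OF spin_fun_deriv_theta], of U])
      (use \<theta> f U in auto)
  then have dt: "d_theta f (\<theta>, \<phi>) = C * ((of_nat p * spin_fun (p - 1) (Suc q) j \<theta> \<phi> -
      of_nat q * spin_fun (Suc p) (q - 1) j \<theta> \<phi>) / 2)"
    unfolding d_theta_def by (simp add: vector_derivative_at)
  have "((\<lambda>t. f (\<theta>, t)) has_vector_derivative
      C * (\<i> * of_real (real j - real (p + q) / 2) * spin_fun p q j \<theta> \<phi>)) (at \<phi>)"
    by (rule has_vector_derivative_transform_within_open[OF cm[OF spin_fun_deriv_phi], of UNIV])
      (use \<theta> f in auto)
  then have dp: "d_phi f (\<theta>, \<phi>) = C * (\<i> * ((2 * of_nat j - of_nat (p + q)) / 2) * spin_fun p q j \<theta> \<phi>)"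
    unfolding d_phi_def by (simp add: vector_derivative_at diff_divide_distrib)
  have S: "complex_of_real (sin \<theta>) \<noteq> 0" using \<theta>(2) by simp
  have "complex_of_int (int p - int q) = of_int (2 * s)" unfolding s ..
  then have s': "of_nat p - of_nat q = 2 * complex_of_int s" by simp
  have cot: "complex_of_real (cot \<theta>) = of_real (cos \<theta>) / of_real (sin \<theta>)" by (simp add: cot_def)
  show "eth s f (\<theta>, \<phi>) = C * of_nat q * spin_fun (Suc p) (q - 1) j \<theta> \<phi>"
    "eth_bar s f (\<theta>, \<phi>) = - C * of_nat p * spin_fun (p - 1) (Suc q) j \<theta> \<phi>"
    unfolding eth_def eth_bar_def prod.case dt dp cot f[OF \<theta>(1)]
    by (rule spin_fun_eth_aux[OF S s' spin_fun_recurrence])+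
qed

text \<open>The steps contribute the factors l, l - 1, ..., l - k + 1. The open set is arbitrary
  apart from the zeros of the sine, because the formula is also used on both sides of a
  pole.\<close>

lemma eth_pow_spin_fun:
  assumes U: "open U" "\<And>\<theta>. \<theta> \<in> U \<Longrightarrow> sin \<theta> \<noteq> 0"
    and f: "\<And>\<theta> \<phi>. \<theta> \<in> U \<Longrightarrow> f (\<theta>, \<phi>) = C * spin_fun l l j \<theta> \<phi>"
    and "k \<le> l" "\<theta> \<in> U"
  shows "eth_pow k f (\<theta>, \<phi>) = C * (fact l / fact (l - k)) * spin_fun (l + k) (l - k) j \<theta> \<phi>"
  using assms(4-)
proof (induction k arbitrary: \<theta> \<phi>)
  case 0
  then show ?case by (simp add: f)
next
  case (Suc k)
  have e1: "eth_pow (Suc k) f (\<theta>, \<phi>) = C * (fact l / fact (l - k)) * of_nat (l - k) * spin_fun (Suc (l + k)) (l - k - 1) j \<theta> \<phi>"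
    unfolding eth_pow.simps by (rule eth_spin_fun[OF U(1)]) (use Suc U(2) in \<open>auto simp: of_nat_diff\<close>)
  have "fact (l - k) = (of_nat (l - k) * fact (l - Suc k) :: complex)"
    using Suc.prems by (metis Suc_diff_Suc Suc_le_eq fact_Suc of_nat_mult)
  then have e2: "C * (fact l / fact (l - k)) * of_nat (l - k) = C * (fact l / fact (l - Suc k))"
    using Suc.prems by (simp del: of_nat_diff)
  show ?case unfolding e1 e2 by simp
qed

lemma eth_bar_pow_spin_fun:
  assumes U: "open U" "\<And>\<theta>. \<theta> \<in> U \<Longrightarrow> sin \<theta> \<noteq> 0"
    and f: "\<And>\<theta> \<phi>. \<theta> \<in> U \<Longrightarrow> f (\<theta>, \<phi>) = C * spin_fun l l j \<theta> \<phi>"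
    and "k \<le> l" "\<theta> \<in> U"
  shows "eth_bar_pow k f (\<theta>, \<phi>) = (-1) ^ k * C * (fact l / fact (l - k)) * spin_fun (l - k) (l + k) j \<theta> \<phi>"
  using assms(4-)
proof (induction k arbitrary: \<theta> \<phi>)
  case 0
  then show ?case by (simp add: f)
next
  case (Suc k)
  have e1: "eth_bar_pow (Suc k) f (\<theta>, \<phi>) = - ((-1) ^ k * C * (fact l / fact (l - k))) * of_nat (l - k) * spin_fun (l - k - 1) (Suc (l + k)) j \<theta> \<phi>"
    unfolding eth_bar_pow.simps by (rule eth_bar_spin_fun[OF U(1)]) (use Suc U(2) in \<open>auto simp: of_nat_diff\<close>)
  have "fact (l - k) = (of_nat (l - k) * fact (l - Suc k) :: complex)"
    using Suc.prems by (metis Suc_diff_Suc Suc_le_eq fact_Suc of_nat_mult)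
  then have e2: "C * (fact l / fact (l - k)) * of_nat (l - k) = C * (fact l / fact (l - Suc k))"
    using Suc.prems by (simp del: of_nat_diff)
  have e3: "- ((-1) ^ k * C * (fact l / fact (l - k))) * of_nat (l - k) = (-1) ^ Suc k * (C * (fact l / fact (l - Suc k)))"
    unfolding e2[symmetric] by simp
  show ?case unfolding e1 e3 by simp
qed

section \<open>Spherical harmonics in half angles\<close>

lemma higher_pderiv_pcompose_shift:
  "(pderiv ^^ k) (pcompose F [:z, 1:]) = pcompose ((pderiv ^^ k) F) [:z, 1:]" for z :: real
  by (induction k) (simp_all add: pderiv_pcompose pderiv_pCons)

lemma coeff_zero_higher_pderiv: "coeff ((pderiv ^^ k) F) 0 = fact k * coeff F k" for F :: "real poly"
proof (induction k arbitrary: F)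
  case (Suc k)
  have "(pderiv ^^ Suc k) F = (pderiv ^^ k) (pderiv F)" by (simp only: funpow_Suc_right o_apply)
  then show ?case by (simp add: Suc coeff_pderiv algebra_simps)
qed simp

lemma coeff_pcompose_shift: "fact k * coeff (pcompose F [:z, 1:]) k = poly ((pderiv ^^ k) F) z" for z :: real
  by (simp add: coeff_zero_higher_pderiv[symmetric] higher_pderiv_pcompose_shift
      flip: poly_0_coeff_0) (simp add: poly_pcompose)

text \<open>By Taylor's formula, the derivatives of (z^2 - 1)^l at z = cos t in Rodrigues' formula are the
  coefficients of a power of (z + x sin t)^2 - 1 = 2 sin t (cos (t/2) + x sin (t/2)) (- sin (t/2) + x cos (t/2)).\<close>

lemma assoc_legendre_cos:
  assumes "0 < \<theta>" "\<theta> < pi"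
  shows "assoc_legendre l m (cos \<theta>) = fact (l + m) / fact l * spin_fun_real l l (l + m) \<theta>"
proof -
  define S z where "S = sin \<theta>" and "z = cos \<theta>"
  have S: "S > 0" unfolding S_def using assms by (rule sin_gt_zero)
  have zS: "z\<^sup>2 = 1 - S\<^sup>2" by (simp add: z_def S_def cos_squared_eq)
  have hs: "S = 2 * (sin (\<theta> / 2) * cos (\<theta> / 2))" "z = cos (\<theta> / 2) * cos (\<theta> / 2) - sin (\<theta> / 2) * sin (\<theta> / 2)"
    using sin_double[of "\<theta> / 2"] cos_double[of "\<theta> / 2"] by (simp_all add: S_def z_def power2_eq_square)
  define F where "F = [:-1, 0, 1::real:] ^ l"
  have "S ^ (l + m) * coeff (pcompose F [:z, 1:]) (l + m) = coeff (pcompose (pcompose F [:z, 1:]) [:0, S:]) (l + m)"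
    by (simp add: coeff_pcompose_linear)
  also have "pcompose (pcompose F [:z, 1:]) [:0, S:] = pcompose F [:z, S:]"
    by (simp add: pcompose_assoc[symmetric] pcompose_pCons)
  also have "\<dots> = pcompose [:-1, 0, 1:] [:z, S:] ^ l" by (simp add: F_def pcompose_power)
  also have "pcompose [:-1, 0, 1:] [:z, S:] = [:z\<^sup>2 - 1, 2 * z * S, S\<^sup>2:]"
    by (simp add: pcompose_pCons power2_eq_square)
  also have "[:z\<^sup>2 - 1, 2 * z * S, S\<^sup>2:] = smult (2 * S) ([:cos (\<theta> / 2), sin (\<theta> / 2):] * [:- sin (\<theta> / 2), cos (\<theta> / 2):])"
  proof -
    have pq: "[:cos (\<theta> / 2), sin (\<theta> / 2):] * [:- sin (\<theta> / 2), cos (\<theta> / 2):] = [:- (S / 2), z, S / 2:]"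
      unfolding hs by (simp add: mult.commute)
    show ?thesis unfolding pq using zS by (simp add: power2_eq_square mult_ac)
  qed
  finally have "S ^ (l + m) * coeff (pcompose F [:z, 1:]) (l + m) = (2 * S) ^ l * spin_fun_real l l (l + m) \<theta>"
    unfolding spin_fun_real_def smult_power coeff_smult power_mult_distrib .
  then have A: "S ^ m * coeff (pcompose F [:z, 1:]) (l + m) = 2 ^ l * spin_fun_real l l (l + m) \<theta>"
    using S by (simp add: power_add power_mult_distrib)
  have "sqrt (1 - z\<^sup>2) = S" using S zS by simp
  moreover have "(pderiv ^^ m) (legendre_poly l) = smult (1 / (2 ^ l * fact l)) ((pderiv ^^ (l + m)) F)"
  proof -
    have "(pderiv ^^ m) (smult c G) = smult c ((pderiv ^^ m) G)" for c and G :: "real poly"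
      by (induction m) (simp_all add: pderiv_smult)
    then show ?thesis
      unfolding legendre_poly_def F_def[symmetric] by (simp add: add.commute[of l] funpow_add)
  qed
  ultimately show ?thesis
    unfolding assoc_legendre_def z_def[symmetric]
    by (simp add: coeff_pcompose_shift[symmetric] mult.left_commute[of "S ^ m"] A)
qed

text \<open>Write F for the product of P^l and Q^l. Under F(t) -> t^(2 l) F(- 1 / t) the linear
  factor P goes to Q and Q to - P, so F is reproduced up to the sign (-1)^l. On coefficients this
  map reverses the order with alternating signs.\<close>

lemma spin_fun_real_reflect:
  assumes "m \<le> l"
  shows "spin_fun_real l l (l - m) \<theta> = (-1) ^ m * spin_fun_real l l (l + m) \<theta>"
proof -
  define c where "c i = complex_of_real (spin_fun_real l l i \<theta>)" for i
  have c: "c i = coeff (spin_poly (of_real (cos (\<theta> / 2))) (of_real (sin (\<theta> / 2))) l l) i" for i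
    by (simp add: c_def spin_fun_real_def spin_poly_def coeff_mult coeff_linear_power)
  let ?a = "complex_of_real (cos (\<theta> / 2))" and ?b = "complex_of_real (sin (\<theta> / 2))"
  have "(\<Sum>i\<le>l + l. monom (c i * (-1) ^ i) (l + l - i)) = homogenize (l + l) (spin_poly ?a ?b l l) [:0, 1:] [:-1:]"
    unfolding homogenize_def c
    by (intro sum.cong refl) (simp add: monom_altdef poly_const_pow mult_ac)
  also have "\<dots> = ([:- ?b, ?a:]) ^ l * (- [:?a, ?b:]) ^ l"
    unfolding spin_poly_def homogenize_linear_power_mult by simp
  also have "\<dots> = smult ((-1) ^ l) (spin_poly ?a ?b l l)"
    by (subst power_minus) (simp add: spin_poly_def mult_ac power_minus1_even minus_one_power_iff)
  finally have "coeff (\<Sum>i\<le>l + l. monom (c i * (-1) ^ i) (l + l - i)) (l - m) = (-1) ^ l * c (l - m)"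
    by (simp add: c)
  moreover have "coeff (\<Sum>i\<le>l + l. monom (c i * (-1) ^ i) (l + l - i)) (l - m) = (\<Sum>i\<le>l + l. if i = l + m then c i * (-1) ^ i else 0)"
    unfolding coeff_sum by (intro sum.cong refl) (use assms in auto)
  ultimately have "c (l + m) * (-1) ^ (l + m) = (-1) ^ l * c (l - m)"
    using assms by simp
  then have "c (l - m) = (-1) ^ m * c (l + m)" by (simp add: power_add mult.commute)
  then have "complex_of_real (spin_fun_real l l (l - m) \<theta>) = of_real ((-1) ^ m * spin_fun_real l l (l + m) \<theta>)"
    by (simp add: c_def)
  then show ?thesis by (simp only: of_real_eq_iff)
qed

text \<open>The sign by which the harmonic of order m differs from a matrix coefficient. For
  negative m the sign of the conjugated harmonic cancels against the one from reversing the
  coefficients.\<close>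

definition harm_sign :: "int \<Rightarrow> complex" where
  "harm_sign m = (if 0 \<le> m then (-1) ^ nat m else 1)"

lemma sph_harm_eq:
  assumes m: "\<bar>m\<bar> \<le> int l" and \<theta>: "0 < \<theta>" "\<theta> < pi"
  shows "sph_harm l m (\<theta>, \<phi>) = harm_sign m * of_real (sqrt ((2 * real l + 1) / (4 * pi)) *
    sqrt (fact (nat (int l + m)) * fact (nat (int l - m))) / fact l) * spin_fun l l (nat (int l + m)) \<theta> \<phi>"
proof -
  have n: "sph_harm_nonneg l k (\<theta>, \<phi>) = (-1) ^ k * of_real (sqrt ((2 * real l + 1) / (4 * pi)) *
    sqrt (fact (l + k) * fact (l - k)) / fact l * spin_fun_real l l (l + k) \<theta>) * cis (real k * \<phi>)" if "k \<le> l" for k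
  proof -
    \<comment> \<open>The factor (l + k)! from Rodrigues' formula makes the normalization of the
      harmonics symmetric in k and - k, as that of \<open>dmat\<close> is.\<close>
    have "sqrt (fact (l - k) / fact (l + k)) * fact (l + k) = sqrt (fact (l + k) * fact (l - k) :: real)"
      by (simp add: real_sqrt_divide real_sqrt_mult field_simps)
    then have "a * sqrt (fact (l - k) / fact (l + k)) * (fact (l + k) / fact l * r) = a * sqrt (fact (l + k) * fact (l - k)) / fact l * r" for a r :: real
      by (metis (no_types, lifting) mult.assoc times_divide_eq_left times_divide_eq_right)
    then show ?thesis
      unfolding sph_harm_nonneg_def prod.case assoc_legendre_cos[OF \<theta>] real_sqrt_mult[of "(2 * real l + 1) / (4 * pi)"]
      by (simp only:)
  qed
  show ?thesis
  proof (cases "0 \<le> m")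
    case True
    then obtain k where k: "m = int k" using nonneg_int_cases by blast
    have "nat (int l + m) = l + k" "nat (int l - m) = l - k" "nat m = k" "k \<le> l" using m k by auto
    then show ?thesis using True
      by (simp add: sph_harm_def n harm_sign_def spin_fun_eq algebra_simps)
  next
    case False
    then obtain k where k: "m = - int k" by (metis linear nonneg_int_cases add.inverse_inverse neg_0_le_iff_le)
    have e: "nat (int l + m) = l - k" "nat (int l - m) = l + k" "nat (- m) = k" "k \<le> l" using m k by auto
    have "cnj (cis (real k * \<phi>)) = cis ((real (l - k) - real (l + l) / 2) * \<phi>)"
      using e(4) by (simp add: cis_cnj of_nat_diff)
    moreover have "(-1) ^ k * ((-1) ^ k * x) = x" for x :: complex
      by (simp add: mult.assoc[symmetric] power_mult_distrib[symmetric])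
    ultimately show ?thesis using False e
      by (simp add: sph_harm_def n harm_sign_def spin_fun_eq spin_fun_real_reflect mult_ac)
  qed
qed

text \<open>The quotient of factorials produced by the powers of the operators, times the
  normalization of the spin weighted harmonic, is 1 / sqrt((l - s)! (l + s)!), exactly the column
  normalization in \<open>dmat\<close>. Row l + m carries the order and column l - s the spin
  weight.\<close>

theorem spin_harm_eq_dmat:
  assumes s: "\<bar>s\<bar> \<le> int l" and m: "\<bar>m\<bar> \<le> int l" and \<theta>: "0 < \<theta>" "\<theta> < pi"
  shows "spin_harm s l m (\<theta>, \<phi>) = harm_sign m * of_real (sqrt ((2 * real l + 1) / (4 * pi))) *
    dmat (2 * l) (nat (int l + m)) (nat (int l - s)) (spinor \<theta> \<phi>)"
proof -
  define M where "M = sqrt (fact (nat (int l + m)) * fact (nat (int l - m)) :: real)"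
  define N where "N = sqrt ((2 * real l + 1) / (4 * pi))"
  define j where "j = nat (int l + m)"
  have mm: "2 * l - j = nat (int l - m)" using m by (auto simp: j_def)
  have sp: "nat (int l + s) = 2 * l - nat (int l - s)" using s by auto
  have U: "open {0<..<pi}" "\<And>\<theta>. \<theta> \<in> {0<..<pi} \<Longrightarrow> sin \<theta> \<noteq> 0" "\<theta> \<in> {0<..<pi}"
    using sin_gt_zero \<theta> by (auto simp: less_le)
  have sh: "\<And>\<theta> \<phi>. \<theta> \<in> {0<..<pi} \<Longrightarrow> sph_harm l m (\<theta>, \<phi>) = harm_sign m * of_real (N * M / fact l) * spin_fun l l j \<theta> \<phi>"
    unfolding N_def M_def j_def using sph_harm_eq[OF m] by simp
  have D: "dmat (2 * l) j (nat (int l - s)) (spinor \<theta> \<phi>) =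
     of_real (M / sqrt (fact (nat (int l - s)) * fact (nat (int l + s)))) * spin_fun (nat (int l + s)) (nat (int l - s)) j \<theta> \<phi>"
    unfolding dmat_def spin_fun_def M_def mm sp real_sqrt_divide by (simp add: j_def)
  show ?thesis
  proof (cases "0 \<le> s")
    case True
    then obtain k where k: "s = int k" using nonneg_int_cases by blast
    have e: "nat (int l + s) = l + k" "nat (int l - s) = l - k" "nat s = k" "k \<le> l" using s k by auto
    have "spin_harm s l m (\<theta>, \<phi>) = of_real (sqrt (fact (l - k) / fact (l + k))) *
      (harm_sign m * of_real (N * M / fact l) * (fact l / fact (l - k)) * spin_fun (l + k) (l - k) j \<theta> \<phi>)"
      using True eth_pow_spin_fun[OF U(1,2) sh e(4) U(3)] e by (simp add: spin_harm_def)
    also have "\<dots> = harm_sign m * of_real N * (of_real (M * (sqrt (fact (l - k) / fact (l + k)) / fact (l - k))) * spin_fun (l + k) (l - k) j \<theta> \<phi>)"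
      by (simp add: field_simps)
    also have "sqrt (fact (l - k) / fact (l + k)) / fact (l - k) = 1 / sqrt (fact (l - k) * fact (l + k) :: real)"
      by (simp add: real_sqrt_divide real_sqrt_mult field_simps)
    finally show ?thesis unfolding N_def[symmetric] j_def[symmetric] D unfolding e by simp
  next
    case False
    then obtain k where k: "s = - int k" by (metis linear nonneg_int_cases add.inverse_inverse neg_0_le_iff_le)
    have e: "nat (int l + s) = l - k" "nat (int l - s) = l + k" "nat (- s) = k" "k \<le> l" using s k by auto
    have sg: "(-1) ^ k * ((-1) ^ k * x) = x" for x :: complex
      by (simp add: mult.assoc[symmetric] power_mult_distrib[symmetric])
    have "spin_harm s l m (\<theta>, \<phi>) = of_real (sqrt (fact (l - k) / fact (l + k))) *
      ((-1) ^ k * ((-1) ^ k * (harm_sign m * of_real (N * M / fact l) * (fact l / fact (l - k)) * spin_fun (l - k) (l + k) j \<theta> \<phi>)))"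
      using False eth_bar_pow_spin_fun[OF U(1,2) sh e(4) U(3)] e by (simp add: spin_harm_def mult_ac)
    also have "\<dots> = harm_sign m * of_real N * (of_real (M * (sqrt (fact (l - k) / fact (l + k)) / fact (l - k))) * spin_fun (l - k) (l + k) j \<theta> \<phi>)"
      unfolding sg by (simp add: field_simps)
    also have "sqrt (fact (l - k) / fact (l + k)) / fact (l - k) = 1 / sqrt (fact (l + k) * fact (l - k) :: real)"
      by (simp add: real_sqrt_divide real_sqrt_mult field_simps)
    finally show ?thesis unfolding N_def[symmetric] j_def[symmetric] D unfolding e by simp
  qed
qed

section \<open>Rotations and Euler angles\<close>

text \<open>The double covering of SO(3) by SU(2), with entries quadratic in the pair. The third
  column, the image of the north pole, is the Hopf map: first two components 2 a b as a complex
  number, third component |a|^2 - |b|^2.\<close>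

definition rot_of :: "complex \<times> complex \<Rightarrow> real^3^3" where
  "rot_of u = (let a = cnj (fst u); b = snd u in vector
     [vector [Re (a\<^sup>2 - b\<^sup>2), Re (\<i> * (a\<^sup>2 + b\<^sup>2)), Re (2 * a * b)],
      vector [Im (a\<^sup>2 - b\<^sup>2), Im (\<i> * (a\<^sup>2 + b\<^sup>2)), Im (2 * a * b)],
      vector [- 2 * Re (cnj a * b), - 2 * Im (cnj a * b), (cmod a)\<^sup>2 - (cmod b)\<^sup>2]])"

lemmas mat3_simps = vec_eq_iff forall_3 matrix_matrix_mult_def matrix_vector_mult_def transpose_def sum_3 mat_def

lemma rot_of_mult: "rot_of (spin_mult h u) = rot_of h ** rot_of u"
proof -
  obtain a1 a2 b1 b2 where h: "h = (Complex a1 a2, Complex b1 b2)" by (metis complex_surj surj_pair)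
  obtain c1 c2 d1 d2 where u: "u = (Complex c1 c2, Complex d1 d2)" by (metis complex_surj surj_pair)
  show ?thesis
    unfolding h u rot_of_def Let_def spin_mult_def mat3_simps cmod_power2
    by (simp add: power2_eq_square) (intro conjI; simp add: algebra_simps)
qed

lemma rot_of_adj: "rot_of (spin_adj u) = transpose (rot_of u)"
  unfolding rot_of_def Let_def spin_adj_def mat3_simps
  by (simp add: cmod_power2 power2_eq_square)

text \<open>The first two columns determine a^2 - b^2 and a^2 + b^2, the third one a b; this fixes
  the pair up to a common sign.\<close>

lemma rot_of_inj:
  assumes "rot_of u = rot_of v"
  shows "u = v \<or> u = - v"
proof -
  define a b a' b' where "a = cnj (fst u)" and "b = snd u" and "a' = cnj (fst v)" and "b' = snd v"
  from assms have "Re (a\<^sup>2 - b\<^sup>2) = Re (a'\<^sup>2 - b'\<^sup>2)" "Re (\<i> * (a\<^sup>2 + b\<^sup>2)) = Re (\<i> * (a'\<^sup>2 + b'\<^sup>2))" "Re (2 * a * b) = Re (2 * a' * b')"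
    "Im (a\<^sup>2 - b\<^sup>2) = Im (a'\<^sup>2 - b'\<^sup>2)" "Im (\<i> * (a\<^sup>2 + b\<^sup>2)) = Im (\<i> * (a'\<^sup>2 + b'\<^sup>2))" "Im (2 * a * b) = Im (2 * a' * b')"
    unfolding rot_of_def Let_def vec_eq_iff forall_3 vector_3 a_def b_def a'_def b'_def by blast+
  then have "a\<^sup>2 - b\<^sup>2 = a'\<^sup>2 - b'\<^sup>2" "\<i> * (a\<^sup>2 + b\<^sup>2) = \<i> * (a'\<^sup>2 + b'\<^sup>2)" "2 * a * b = 2 * a' * b'"
    by (auto intro: complex_eqI simp only:)
  then have "a\<^sup>2 = a'\<^sup>2" "b\<^sup>2 = b'\<^sup>2" "a * b = a' * b'" by (simp_all, algebra+)
  then have "(a = a' \<and> b = b') \<or> (a = - a' \<and> b = - b')" unfolding power2_eq_iff by auto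
  then show ?thesis
    unfolding a_def b_def a'_def b'_def by (auto simp: prod_eq_iff) (metis complex_cnj_cnj complex_cnj_minus)+
qed

definition spinor3 :: "real \<Rightarrow> real \<Rightarrow> real \<Rightarrow> complex \<times> complex" where
  "spinor3 a b c = (fst (spinor b a) * cis (- c / 2), snd (spinor b a) * cis (- c / 2))"

lemma rot_z_eq: "rot_z t = rot_of (cis (- t / 2), 0)"
proof -
  have "cis (t / 2) ^ 2 = cis t" by (subst Complex.DeMoivre) simp
  then show ?thesis
    unfolding rot_z_def rot_of_def Let_def by (simp add: cis_cnj)
qed

lemma rot_y_eq: "rot_y t = rot_of (of_real (cos (t / 2)), of_real (sin (t / 2)))"
  unfolding rot_y_def rot_of_def Let_def vec_eq_iff forall_3
  using cos_double[of "t / 2"] sin_double[of "t / 2"]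
  by (simp add: cmod_power2 power2_eq_square[symmetric] flip: of_real_power of_real_mult)

lemma spinor3_mult: "spinor3 a b c = spin_mult (spin_mult (cis (- a / 2), 0) (of_real (cos (b / 2)), of_real (sin (b / 2)))) (cis (- c / 2), 0)"
  by (simp add: spinor3_def spinor_def spin_mult_def cis_cnj mult_ac)

lemma euler_eq: "euler a b c = rot_of (spinor3 a b c)"
  unfolding euler_def rot_z_eq rot_y_eq spinor3_mult rot_of_mult by (simp add: matrix_mul_assoc)

lemma spinor3_0: "spinor3 a b 0 = spinor b a"
  by (simp add: spinor3_def)

lemma spinor3_SU2: "spinor3 a b c \<in> SU2"
  using spinor_SU2[of b a] by (simp add: SU2_def spinor3_def norm_mult)

lemma euler_entries:
  "euler a b c $ 3 $ 1 = - sin b * cos c" "euler a b c $ 3 $ 2 = sin b * sin c" "euler a b c $ 3 $ 3 = cos b"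
  "euler a b c $ 1 $ 3 = sin b * cos a" "euler a b c $ 2 $ 3 = sin b * sin a"
  "euler a b c $ 2 $ 1 = sin a * cos b * cos c + cos a * sin c"
  "euler a b c $ 2 $ 2 = - sin a * cos b * sin c + cos a * cos c"
  by (simp_all add: euler_def rot_z_def rot_y_def matrix_matrix_mult_def sum_3 algebra_simps)

lemma SO3_mult: "A \<in> SO3 \<Longrightarrow> B \<in> SO3 \<Longrightarrow> A ** B \<in> SO3"
  by (simp add: SO3_def rotation_matrix_def orthogonal_matrix_mul det_mul)

lemma SO3_transpose: "A \<in> SO3 \<Longrightarrow> transpose A \<in> SO3"
  by (simp add: SO3_def rotation_matrix_def det_transpose)

lemma SO3_transpose_mult: "A \<in> SO3 \<Longrightarrow> transpose A ** A = mat 1" "A \<in> SO3 \<Longrightarrow> A ** transpose A = mat 1"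
  by (simp_all add: SO3_def rotation_matrix_def orthogonal_matrix_def)

lemma SO3_matrix_inv: "A \<in> SO3 \<Longrightarrow> matrix_inv A = transpose A"
proof -
  assume A: "A \<in> SO3"
  then have "A ** matrix_inv A = mat 1 \<and> matrix_inv A ** A = mat 1"
    unfolding matrix_inv_def using SO3_transpose_mult[OF A] by (intro someI) auto
  then show ?thesis
    by (metis A SO3_transpose_mult(1) matrix_mul_assoc matrix_mul_lid matrix_mul_rid)
qed

lemma rot_z_SO3: "rot_z t \<in> SO3" and rot_y_SO3: "rot_y t \<in> SO3"
proof -
  have sc: "sin t * sin t + cos t * cos t = 1" "cos t * cos t + sin t * sin t = 1"
    using sin_cos_squared_add[of t] sin_cos_squared_add2[of t] by (simp_all only: power2_eq_square)
  show "rot_z t \<in> SO3" "rot_y t \<in> SO3"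
    by (simp_all add: SO3_def rotation_matrix_def orthogonal_matrix rot_z_def rot_y_def mat3_simps det_3 power2_eq_square sc)
qed

lemma euler_SO3: "euler a b c \<in> SO3"
  unfolding euler_def by (intro SO3_mult rot_z_SO3 rot_y_SO3)

text \<open>The third row has length 1 and last entry 1, so its other entries vanish. The remaining
  block is orthogonal, and determinant 1 makes it a rotation rather than a reflection.\<close>

lemma SO3_fix_north:
  assumes B: "B \<in> SO3" and n: "B $ 1 $ 3 = 0" "B $ 2 $ 3 = 0" "B $ 3 $ 3 = 1"
  obtains c where "0 \<le> c" "c < 2 * pi" "B = rot_z c"
proof -
  have r: "B ** transpose B = mat 1" and c: "transpose B ** B = mat 1" and d: "det B = 1"
    using B by (auto simp: SO3_def rotation_matrix_def orthogonal_matrix_def)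
  have "(B $ 3 $ 1)\<^sup>2 + (B $ 3 $ 2)\<^sup>2 = 0"
    using r n by (simp add: mat3_simps power2_eq_square)
  then have b: "B $ 3 $ 1 = 0" "B $ 3 $ 2 = 0" by (simp_all add: sum_power2_eq_zero_iff)
  have e: "(B $ 1 $ 1)\<^sup>2 + (B $ 2 $ 1)\<^sup>2 = 1" "B $ 1 $ 1 * B $ 1 $ 2 + B $ 2 $ 1 * B $ 2 $ 2 = 0"
    "B $ 1 $ 1 * B $ 2 $ 2 - B $ 1 $ 2 * B $ 2 $ 1 = 1"
    using c d b n by (simp_all add: mat3_simps det_3 power2_eq_square)
  have e12: "B $ 1 $ 2 = - B $ 2 $ 1" and e22: "B $ 2 $ 2 = B $ 1 $ 1"
    using e by algebra+
  obtain t where t: "0 \<le> t" "t < 2 * pi" "B $ 1 $ 1 = cos t" "B $ 2 $ 1 = sin t"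
    using sincos_total_2pi[OF e(1)] by metis
  have "B = rot_z t"
    using t b n e12 e22 by (simp add: rot_z_def mat3_simps)
  with t show ?thesis by (intro that)
qed

lemma arccos_Arg2pi_props:
  assumes "norm v = 1" and q: "q = (arccos (v $ 3), Arg2pi (Complex (v $ 1) (v $ 2)))"
  shows "q \<in> sph_dom" "sph_point q = v" "sin (fst q) = 0 \<Longrightarrow> snd q = 0"
proof -
  define r where "r = cmod (Complex (v $ 1) (v $ 2))"
  have n: "(v $ 1)\<^sup>2 + (v $ 2)\<^sup>2 + (v $ 3)\<^sup>2 = 1"
    using assms by (simp add: norm_vec_def L2_set_def sum_3)
  then have r2: "r\<^sup>2 = 1 - (v $ 3)\<^sup>2" unfolding r_def cmod_power2 by simp
  have r0: "r \<ge> 0" by (simp add: r_def)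
  have z: "\<bar>v $ 3\<bar> \<le> 1" using r2 by (metis abs_le_square_iff abs_one diff_ge_0_iff_ge one_power2 zero_le_power2)
  then have sa: "sin (arccos (v $ 3)) = r"
    using r2 r0 by (simp add: sin_arccos_abs real_sqrt_unique)
  show "q \<in> sph_dom"
    using z Arg2pi_ge_0 Arg2pi_lt_2pi arccos_lbound arccos_ubound
    by (auto simp: q sph_dom_def abs_le_iff)
  show "sph_point q = v"
    using cos_Arg2pi[of "Complex (v $ 1) (v $ 2)"] sin_Arg2pi[of "Complex (v $ 1) (v $ 2)"] z
    by (simp add: q sph_point_def vec_eq_iff forall_3 sa r_def[symmetric] cos_arccos_abs)
  assume "sin (fst q) = 0"
  then have "Complex (v $ 1) (v $ 2) = 0" using sa by (simp add: q r_def)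
  then show "snd q = 0" by (simp only: q snd_conv Arg2pi_0)
qed

text \<open>Replaces the definite description by a closed form from which measurability can be read
  off. At the poles the value of \<open>Arg2pi\<close> at 0 agrees with the azimuth 0 prescribed
  there.\<close>

lemma sph_coords_eq:
  assumes v: "norm v = 1"
  shows "sph_coords v = (arccos (v $ 3), Arg2pi (Complex (v $ 1) (v $ 2)))"
  unfolding sph_coords_def
proof (rule the_equality)
  show "(arccos (v $ 3), Arg2pi (Complex (v $ 1) (v $ 2))) \<in> sph_dom \<and>
      sph_point (arccos (v $ 3), Arg2pi (Complex (v $ 1) (v $ 2))) = v \<and>
      (sin (fst (arccos (v $ 3), Arg2pi (Complex (v $ 1) (v $ 2)))) = 0 \<longrightarrow>
       snd (arccos (v $ 3), Arg2pi (Complex (v $ 1) (v $ 2))) = 0)"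
    using arccos_Arg2pi_props[OF v refl] by blast
  fix p assume p: "p \<in> sph_dom \<and> sph_point p = v \<and> (sin (fst p) = 0 \<longrightarrow> snd p = 0)"
  obtain \<theta> \<phi> where p': "p = (\<theta>, \<phi>)" by (cases p)
  have d: "0 \<le> \<theta>" "\<theta> \<le> pi" "0 \<le> \<phi>" "\<phi> < 2 * pi" using p by (auto simp: p' sph_dom_def)
  have vv: "v $ 1 = sin \<theta> * cos \<phi>" "v $ 2 = sin \<theta> * sin \<phi>" "v $ 3 = cos \<theta>"
    using p by (auto simp: p' sph_point_def)
  have "Arg2pi (Complex (v $ 1) (v $ 2)) = \<phi>"
  proof (cases "sin \<theta> = 0")
    case True
    then show ?thesis using p by (simp add: vv p' Complex_eq)
  next
    case False
    then have "sin \<theta> > 0" using sin_ge_zero[of \<theta>] d by simp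
    then show ?thesis
      using d by (intro Arg2pi_unique[of "sin \<theta>"])
        (auto simp: vv complex_eq_iff Re_exp Im_exp)
  qed
  then show "p = (arccos (v $ 3), Arg2pi (Complex (v $ 1) (v $ 2)))"
    using d by (simp add: p' vv arccos_cos)
qed

lemma sph_coords_props:
  assumes "norm v = 1"
  shows "sph_coords v \<in> sph_dom" "sph_point (sph_coords v) = v" "sin (fst (sph_coords v)) = 0 \<Longrightarrow> snd (sph_coords v) = 0"
  using arccos_Arg2pi_props[OF assms sph_coords_eq[OF assms]] by blast+

definition north :: "real^3" where "north = vector [0, 0, 1]"

lemma mult_north: "(A :: real^3^3) *v north = vector [A $ 1 $ 3, A $ 2 $ 3, A $ 3 $ 3]"
  by (simp add: north_def mat3_simps)

lemma euler_north: "euler \<phi> \<theta> c *v north = sph_point (\<theta>, \<phi>)"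
  by (simp add: mult_north euler_entries sph_point_def)

lemma norm_SO3_mult:
  assumes "A \<in> SO3"
  shows "norm (A *v v) = norm v"
proof -
  have "orthogonal_transformation ((*v) A)"
    using assms by (simp add: orthogonal_transformation_matrix matrix_of_matrix_vector_mul SO3_def rotation_matrix_def)
  then show ?thesis by (rule orthogonal_transformation_norm)
qed

lemma norm_north: "norm north = 1"
  by (simp add: north_def norm_vec_def L2_set_def sum_3)

lemma norm_sph_point: "norm (sph_point p) = 1"
  using norm_SO3_mult[OF euler_SO3, of "snd p" "fst p" 0 north] by (simp add: euler_north norm_north)

lemma sph_coords_sph_point:
  assumes "p \<in> sph_dom" "sin (fst p) \<noteq> 0"
  shows "sph_coords (sph_point p) = p"
proof -
  obtain \<theta> \<phi> where p': "p = (\<theta>, \<phi>)" by (cases p)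
  have d: "0 \<le> \<theta>" "\<theta> \<le> pi" "0 \<le> \<phi>" "\<phi> < 2 * pi" using assms by (auto simp: p' sph_dom_def)
  then have "sin \<theta> > 0" using sin_ge_zero[of \<theta>] assms by (simp add: p')
  then have "Arg2pi (Complex (sin \<theta> * cos \<phi>) (sin \<theta> * sin \<phi>)) = \<phi>"
    using d by (intro Arg2pi_unique[of "sin \<theta>"]) (auto simp: complex_eq_iff Re_exp Im_exp)
  then show ?thesis
    using d by (simp add: sph_coords_eq norm_sph_point) (simp add: p' sph_point_def arccos_cos)
qed

text \<open>The rotation \<open>E\<close> built from the coordinates of the image of the north pole
  moves the north pole as A does, so the quotient of the two fixes it and is a rotation about the
  z-axis.\<close>

lemma euler_exists:
  assumes "A \<in> SO3"
  obtains c where "0 \<le> c" "c < 2 * pi"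
    "A = euler (snd (sph_coords (A *v north))) (fst (sph_coords (A *v north))) c"
proof -
  define p where "p = sph_coords (A *v north)"
  define E where "E = rot_z (snd p) ** rot_y (fst p)"
  have n: "norm (A *v north) = 1" using norm_SO3_mult[OF assms] norm_north by simp
  have E: "E \<in> SO3" unfolding E_def by (intro SO3_mult rot_z_SO3 rot_y_SO3)
  have rz0: "rot_z 0 = mat 1" by (simp add: rot_z_def mat3_simps)
  have "E *v north = sph_point p"
    using euler_north[of "snd p" "fst p" 0] by (simp add: euler_def E_def rz0)
  also have "\<dots> = A *v north" unfolding p_def by (rule sph_coords_props(2)[OF n])
  finally have "(transpose E ** A) *v north = north"
    by (metis E SO3_transpose_mult(1) matrix_vector_mul_assoc matrix_vector_mul_lid)
  then have "(transpose E ** A) $ 1 $ 3 = 0" "(transpose E ** A) $ 2 $ 3 = 0" "(transpose E ** A) $ 3 $ 3 = 1"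
    unfolding mult_north by (simp_all add: north_def vec_eq_iff forall_3)
  then obtain c where c: "0 \<le> c" "c < 2 * pi" "transpose E ** A = rot_z c"
    using SO3_fix_north SO3_mult[OF SO3_transpose[OF E] assms] by blast
  have "A = E ** rot_z c"
    unfolding c(3)[symmetric] matrix_mul_assoc SO3_transpose_mult(2)[OF E] by simp
  then show ?thesis using c that by (simp add: euler_def E_def p_def)
qed

text \<open>The third row of an Euler matrix is (- sin b cos c, sin b sin c, cos b), which exhibits
  c unless sin b = 0. In that case the first angle is 0 by convention, and c is found in the second
  row.\<close>

definition third_euler_formula :: "real^3^3 \<Rightarrow> real" where
  "third_euler_formula A = (if A $ 3 $ 1 = 0 \<and> A $ 3 $ 2 = 0 then Arg2pi (Complex (A $ 2 $ 2) (A $ 2 $ 1))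
     else Arg2pi (Complex (- A $ 3 $ 1) (A $ 3 $ 2)))"

lemma third_euler_formula_euler:
  assumes "0 \<le> c" "c < 2 * pi" "0 \<le> b" "b \<le> pi" "sin b = 0 \<longrightarrow> a = 0"
  shows "third_euler_formula (euler a b c) = c"
proof (cases "sin b = 0")
  case True
  then have "a = 0" using assms by simp
  with True show ?thesis
    using assms by (simp add: third_euler_formula_def euler_entries)
      (intro Arg2pi_unique[of 1], auto simp: complex_eq_iff Re_exp Im_exp)
next
  case False
  then have "sin b > 0" using sin_ge_zero[of b] assms by simp
  moreover have "\<not> (cos c = 0 \<and> sin c = 0)" using sin_cos_squared_add[of c] by force
  ultimately show ?thesis
    using assms by (auto simp: third_euler_formula_def euler_entries complex_eq_iff Re_exp Im_exp
        intro!: Arg2pi_unique[of "sin b"])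
qed

lemma third_euler_eq:
  assumes "A \<in> SO3"
  shows "third_euler A = third_euler_formula A"
    and "A = euler (snd (sph_coords (A *v north))) (fst (sph_coords (A *v north))) (third_euler A)"
proof -
  define p where "p = sph_coords (A *v north)"
  have n: "norm (A *v north) = 1" using norm_SO3_mult[OF assms] norm_north by simp
  obtain c where c: "0 \<le> c" "c < 2 * pi" "A = euler (snd p) (fst p) c"
    using euler_exists[OF assms] unfolding p_def by metis
  have p: "0 \<le> fst p" "fst p \<le> pi" "0 \<le> snd p" "snd p < 2 * pi" "sin (fst p) = 0 \<longrightarrow> snd p = 0"
    using sph_coords_props[OF n] unfolding p_def[symmetric] by (auto simp: sph_dom_def mem_Times_iff)
  have "third_euler A = c"
    unfolding third_euler_def
  proof (rule the_equality)
    show "c \<in> {0..<2 * pi} \<and> (\<exists>a\<in>{0..<2 * pi}. \<exists>b\<in>{0..pi}. A = euler a b c \<and> (sin b = 0 \<longrightarrow> a = 0))"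
      by (intro conjI bexI[of _ "snd p"] bexI[of _ "fst p"]) (use c p in auto)
    show "c' = c" if "c' \<in> {0..<2 * pi} \<and> (\<exists>a\<in>{0..<2 * pi}. \<exists>b\<in>{0..pi}. A = euler a b c' \<and> (sin b = 0 \<longrightarrow> a = 0))" for c'
      using that third_euler_formula_euler[OF c(1,2) p(1,2,5)] c(3) third_euler_formula_euler
      by (metis atLeastAtMost_iff atLeastLessThan_iff)
  qed
  then show "third_euler A = third_euler_formula A"
    "A = euler (snd (sph_coords (A *v north))) (fst (sph_coords (A *v north))) (third_euler A)"
    unfolding p_def[symmetric] using c third_euler_formula_euler[OF c(1,2) p(1,2,5)] by simp_all
qed

text \<open>One of the two preimages of A in SU(2). The choice jumps as A varies, but coefficients
  of even degree, such as those in \<open>wigner\<close>, are the same for both preimages.\<close>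

definition spin_of :: "real^3^3 \<Rightarrow> complex \<times> complex" where
  "spin_of A = spinor3 (snd (sph_coords (A *v north))) (fst (sph_coords (A *v north))) (third_euler A)"

definition wigner :: "nat \<Rightarrow> nat \<Rightarrow> nat \<Rightarrow> real^3^3 \<Rightarrow> complex" where
  "wigner l j k A = dmat (2 * l) j k (spin_of A)"

lemma rot_of_spin_of: "A \<in> SO3 \<Longrightarrow> rot_of (spin_of A) = A"
  unfolding spin_of_def euler_eq[symmetric] using third_euler_eq(2) by metis

lemma spin_of_SU2: "spin_of A \<in> SU2"
  unfolding spin_of_def by (rule spinor3_SU2)

lemma wigner_rot_of:
  assumes "rot_of u \<in> SO3" "k \<le> 2 * l"
  shows "wigner l j k (rot_of u) = dmat (2 * l) j k u"
proof -
  have "spin_of (rot_of u) = u \<or> spin_of (rot_of u) = - u"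
    using rot_of_inj rot_of_spin_of[OF assms(1)] by blast
  then show ?thesis
    unfolding wigner_def using dmat_uminus[of "2 * l" k j u] assms(2) by auto
qed

lemma wigner_mult:
  assumes "A \<in> SO3" "B \<in> SO3" "k \<le> 2 * l"
  shows "wigner l j k (A ** B) = (\<Sum>i\<le>2 * l. wigner l j i A * wigner l i k B)"
proof -
  have e: "A ** B = rot_of (spin_mult (spin_of A) (spin_of B))"
    by (simp add: rot_of_mult rot_of_spin_of assms)
  have "rot_of (spin_mult (spin_of A) (spin_of B)) \<in> SO3"
    unfolding e[symmetric] by (rule SO3_mult[OF assms(1,2)])
  then show ?thesis unfolding e
    by (simp add: wigner_rot_of assms(3) dmat_spin_mult) (simp add: wigner_def)
qed

lemma wigner_transpose:
  assumes "A \<in> SO3" "j \<le> 2 * l" "k \<le> 2 * l"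
  shows "wigner l j k (transpose A) = cnj (wigner l k j A)"
proof -
  have e: "transpose A = rot_of (spin_adj (spin_of A))"
    by (simp add: rot_of_adj rot_of_spin_of assms)
  have "rot_of (spin_adj (spin_of A)) \<in> SO3"
    unfolding e[symmetric] by (rule SO3_transpose[OF assms(1)])
  then show ?thesis unfolding e
    using assms by (simp add: wigner_rot_of dmat_adj) (simp add: wigner_def)
qed

lemma wigner_orthonormal_columns:
  assumes "j \<le> 2 * l" "k \<le> 2 * l"
  shows "(\<Sum>i\<le>2 * l. cnj (wigner l i j A) * wigner l i k A) = (if j = k then 1 else 0)"
  unfolding wigner_def by (rule dmat_orthonormal_columns[OF spin_of_SU2 assms])

lemma wigner_orthonormal_rows:
  assumes "j \<le> 2 * l" "k \<le> 2 * l"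
  shows "(\<Sum>i\<le>2 * l. wigner l j i A * cnj (wigner l k i A)) = (if j = k then 1 else 0)"
  unfolding wigner_def by (rule dmat_orthonormal_rows[OF spin_of_SU2 assms])

lemma norm_wigner_le: 
  assumes "j \<le> 2 * l" "k \<le> 2 * l"
  shows "cmod (wigner l j k A) \<le> 1"
proof -
  have "of_real (\<Sum>i\<le>2 * l. (cmod (wigner l j i A))\<^sup>2) = (1 :: complex)"
    using wigner_orthonormal_rows[OF assms(1) assms(1), of A] unfolding of_real_sum complex_norm_square by simp
  then have "(\<Sum>i\<le>2 * l. (cmod (wigner l j i A))\<^sup>2) = 1"
    by (simp only: of_real_eq_1_iff)
  moreover have "(cmod (wigner l j k A))\<^sup>2 \<le> (\<Sum>i\<le>2 * l. (cmod (wigner l j i A))\<^sup>2)"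
    using assms(2) by (intro member_le_sum) auto
  ultimately show ?thesis by (simp add: power2_le_iff_abs_le abs_square_le_1)
qed

section \<open>Functions of spin weight s lifted to SO(3)\<close>

text \<open>The value at the image of the north pole, with a phase that depends on the remaining
  rotation about the axis. The phase in \<open>rotate_spin\<close> is of this form, so rotating a
  function becomes a left translation of its lift.\<close>

definition lift_spin :: "int \<Rightarrow> (sph \<Rightarrow> complex) \<Rightarrow> real^3^3 \<Rightarrow> complex" where
  "lift_spin s f A = exp (- \<i> * of_int s * of_real (third_euler A)) * f (sph_coords (A *v north))"

abbreviation frame :: "sph \<Rightarrow> real^3^3" where "frame x \<equiv> euler (snd x) (fst x) 0"

lemma rotate_spin_eq_lift:
  assumes "A \<in> SO3"
  shows "rotate_spin s A f x = lift_spin s f (transpose A ** frame x)"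
  unfolding rotate_spin_def lift_spin_def
  by (simp add: SO3_matrix_inv[OF assms] matrix_vector_mul_assoc[symmetric] euler_north split_beta)

text \<open>The index j stands for l + m.\<close>

definition spin_harm_ext :: "int \<Rightarrow> nat \<Rightarrow> nat \<Rightarrow> sph \<Rightarrow> complex" where
  "spin_harm_ext s l j x = of_real (sqrt ((2 * real l + 1) / (4 * pi))) * wigner l j (nat (int l - s)) (frame x)"

lemma spin_harm_ext_eq:
  assumes "\<bar>s\<bar> \<le> int l"
  shows "spin_harm_ext s l j (\<theta>, \<phi>) = of_real (sqrt ((2 * real l + 1) / (4 * pi))) *
    dmat (2 * l) j (nat (int l - s)) (spinor \<theta> \<phi>)"
  using wigner_rot_of[of "spinor \<theta> \<phi>" "nat (int l - s)" l j] assms euler_SO3[of \<phi> \<theta> 0]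
  by (simp add: spin_harm_ext_def euler_eq spinor3_0)

text \<open>The poles are excluded: there \<open>spin_harm\<close> depends on derivatives that need
  not exist, whereas \<open>spin_harm_ext\<close> continues the formula smoothly.\<close>

lemma spin_harm_eq_ext:
  assumes "\<bar>s\<bar> \<le> int l" "\<bar>m\<bar> \<le> int l" "0 < fst x" "fst x < pi"
  shows "spin_harm s l m x = harm_sign m * spin_harm_ext s l (nat (int l + m)) x"
  using spin_harm_eq_dmat[OF assms, of "snd x"] spin_harm_ext_eq[OF assms(1), of _ "fst x" "snd x"] by simp

text \<open>Column l - s has torus weight w^(l + s) times (cnj w)^(l - s), that is w^(2 s). For w =
  exp(- i c / 2) this is exp(- i s c), precisely the phase of the lift, so the lifted harmonic is an
  entry of the representation itself.\<close>

lemma lift_spin_harm_ext: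
  assumes A: "A \<in> SO3" and s: "\<bar>s\<bar> \<le> int l"
  shows "lift_spin s (spin_harm_ext s l j) A =
    of_real (sqrt ((2 * real l + 1) / (4 * pi))) * wigner l j (nat (int l - s)) A"
proof -
  define p where "p = sph_coords (A *v north)"
  define c where "c = third_euler A"
  define k where "k = nat (int l - s)"
  have k: "real (2 * l - k) = real l + real_of_int s" "real k = real l - real_of_int s"
    using s by (auto simp: k_def)
  have "cis (- c / 2) ^ (2 * l - k) * cnj (cis (- c / 2)) ^ k = cis (real (2 * l - k) * (- c / 2) + real k * (c / 2))"
    by (simp only: cis_cnj Complex.DeMoivre cis_mult) simp
  also have "\<dots> = exp (- \<i> * of_int s * of_real c)"
    unfolding k cis_conv_exp by (simp add: field_simps)
  finally have ph: "cis (- c / 2) ^ (2 * l - k) * cnj (cis (- c / 2)) ^ k = exp (- \<i> * of_int s * of_real c)" .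
  have "wigner l j k A = exp (- \<i> * of_int s * of_real c) * dmat (2 * l) j k (spinor (fst p) (snd p))"
    unfolding wigner_def spin_of_def p_def[symmetric] c_def[symmetric] spinor3_def dmat_phase ph ..
  then show ?thesis
    using spin_harm_ext_eq[OF s, of j "fst p" "snd p"]
    by (simp add: lift_spin_def p_def[symmetric] c_def[symmetric] k_def[symmetric])
qed

text \<open>After lifting, this is the homomorphism property for the product of the inverse of A and
  the frame at x, together with unitarity. In particular the harmonics of one degree span an
  invariant space.\<close>

lemma rotate_spin_harm_ext:
  assumes A: "A \<in> SO3" and s: "\<bar>s\<bar> \<le> int l" and j: "j \<le> 2 * l"
  shows "rotate_spin s A (spin_harm_ext s l j) x = (\<Sum>i\<le>2 * l. cnj (wigner l i j A) * spin_harm_ext s l i x)"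
proof -
  have "nat (int l - s) \<le> 2 * l" using s by auto
  then show ?thesis
    using j unfolding rotate_spin_eq_lift[OF A] lift_spin_harm_ext[OF SO3_mult[OF SO3_transpose[OF A] euler_SO3] s]
    by (simp add: wigner_mult SO3_transpose A euler_SO3 wigner_transpose spin_harm_ext_def sum_distrib_left mult_ac)
qed

text \<open>The addition theorem at coinciding points: a column of a unitary matrix has length
  1.\<close>

lemma sum_norm_spin_harm_ext:
  assumes "\<bar>s\<bar> \<le> int l"
  shows "(\<Sum>i\<le>2 * l. (cmod (spin_harm_ext s l i x))\<^sup>2) = (2 * real l + 1) / (4 * pi)"
proof -
  have k: "nat (int l - s) \<le> 2 * l" using assms by auto
  have "of_real (\<Sum>i\<le>2 * l. (cmod (wigner l i (nat (int l - s)) (frame x)))\<^sup>2) = (1 :: complex)"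
    using wigner_orthonormal_columns[OF k k, of "frame x"] unfolding of_real_sum complex_norm_square by (simp add: mult.commute)
  then have h: "(\<Sum>i\<le>2 * l. (cmod (wigner l i (nat (int l - s)) (frame x)))\<^sup>2) = 1"
    by (simp only: of_real_eq_1_iff)
  show ?thesis
    unfolding spin_harm_ext_def norm_mult power_mult_distrib sum_distrib_left[symmetric] h by simp
qed

section \<open>Measurability of Euler angles, lifts and matrix coefficients\<close>

lemma borel_measurable_Arg2pi [measurable]: "Arg2pi \<in> borel_measurable borel"
  by (rule borel_measurableI_greater) (simp add: open_Arg2pi2pi_gt borel_open)

lemma borel_measurable_Complex [measurable (raw)]:
  assumes [measurable]: "f \<in> borel_measurable M" "g \<in> borel_measurable M"
  shows "(\<lambda>x. Complex (f x) (g x)) \<in> borel_measurable M"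
  unfolding Complex_eq by measurable

lemma borel_measurable_mat_nth [measurable]: "(\<lambda>A :: real^3^3. A $ i $ j) \<in> borel_measurable borel"
  by (intro borel_measurable_continuous_onI continuous_intros)

abbreviation SO3_borel :: "(real^3^3) measure" where "SO3_borel \<equiv> restrict_space borel SO3"

lemma third_euler_measurable [measurable]: "third_euler \<in> borel_measurable SO3_borel"
proof -
  have "third_euler_formula \<in> borel_measurable borel"
    unfolding third_euler_formula_def by measurable
  then have "third_euler_formula \<in> borel_measurable SO3_borel" by (rule measurable_restrict_space1)
  then show ?thesis
    by (subst measurable_cong[of _ _ third_euler_formula]) (auto simp: third_euler_eq(1) space_restrict_space)
qed

text \<open>Total and Borel measurable; outside of the unit sphere the values are irrelevant.\<close>

definition coords_formula :: "real^3 \<Rightarrow> sph" where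
  "coords_formula v = (arccos (max (-1) (min 1 (v $ 3))), Arg2pi (Complex (v $ 1) (v $ 2)))"

lemma sph_coords_eq_formula: "norm v = 1 \<Longrightarrow> sph_coords v = coords_formula v"
  using component_le_norm_cart[of v 3] by (simp add: sph_coords_eq coords_formula_def)

lemma coords_formula_measurable [measurable]: "coords_formula \<in> measurable borel (restrict_space borel sph_dom)"
proof (rule measurable_restrict_space2)
  show "coords_formula \<in> space borel \<rightarrow> sph_dom"
    using Arg2pi_ge_0 Arg2pi_lt_2pi arccos_lbound arccos_ubound
    by (auto simp: coords_formula_def sph_dom_def)
  have [measurable]: "(\<lambda>y :: real. arccos (max (-1) (min 1 y))) \<in> borel_measurable borel"
    by (intro borel_measurable_continuous_onI continuous_on_arccos continuous_intros) auto
  show "coords_formula \<in> borel_measurable borel"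
    unfolding coords_formula_def by measurable
qed

lemma borel_measurable_mult_north [measurable]: "(\<lambda>A :: real^3^3. A *v w) \<in> borel_measurable borel"
proof (rule borel_measurable_continuous_onI)
  show "continuous_on UNIV (\<lambda>A :: real^3^3. A *v w)"
    unfolding matrix_vector_mult_def by (intro continuous_on_vec_lambda continuous_intros)
qed

lemma sph_coords_north_measurable [measurable]:
  "(\<lambda>A. sph_coords (A *v north)) \<in> measurable SO3_borel (restrict_space borel sph_dom)"
proof (subst measurable_cong)
  fix A assume "A \<in> space SO3_borel"
  then have "norm (A *v north) = 1"
    using norm_SO3_mult norm_north by (simp add: space_restrict_space)
  then show "sph_coords (A *v north) = coords_formula (A *v north)" by (rule sph_coords_eq_formula)
next
  have "(\<lambda>A. coords_formula (A *v north)) \<in> measurable borel (restrict_space borel sph_dom)"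
    by measurable
  then show "(\<lambda>A. coords_formula (A *v north)) \<in> measurable SO3_borel (restrict_space borel sph_dom)"
    by (rule measurable_restrict_space1)
qed

lemma sets_sph_measure: "sets sph_measure = sets (restrict_space borel sph_dom)"
  unfolding sph_measure_def by (simp cong: sets_restrict_space_cong)

lemma space_sph_measure: "space sph_measure = sph_dom"
  using sets_eq_imp_space_eq[OF sets_sph_measure] by (simp add: space_restrict_space)

lemma lift_spin_measurable [measurable (raw)]:
  assumes "f \<in> borel_measurable sph_measure"
  shows "lift_spin s f \<in> borel_measurable SO3_borel"
proof -
  have f: "f \<in> borel_measurable (restrict_space borel sph_dom)"
    using assms by (simp add: measurable_cong_sets[OF sets_sph_measure refl])
  have [measurable]: "(\<lambda>A. f (sph_coords (A *v north))) \<in> borel_measurable SO3_borel"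
    by (rule measurable_compose[OF sph_coords_north_measurable f])
  show ?thesis unfolding lift_spin_def by measurable
qed

lemma spin_fun_real_measurable: "spin_fun_real p q j \<in> borel_measurable borel"
proof -
  have "spin_fun_real p q j = (\<lambda>\<theta>. \<Sum>i\<le>j. of_nat (p choose i) * sin (\<theta> / 2) ^ i * cos (\<theta> / 2) ^ (p - i) *
      (of_nat (q choose (j - i)) * cos (\<theta> / 2) ^ (j - i) * (- sin (\<theta> / 2)) ^ (q - (j - i))))"
    by (rule ext) (simp add: spin_fun_real_def coeff_mult coeff_linear_power)
  then show ?thesis by (simp only:) measurable
qed

lemma spin_harm_ext_measurable_borel:
  assumes "\<bar>s\<bar> \<le> int l"
  shows "spin_harm_ext s l j \<in> borel_measurable borel"
proof -
  have [measurable]: "fst \<in> borel_measurable (borel :: sph measure)" "snd \<in> borel_measurable (borel :: sph measure)"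
    by (intro borel_measurable_continuous_onI continuous_intros)+
  have [measurable]: "(\<lambda>x. spin_fun_real p q j (fst x)) \<in> borel_measurable (borel :: sph measure)" for p q j
    by (rule measurable_compose[OF _ spin_fun_real_measurable]) measurable
  have [measurable]: "(\<lambda>x. cis (f x)) \<in> borel_measurable M" if "f \<in> borel_measurable M" for f and M :: "sph measure"
    using that unfolding cis_conv_exp by measurable
  have "spin_harm_ext s l j = (\<lambda>x. of_real (sqrt ((2 * real l + 1) / (4 * pi))) *
    (of_real (sqrt (fact j * fact (2 * l - j) / (fact (nat (int l - s)) * fact (2 * l - nat (int l - s))))) *
      spin_fun (2 * l - nat (int l - s)) (nat (int l - s)) j (fst x) (snd x)))"
    using spin_harm_ext_eq[OF assms] by (auto simp: fun_eq_iff dmat_def spin_fun_def)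
  also have "\<dots> \<in> borel_measurable borel"
    unfolding spin_fun_eq by measurable
  finally show ?thesis .
qed

lemma spin_harm_ext_measurable [measurable]:
  assumes "\<bar>s\<bar> \<le> int l"
  shows "spin_harm_ext s l j \<in> borel_measurable sph_measure"
  using measurable_restrict_space1[OF spin_harm_ext_measurable_borel[OF assms]]
  by (simp add: measurable_cong_sets[OF sets_sph_measure refl])

text \<open>Column k is the lift of a harmonic of spin weight l - k, up to a nonzero constant.
  Measurability of lifts therefore settles that of the coefficients, in spite of the discontinuous
  choice in \<open>spin_of\<close>.\<close>

lemma wigner_measurable [measurable]:
  assumes "j \<le> 2 * l" "k \<le> 2 * l"
  shows "wigner l j k \<in> borel_measurable SO3_borel"
proof -
  define s where "s = int l - int k"
  have s: "\<bar>s\<bar> \<le> int l" "nat (int l - s) = k" using assms by (auto simp: s_def)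
  have "lift_spin s (spin_harm_ext s l j) \<in> borel_measurable SO3_borel"
    using s(1) by measurable
  then have "(\<lambda>A. of_real (1 / sqrt ((2 * real l + 1) / (4 * pi))) * lift_spin s (spin_harm_ext s l j) A) \<in> borel_measurable SO3_borel"
    by measurable
  moreover have "of_real (1 / sqrt ((2 * real l + 1) / (4 * pi))) * lift_spin s (spin_harm_ext s l j) A = wigner l j k A" if "A \<in> SO3" for A
  proof -
    have "sqrt ((2 * real l + 1) / (4 * pi)) \<noteq> 0" by (simp add: add_nonneg_eq_0_iff)
    then show ?thesis unfolding lift_spin_harm_ext[OF that s(1)] s(2) by simp
  qed
  ultimately show ?thesis
    by (subst (asm) measurable_cong[of _ _ "wigner l j k"]) (auto simp: space_restrict_space)
qed

section \<open>Orthogonality of the matrix coefficients\<close>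

lemma borel_measurable_cnj [measurable (raw)]:
  assumes "f \<in> borel_measurable M"
  shows "(\<lambda>x. cnj (f x)) \<in> borel_measurable M"
  by (rule measurable_compose[OF assms borel_measurable_continuous_onI]) (intro continuous_intros)

lemma borel_measurable_matrix_mult [measurable (raw)]:
  fixes f g :: "'a \<Rightarrow> real^3^3"
  assumes [measurable]: "f \<in> borel_measurable M" "g \<in> borel_measurable M"
  shows "(\<lambda>x. f x ** g x) \<in> borel_measurable M"
  by (rule borel_measurable_continuous_Pair[OF assms])
    (auto simp: matrix_matrix_mult_def intro!: continuous_on_vec_lambda continuous_intros)

lemma borel_measurable_transpose [measurable (raw)]:
  fixes f :: "'a \<Rightarrow> real^3^3"
  assumes [measurable]: "f \<in> borel_measurable M"
  shows "(\<lambda>x. transpose (f x)) \<in> borel_measurable M"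
proof (rule measurable_compose[OF assms borel_measurable_continuous_onI])
  show "continuous_on UNIV (transpose :: real^3^3 \<Rightarrow> real^3^3)"
    unfolding transpose_def by (intro continuous_on_vec_lambda continuous_intros)
qed

lemma borel_measurable_SO3_borel: "f \<in> measurable M SO3_borel \<Longrightarrow> f \<in> borel_measurable M"
  unfolding measurable_restrict_space2_iff by simp

lemma measurable_SO3_mult [measurable (raw)]:
  assumes "f \<in> measurable M SO3_borel" "g \<in> measurable M SO3_borel"
  shows "(\<lambda>x. f x ** g x) \<in> measurable M SO3_borel"
  unfolding measurable_restrict_space2_iff
  using borel_measurable_matrix_mult[OF assms[THEN borel_measurable_SO3_borel]] assms[THEN measurable_space]
  by (auto simp: space_restrict_space intro!: SO3_mult)

lemma measurable_SO3_transpose [measurable (raw)]: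
  assumes "f \<in> measurable M SO3_borel"
  shows "(\<lambda>x. transpose (f x)) \<in> measurable M SO3_borel"
  unfolding measurable_restrict_space2_iff
  using borel_measurable_transpose[OF assms[THEN borel_measurable_SO3_borel]] assms[THEN measurable_space]
  by (auto simp: space_restrict_space intro!: SO3_transpose)

section \<open>Invariance properties of the Haar measure\<close>

locale haar =
  fixes \<nu> :: "(real^3^3) measure"
  assumes haar: "haar_SO3 \<nu>"
begin

lemma sets_haar [measurable_cong]: "sets \<nu> = sets SO3_borel"
  using haar by (simp add: haar_SO3_def)

lemma space_haar: "space \<nu> = SO3"
  using sets_eq_imp_space_eq[OF sets_haar] by (simp add: space_restrict_space)

lemma emeasure_haar: "emeasure \<nu> (space \<nu>) = ennreal (8 * pi\<^sup>2)"
  using haar by (simp add: haar_SO3_def space_haar)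

sublocale finite_measure \<nu>
  by standard (simp add: emeasure_haar)

lemma measure_haar: "measure \<nu> (space \<nu>) = 8 * pi\<^sup>2"
  by (simp add: measure_def emeasure_haar)

lemma measurable_left_mult:
  assumes "B \<in> SO3"
  shows "(**) B \<in> measurable \<nu> \<nu>"
proof -
  have Bc: "(\<lambda>A. B) \<in> measurable \<nu> SO3_borel" using assms by (simp add: space_restrict_space)
  show ?thesis
    using measurable_SO3_mult[OF Bc measurable_ident_sets[OF sets_haar]]
    by (simp add: measurable_cong_sets[OF refl sets_haar])
qed

lemma distr_left_mult:
  assumes B: "B \<in> SO3"
  shows "distr \<nu> \<nu> ((**) B) = \<nu>"
proof (rule measure_eqI)
  note m = measurable_left_mult[OF B]
  fix E assume "E \<in> sets (distr \<nu> \<nu> ((**) B))"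
  then have E: "E \<in> sets \<nu>" by simp
  then have "E \<subseteq> SO3" using sets.sets_into_space[OF E] by (simp add: space_haar)
  \<comment> \<open>The invariance in \<open>haar_SO3\<close> speaks of images; the preimage under
    multiplication by B is the image under multiplication by the inverse.\<close>
  then have "(**) B -` E \<inter> space \<nu> = (\<lambda>A. transpose B ** A) ` E"
    using B SO3_transpose_mult[OF B] SO3_mult[OF SO3_transpose[OF B]]
    by (auto simp: space_haar matrix_mul_assoc image_iff) (metis matrix_mul_assoc matrix_mul_lid)
  then have "emeasure (distr \<nu> \<nu> ((**) B)) E = emeasure \<nu> ((\<lambda>A. transpose B ** A) ` E)"
    using E m by (simp add: emeasure_distr)
  also have "\<dots> = emeasure \<nu> E"
    using haar E SO3_transpose[OF B] by (simp add: haar_SO3_def)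
  finally show "emeasure (distr \<nu> \<nu> ((**) B)) E = emeasure \<nu> E" .
qed simp

lemma nn_integral_left_mult:
  assumes "B \<in> SO3" "F \<in> borel_measurable \<nu>"
  shows "(\<integral>\<^sup>+A. F (B ** A) \<partial>\<nu>) = (\<integral>\<^sup>+A. F A \<partial>\<nu>)"
  using nn_integral_distr[OF measurable_left_mult[OF assms(1)], of F] assms(2)
  by (simp add: distr_left_mult[OF assms(1)])

lemma integral_left_mult:
  fixes F :: "real^3^3 \<Rightarrow> complex"
  assumes "B \<in> SO3" "F \<in> borel_measurable \<nu>"
  shows "(LINT A|\<nu>. F (B ** A)) = (LINT A|\<nu>. F A)"
  using integral_distr[OF measurable_left_mult[OF assms(1)], of F] assms(2)
  by (simp add: distr_left_mult[OF assms(1)])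

text \<open>Inversion invariance: both sides, multiplied by the total mass, are the double integral of
  F (x^-1 y), by left invariance in y and, after inversion, in x.\<close>

lemma nn_integral_transpose:
  assumes F: "F \<in> borel_measurable \<nu>"
  shows "(\<integral>\<^sup>+A. F (transpose A) \<partial>\<nu>) = (\<integral>\<^sup>+A. F A \<partial>\<nu>)"
proof -
  interpret P: pair_sigma_finite \<nu> \<nu> ..
  have tr: "transpose \<in> measurable \<nu> \<nu>"
    using measurable_SO3_transpose[OF measurable_ident_sets[OF sets_haar]]
    by (simp add: measurable_cong_sets[OF refl sets_haar])
  have G: "(\<lambda>A. F (transpose A)) \<in> borel_measurable \<nu>"
    by (rule measurable_compose[OF tr F])
  have "(\<lambda>z. transpose (fst z) ** snd z) \<in> measurable (\<nu> \<Otimes>\<^sub>M \<nu>) \<nu>"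
    by measurable
  then have m: "(\<lambda>z. F (transpose (fst z) ** snd z)) \<in> borel_measurable (\<nu> \<Otimes>\<^sub>M \<nu>)"
    using F by measurable
  have "(\<integral>\<^sup>+x. \<integral>\<^sup>+y. F (transpose x ** y) \<partial>\<nu> \<partial>\<nu>) = (\<integral>\<^sup>+x. (\<integral>\<^sup>+y. F y \<partial>\<nu>) \<partial>\<nu>)"
    by (intro nn_integral_cong nn_integral_left_mult[OF _ F] SO3_transpose) (simp add: space_haar)
  moreover have "(\<integral>\<^sup>+y. \<integral>\<^sup>+x. F (transpose x ** y) \<partial>\<nu> \<partial>\<nu>) = (\<integral>\<^sup>+x. (\<integral>\<^sup>+y. F (transpose y) \<partial>\<nu>) \<partial>\<nu>)"
  proof (rule nn_integral_cong)
    fix y assume "y \<in> space \<nu>"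
    then have "transpose y \<in> SO3" by (simp add: space_haar SO3_transpose)
    from nn_integral_left_mult[OF this G]
    show "(\<integral>\<^sup>+x. F (transpose x ** y) \<partial>\<nu>) = (\<integral>\<^sup>+y. F (transpose y) \<partial>\<nu>)"
      by (simp add: matrix_transpose_mul)
  qed
  moreover have "(\<integral>\<^sup>+y. \<integral>\<^sup>+x. F (transpose x ** y) \<partial>\<nu> \<partial>\<nu>) = (\<integral>\<^sup>+x. \<integral>\<^sup>+y. F (transpose x ** y) \<partial>\<nu> \<partial>\<nu>)"
    using P.Fubini[OF m] by simp
  ultimately have "(\<integral>\<^sup>+y. F (transpose y) \<partial>\<nu>) * ennreal (8 * pi\<^sup>2) = (\<integral>\<^sup>+y. F y \<partial>\<nu>) * ennreal (8 * pi\<^sup>2)"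
    by (simp add: emeasure_haar)
  then show ?thesis by (simp add: ennreal_mult_cancel_left mult.commute[of _ "ennreal _"])
qed

lemma wigner_measurable_haar [measurable]:
  "j \<le> 2 * l \<Longrightarrow> k \<le> 2 * l \<Longrightarrow> wigner l j k \<in> borel_measurable \<nu>"
  using wigner_measurable by (simp add: measurable_cong_sets[OF sets_haar refl])

lemma integrable_wigner_mult:
  assumes "i \<le> 2 * l" "j \<le> 2 * l" "i' \<le> 2 * l'" "j' \<le> 2 * l'"
  shows "integrable \<nu> (\<lambda>A. cnj (wigner l i j A) * wigner l' i' j' A)"
proof (rule integrable_const_bound[where B = 1])
  show "(\<lambda>A. cnj (wigner l i j A) * wigner l' i' j' A) \<in> borel_measurable \<nu>"
    using assms by (intro borel_measurable_times borel_measurable_cnj wigner_measurable_haar)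
  show "AE A in \<nu>. norm (cnj (wigner l i j A) * wigner l' i' j' A) \<le> 1"
    using norm_wigner_le assms by (auto simp: norm_mult intro!: mult_le_one)
qed

section \<open>Schur orthogonality by weights\<close>

text \<open>For fixed columns j and j' these integrals, as a matrix in the rows i and i', intertwine
  the representations of degrees l and l'.\<close>

definition wigner_gram :: "nat \<Rightarrow> nat \<Rightarrow> nat \<Rightarrow> nat \<Rightarrow> nat \<Rightarrow> nat \<Rightarrow> complex" where
  "wigner_gram l i j l' i' j' = (LINT A|\<nu>. cnj (wigner l i j A) * wigner l' i' j' A)"

lemma wigner_gram_cnj: "wigner_gram l' i' j' l i j = cnj (wigner_gram l i j l' i' j')"
proof -
  have "cnj (wigner_gram l i j l' i' j') = (LINT A|\<nu>. cnj (cnj (wigner l i j A) * wigner l' i' j' A))"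
    unfolding wigner_gram_def by (rule Bochner_Integration.integral_cnj[symmetric])
  then show ?thesis by (simp add: wigner_gram_def mult.commute del: Bochner_Integration.integral_cnj)
qed

text \<open>Left invariance allows A to be replaced by the product of B and A. Expanding both
  coefficients puts a matrix of B on each side of the Gram matrix, and unitarity moves one of the
  two to the other side of the equation.\<close>

lemma wigner_gram_intertwines:
  assumes B: "B \<in> SO3" and le: "t \<le> 2 * l" "j \<le> 2 * l" "i' \<le> 2 * l'" "j' \<le> 2 * l'"
  shows "(\<Sum>i\<le>2 * l. wigner l i t B * wigner_gram l i j l' i' j') =
    (\<Sum>r\<le>2 * l'. wigner l' i' r B * wigner_gram l t j l' r j')"
proof -
  have *: "wigner_gram l i j l' i' j' =
    (\<Sum>r\<le>2 * l. \<Sum>r'\<le>2 * l'. cnj (wigner l i r B) * wigner l' i' r' B * wigner_gram l r j l' r' j')"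
    if i: "i \<le> 2 * l" for i
  proof -
    have m: "(\<lambda>A. cnj (wigner l i j A) * wigner l' i' j' A) \<in> borel_measurable \<nu>"
      using integrable_wigner_mult[OF i le(2-4)] by auto
    have "wigner_gram l i j l' i' j' = (LINT A|\<nu>. cnj (wigner l i j (B ** A)) * wigner l' i' j' (B ** A))"
      unfolding wigner_gram_def using integral_left_mult[OF B m] by simp
    also have "\<dots> = (LINT A|\<nu>. (\<Sum>r\<le>2 * l. \<Sum>r'\<le>2 * l'. cnj (wigner l i r B) * wigner l' i' r' B *
        (cnj (wigner l r j A) * wigner l' r' j' A)))"
    proof (intro Bochner_Integration.integral_cong refl)
      fix A assume "A \<in> space \<nu>"
      then have "A \<in> SO3" by (simp add: space_haar)
      from wigner_mult[OF B this]
      have e: "wigner l i j (B ** A) = (\<Sum>r\<le>2 * l. wigner l i r B * wigner l r j A)"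
        "wigner l' i' j' (B ** A) = (\<Sum>r\<le>2 * l'. wigner l' i' r B * wigner l' r j' A)"
        using le by auto
      show "cnj (wigner l i j (B ** A)) * wigner l' i' j' (B ** A) =
        (\<Sum>r\<le>2 * l. \<Sum>r'\<le>2 * l'. cnj (wigner l i r B) * wigner l' i' r' B * (cnj (wigner l r j A) * wigner l' r' j' A))"
        unfolding e cnj_sum complex_cnj_mult sum_product by (simp only: mult_ac)
    qed
    also have "\<dots> = (\<Sum>r\<le>2 * l. \<Sum>r'\<le>2 * l'. cnj (wigner l i r B) * wigner l' i' r' B * wigner_gram l r j l' r' j')"
      unfolding wigner_gram_def using le
      by (subst Bochner_Integration.integral_sum Bochner_Integration.integral_mult_right
          | auto intro!: Bochner_Integration.integrable_sum integrable_mult_right integrable_wigner_mult sum.cong)+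
    finally show ?thesis .
  qed
  have "(\<Sum>i\<le>2 * l. wigner l i t B * wigner_gram l i j l' i' j') =
    (\<Sum>i\<le>2 * l. \<Sum>r\<le>2 * l. \<Sum>r'\<le>2 * l'. (cnj (wigner l i r B) * wigner l i t B) * (wigner l' i' r' B * wigner_gram l r j l' r' j'))"
    by (intro sum.cong refl) (simp add: * sum_distrib_left mult_ac)
  also have "\<dots> = (\<Sum>r\<le>2 * l. \<Sum>i\<le>2 * l. \<Sum>r'\<le>2 * l'. (cnj (wigner l i r B) * wigner l i t B) * (wigner l' i' r' B * wigner_gram l r j l' r' j'))"
    by (rule sum.swap)
  also have "\<dots> = (\<Sum>r\<le>2 * l. (\<Sum>i\<le>2 * l. cnj (wigner l i r B) * wigner l i t B) * (\<Sum>r'\<le>2 * l'. wigner l' i' r' B * wigner_gram l r j l' r' j'))"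
    unfolding sum_product ..
  also have "\<dots> = (\<Sum>r\<le>2 * l. if r = t then (\<Sum>r'\<le>2 * l'. wigner l' i' r' B * wigner_gram l r j l' r' j') else 0)"
    by (intro sum.cong refl) (use le wigner_orthonormal_columns in auto)
  finally show ?thesis using le by simp
qed

lemma wigner_rot_z:
  assumes "j \<le> 2 * l" "k \<le> 2 * l"
  shows "wigner l j k (rot_z a) = (if j = k then cis ((real k - real l) * a) else 0)"
proof -
  have "cis (- a / 2) ^ (2 * l - k) * cnj (cis (- a / 2)) ^ k = cis (real (2 * l - k) * (- a / 2) + real k * (a / 2))"
    by (simp only: cis_cnj Complex.DeMoivre cis_mult) simp
  also have "real (2 * l - k) * (- a / 2) + real k * (a / 2) = (real k - real l) * a"
    using assms by (simp add: field_simps of_nat_diff)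
  finally show ?thesis
    using wigner_rot_of[of "(cis (- a / 2), 0)" k l j] rot_z_SO3[of a] assms
    by (simp add: rot_z_eq dmat_diag)
qed

text \<open>Intertwining with rotations about the z-axis, which act diagonally, leaves room for
  nonzero entries only between equal weights.\<close>

lemma wigner_gram_weights:
  assumes le: "i \<le> 2 * l" "j \<le> 2 * l" "i' \<le> 2 * l'" "j' \<le> 2 * l'"
    and ne: "int i - int l \<noteq> int i' - int l'"
  shows "wigner_gram l i j l' i' j' = 0"
proof -
  define d where "d = (real i - real l) - (real i' - real l')"
  have d: "d \<noteq> 0"
  proof
    assume "d = 0"
    then have "real_of_int (int i - int l) = real_of_int (int i' - int l')" by (simp add: d_def)
    then show False using ne by (simp only: of_int_eq_iff)
  qed
  \<comment> \<open>At this angle the two different weights produce opposite phases.\<close>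
  define a where "a = pi / d"
  have "(\<Sum>r\<le>2 * l. wigner l r i (rot_z a) * wigner_gram l r j l' i' j') = cis ((real i - real l) * a) * wigner_gram l i j l' i' j'"
    using le by (simp add: wigner_rot_z if_distrib[of "\<lambda>x. x * _"] cong: if_cong)
  moreover have "(\<Sum>r\<le>2 * l'. wigner l' i' r (rot_z a) * wigner_gram l i j l' r j') = cis ((real i' - real l') * a) * wigner_gram l i j l' i' j'"
    using le by (simp add: wigner_rot_z if_distrib[of "\<lambda>x. x * _"] cong: if_cong)
  ultimately have e: "cis ((real i - real l) * a) * wigner_gram l i j l' i' j' = cis ((real i' - real l') * a) * wigner_gram l i j l' i' j'"
    using wigner_gram_intertwines[OF rot_z_SO3 le] by metis
  have "(real i - real l) * a = (real i' - real l') * a + pi"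
    using d by (simp add: a_def d_def field_simps)
  then have "cis ((real i - real l) * a) = - cis ((real i' - real l') * a)"
    by (simp add: cis_mult[symmetric])
  with e have "2 * cis ((real i' - real l') * a) * wigner_gram l i j l' i' j' = 0" by simp
  then show ?thesis by (simp add: cis_neq_zero)
qed

lemma wigner_top_row_nonzero:
  assumes "k \<le> 2 * l"
  shows "wigner l (2 * l) k (rot_y (pi / 2)) \<noteq> 0"
proof -
  have "cos (pi / 4) > (0 :: real)" "sin (pi / 4) > (0 :: real)"
    by (simp_all add: cos_45 sin_45)
  then show ?thesis
    using wigner_rot_of[of "(of_real (cos (pi / 2 / 2)), of_real (sin (pi / 2 / 2)))" k l "2 * l"] rot_y_SO3[of "pi / 2"] assms
    by (simp add: rot_y_eq dmat_top_row)
qed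

text \<open>The highest weight l' does not occur in degree l, so intertwining with a quarter turn,
  taken at the top row of degree l', has left-hand side 0. On the right only the row of the weight
  of i survives, and its factor in the top row of the quarter turn is nonzero.\<close>

lemma wigner_gram_less:
  assumes le: "i \<le> 2 * l" "j \<le> 2 * l" "i' \<le> 2 * l'" "j' \<le> 2 * l'" and l: "l < l'"
  shows "wigner_gram l i j l' i' j' = 0"
proof (cases "int i - int l = int i' - int l'")
  case True
  have "(\<Sum>r\<le>2 * l. wigner l r i (rot_y (pi / 2)) * wigner_gram l r j l' (2 * l') j') = 0"
    using le l by (intro sum.neutral) (auto intro!: wigner_gram_weights)
  then have "0 = (\<Sum>r\<le>2 * l'. wigner l' (2 * l') r (rot_y (pi / 2)) * wigner_gram l i j l' r j')"
    using wigner_gram_intertwines[OF rot_y_SO3 le(1,2) _ le(4), of "2 * l'" "pi / 2"] by simp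
  also have "\<dots> = (\<Sum>r\<le>2 * l'. if r = i' then wigner l' (2 * l') i' (rot_y (pi / 2)) * wigner_gram l i j l' i' j' else 0)"
    using le True by (intro sum.cong refl) (auto intro!: wigner_gram_weights)
  finally show ?thesis using le wigner_top_row_nonzero[OF le(3)] by simp
qed (rule wigner_gram_weights[OF le])

text \<open>The same relation within a single degree: the two surviving terms carry the same nonzero
  entry of the quarter turn, so every diagonal entry equals the one of highest weight. This takes
  the place of Schur's lemma.\<close>

lemma wigner_gram_diag:
  assumes le: "i \<le> 2 * l" "j \<le> 2 * l" "j' \<le> 2 * l"
  shows "wigner_gram l i j l i j' = wigner_gram l (2 * l) j l (2 * l) j'"
proof -
  have "(\<Sum>r\<le>2 * l. wigner l r i (rot_y (pi / 2)) * wigner_gram l r j l (2 * l) j') =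
    (\<Sum>r\<le>2 * l. if r = 2 * l then wigner l (2 * l) i (rot_y (pi / 2)) * wigner_gram l (2 * l) j l (2 * l) j' else 0)"
    using le by (intro sum.cong refl) (auto intro!: wigner_gram_weights)
  moreover have "(\<Sum>r\<le>2 * l. wigner l (2 * l) r (rot_y (pi / 2)) * wigner_gram l i j l r j') =
    (\<Sum>r\<le>2 * l. if r = i then wigner l (2 * l) i (rot_y (pi / 2)) * wigner_gram l i j l i j' else 0)"
    using le by (intro sum.cong refl) (auto intro!: wigner_gram_weights)
  ultimately show ?thesis
    using wigner_gram_intertwines[OF rot_y_SO3 le(1,2) _ le(3), of "2 * l" "pi / 2"] wigner_top_row_nonzero[OF le(1)] le
    by simp
qed

text \<open>The common value of the diagonal entries follows from their sum over all 2 l + 1 rows: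
  by unitarity the summed integrand is constantly 1 or 0, and the total mass is 8 pi^2.\<close>

theorem wigner_orthogonality:
  assumes le: "i \<le> 2 * l" "j \<le> 2 * l" "i' \<le> 2 * l'" "j' \<le> 2 * l'"
  shows "(LINT A|\<nu>. cnj (wigner l i j A) * wigner l' i' j' A) =
    (if l = l' \<and> i = i' \<and> j = j' then of_real (8 * pi\<^sup>2 / (2 * real l + 1)) else 0)"
proof -
  consider "l < l'" | "l' < l" | "l = l'" "i \<noteq> i'" | "l = l'" "i = i'" by fastforce
  then have "wigner_gram l i j l' i' j' = (if l = l' \<and> i = i' \<and> j = j' then of_real (8 * pi\<^sup>2 / (2 * real l + 1)) else 0)"
  proof cases
    case 1
    then show ?thesis using wigner_gram_less[OF le] by simp
  next
    case 2
    then show ?thesis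
      unfolding wigner_gram_cnj[of l i j l' i' j'] using wigner_gram_less[OF le(3,4,1,2)] by simp
  next
    case 3
    then show ?thesis using wigner_gram_weights[OF le] by simp
  next
    case 4
    have "of_nat (2 * l + 1) * wigner_gram l i j l i j' = (\<Sum>r\<le>2 * l. wigner_gram l r j l r j')"
    proof -
      have "(\<Sum>r\<le>2 * l. wigner_gram l r j l r j') = (\<Sum>r\<le>2 * l. wigner_gram l i j l i j')"
      proof (intro sum.cong refl)
        fix r assume "r \<in> {..2 * l}"
        then have r: "r \<le> 2 * l" by simp
        show "wigner_gram l r j l r j' = wigner_gram l i j l i j'"
          unfolding wigner_gram_diag[OF r le(2) le(4)[folded 4(1)]] wigner_gram_diag[OF le(1,2) le(4)[folded 4(1)]] ..
      qed
      then show ?thesis by simp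
    qed
    also have "\<dots> = (LINT A|\<nu>. (\<Sum>r\<le>2 * l. cnj (wigner l r j A) * wigner l r j' A))"
      unfolding wigner_gram_def using le 4
      by (subst Bochner_Integration.integral_sum) (auto intro!: integrable_wigner_mult)
    also have "\<dots> = (if j = j' then of_real (8 * pi\<^sup>2) else 0)"
      using le 4 by (simp add: wigner_orthonormal_columns measure_haar scaleR_conv_of_real)
    finally have "of_nat (2 * l + 1) * wigner_gram l i j l i j' = (if j = j' then of_real (8 * pi\<^sup>2) else 0)" .
    moreover have "complex_of_nat (2 * l + 1) \<noteq> 0" by (simp only: of_nat_eq_0_iff)
    ultimately have "wigner_gram l i j l i j' = (if j = j' then of_real (8 * pi\<^sup>2) else 0) / of_nat (2 * l + 1)"
      by (simp add: eq_divide_eq mult.commute)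
    then show ?thesis using 4 by (simp add: add.commute)
  qed
  then show ?thesis by (simp only: wigner_gram_def)
qed

end

section \<open>Integration over the sphere and completeness of the harmonics\<close>

lemma sets_sph_dom [measurable]: "sph_dom \<in> sets borel"
proof -
  have "sph_dom \<in> sets (borel \<Otimes>\<^sub>M borel)" unfolding sph_dom_def by measurable
  then show ?thesis unfolding borel_prod .
qed

lemma borel_measurable_fst_sph [measurable]: "fst \<in> borel_measurable (borel :: sph measure)"
  and borel_measurable_snd_sph [measurable]: "snd \<in> borel_measurable (borel :: sph measure)"
  by (intro borel_measurable_continuous_onI continuous_intros)+

lemma measurable_sph_measureI: "f \<in> borel_measurable borel \<Longrightarrow> f \<in> borel_measurable sph_measure"
  unfolding measurable_cong_sets[OF sets_sph_measure refl] by (rule measurable_restrict_space1)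

lemma sph_measure_eq: "sph_measure = density (restrict_space lborel sph_dom) (\<lambda>x. ennreal (sin (fst x)))"
  unfolding sph_measure_def case_prod_unfold ..

lemma finite_measure_sph: "finite_measure sph_measure"
proof
  have "emeasure sph_measure (space sph_measure) = (\<integral>\<^sup>+x. ennreal (sin (fst x)) \<partial>restrict_space lborel sph_dom)"
    unfolding sph_measure_eq by (subst emeasure_density) (auto simp: sets_restrict_space intro!: measurable_restrict_space1 nn_integral_cong image_eqI[of _ _ sph_dom])
  also have "\<dots> \<le> (\<integral>\<^sup>+x. 1 \<partial>restrict_space lborel sph_dom)"
    by (intro nn_integral_mono) (simp add: ennreal_le_1)
  also have "\<dots> = emeasure lborel sph_dom"
    by (simp add: emeasure_restrict_space space_restrict_space)
  also have "\<dots> \<le> emeasure lborel (cbox (0, 0) (pi, 2 * pi))"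
  proof (rule emeasure_mono)
    show "sph_dom \<subseteq> cbox (0, 0) (pi, 2 * pi)" by (auto simp: sph_dom_def cbox_Pair_eq)
  qed simp
  also have "\<dots> < \<infinity>" by (rule emeasure_lborel_cbox_finite)
  finally show "emeasure sph_measure (space sph_measure) \<noteq> \<infinity>" by simp
qed

interpretation sph: finite_measure sph_measure by (rule finite_measure_sph)

text \<open>The density sin theta vanishes on the two lines of the coordinate domain that represent
  the poles.\<close>

lemma AE_sph_interior: "AE x in sph_measure. x \<in> sph_dom \<and> 0 < fst x \<and> fst x < pi"
  unfolding sph_measure_eq
proof (subst AE_density)
  have "0 < fst x \<and> fst x < pi" if "x \<in> sph_dom" "0 < sin (fst x)" for x
    using that by (cases "fst x = 0"; cases "fst x = pi") (auto simp: sph_dom_def mem_Times_iff)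
  then show "AE x in restrict_space lborel sph_dom. 0 < ennreal (sin (fst x)) \<longrightarrow> x \<in> sph_dom \<and> 0 < fst x \<and> fst x < pi"
    by (intro AE_I2) (auto simp: space_restrict_space)
qed (auto intro!: measurable_restrict_space1)

lemma integral_sph_product:
  fixes g h :: "real \<Rightarrow> complex"
  assumes "continuous_on UNIV g" "continuous_on UNIV h"
  shows "(LINT x|sph_measure. g (fst x) * h (snd x)) =
    (LINT t|lborel. indicator {0..pi} t *\<^sub>R (of_real (sin t) * g t)) * (LINT t|lborel. indicator {0..2 * pi} t *\<^sub>R h t)"
proof -
  have [measurable]: "g \<in> borel_measurable borel" "h \<in> borel_measurable borel"
    using assms by (auto intro: borel_measurable_continuous_onI)
  define u where "u t = indicator {0..pi} t *\<^sub>R (of_real (sin t) * g t)" for t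
  define v where "v t = indicator {0..<2 * pi} t *\<^sub>R h t" for t
  \<comment> \<open>The azimuth runs over a half-open interval, while the fundamental theorem of
    calculus is applied on the closed one; they differ by a null set.\<close>
  have v_AE: "AE t in lborel. v t = indicator {0..2 * pi} t *\<^sub>R h t"
    using AE_lborel_singleton[of "2 * pi"] by eventually_elim (auto simp: v_def indicator_def)
  have [measurable]: "u \<in> borel_measurable borel" "v \<in> borel_measurable borel"
    unfolding u_def v_def by measurable
  have ui: "integrable lborel u" unfolding u_def
    using assms by (intro borel_integrable_compact compact_Icc continuous_intros) (auto intro: continuous_on_subset)
  have "integrable lborel (\<lambda>t. indicator {0..2 * pi} t *\<^sub>R h t)"
    using assms by (intro borel_integrable_compact compact_Icc) (auto intro: continuous_on_subset)
  then have vi: "integrable lborel v"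
    by (subst integrable_cong_AE[OF _ _ v_AE]) auto
  have vv: "integral\<^sup>L lborel v = (LINT t|lborel. indicator {0..2 * pi} t *\<^sub>R h t)"
    by (intro integral_cong_AE v_AE) auto
  have int: "integrable (lborel \<Otimes>\<^sub>M lborel) (\<lambda>x. u (fst x) * v (snd x))"
    by (rule lborel_pair.Fubini_integrable) (auto simp: norm_mult ui vi)
  have "(LINT x|sph_measure. g (fst x) * h (snd x)) =
    (LINT x|restrict_space lborel sph_dom. sin (fst x) *\<^sub>R (g (fst x) * h (snd x)))"
    unfolding sph_measure_eq
    by (rule integral_density) (auto intro!: measurable_restrict_space1 AE_I2 sin_ge_zero simp: space_restrict_space sph_dom_def mem_Times_iff)
  also have "\<dots> = (LINT x|lborel. indicator sph_dom x *\<^sub>R sin (fst x) *\<^sub>R (g (fst x) * h (snd x)))"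
    by (rule integral_restrict_space) auto
  also have "\<dots> = (LINT x|lborel. u (fst x) * v (snd x))"
    by (intro Bochner_Integration.integral_cong refl)
      (auto simp: u_def v_def sph_dom_def indicator_def scaleR_conv_of_real split: if_splits)
  also have "\<dots> = (LINT x|(lborel \<Otimes>\<^sub>M lborel). u (fst x) * v (snd x))"
    by (simp only: lborel_prod)
  also have "\<dots> = integral\<^sup>L lborel (\<lambda>s. integral\<^sup>L lborel (\<lambda>t. u s * v t))"
    using lborel_pair.integral_fst'[OF int] by simp
  also have "\<dots> = integral\<^sup>L lborel u * integral\<^sup>L lborel v"
    by simp
  also have "u = (\<lambda>t. indicator {0..pi} t *\<^sub>R (of_real (sin t) * g t))" by (rule ext) (rule u_def)
  finally show ?thesis unfolding vv .
qed

lemma measure_sph: "measure sph_measure (space sph_measure) = 4 * pi"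
proof -
  have "(LINT t|lborel. indicator {0..pi} t *\<^sub>R complex_of_real (sin t)) = of_real (- cos pi) - of_real (- cos 0)"
    by (intro integral_FTC_Icc has_vector_derivative_of_real continuous_intros) (auto intro!: derivative_eq_intros)
  moreover have "(LINT t|lborel. indicator {0..2 * pi} t *\<^sub>R (1 :: complex)) = of_real (2 * pi) - of_real 0"
    by (intro integral_FTC_Icc has_vector_derivative_eq_rhs[OF has_vector_derivative_of_real] continuous_intros)
      (auto intro!: derivative_eq_intros)
  ultimately have "complex_of_real (measure sph_measure (space sph_measure)) = of_real (4 * pi)"
    using integral_sph_product[of "\<lambda>_. 1" "\<lambda>_. 1"] by (simp add: scaleR_conv_of_real)
  then show ?thesis by (simp only: of_real_eq_iff)
qed

lemma continuous_spin_fun_real: "continuous_on UNIV (spin_fun_real p q j)"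
proof -
  have "spin_fun_real p q j = (\<lambda>\<theta>. \<Sum>i\<le>j. of_nat (p choose i) * sin (\<theta> / 2) ^ i * cos (\<theta> / 2) ^ (p - i) *
      (of_nat (q choose (j - i)) * cos (\<theta> / 2) ^ (j - i) * (- sin (\<theta> / 2)) ^ (q - (j - i))))"
    by (rule ext) (simp add: spin_fun_real_def coeff_mult coeff_linear_power)
  then show ?thesis by (simp only:) (intro continuous_intros, simp_all)
qed

lemma integral_cis_eq_0:
  assumes "k \<noteq> (0 :: int)"
  shows "(LINT t|lborel. indicator {0..2 * pi} t *\<^sub>R cis (of_int k * t)) = 0"
proof -
  define F where "F t = cis (of_int k * t) / (\<i> * of_int k)" for t
  have "((\<lambda>t. cis (of_int k * t)) has_vector_derivative \<i> * of_int k * cis (of_int k * t)) (at t)" for t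
    using exp_scaleR_has_vector_derivative_right[of "\<i> * of_int k" t UNIV]
    by (simp add: cis_conv_exp scaleR_conv_of_real mult_ac)
  then have "(F has_vector_derivative cis (of_int k * t)) (at t)" for t
    unfolding F_def using assms
    by (auto intro!: has_vector_derivative_eq_rhs[OF has_vector_derivative_divide])
  then have "(LINT t|lborel. indicator {0..2 * pi} t *\<^sub>R cis (of_int k * t)) = F (2 * pi) - F 0"
    by (intro integral_FTC_Icc) (auto intro: has_vector_derivative_at_within intro!: continuous_intros)
  also have "cis (of_int k * (2 * pi)) = 1"
    using cis_multiple_2pi[of "of_int k"] by (simp add: mult.commute)
  then have "F (2 * pi) = F 0" by (simp add: F_def)
  finally show ?thesis by simp
qed

text \<open>The integrand is the derivative of sin t times the function obtained by lowering the spin weight.\<close>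

lemma integral_spin_fun_middle:
  assumes "l > 0"
  shows "(LINT t|lborel. indicator {0..pi} t *\<^sub>R (of_real (sin t) * spin_fun l l l t 0)) = 0"
proof -
  define F where "F t = of_real (sin t) * spin_fun (Suc l) (l - 1) l t 0" for t
  have l: "Suc l - 1 = l" "Suc (l - 1) = l" using assms by auto
  have "(F has_vector_derivative of_nat (Suc l) * (of_real (sin t) * spin_fun l l l t 0)) (at t)" for t
  proof -
    define A B C where "A = spin_fun l l l t 0" and "B = spin_fun (Suc (Suc l)) (l - 1 - 1) l t 0" and "C = spin_fun (Suc l) (l - 1) l t 0"
    have "((\<lambda>t. complex_of_real (sin t)) has_vector_derivative of_real (cos t)) (at t)"
      by (intro has_vector_derivative_of_real) (auto intro!: derivative_eq_intros)
    from has_vector_derivative_mult[OF this spin_fun_deriv_theta[of "Suc l" "l - 1" l 0 t]]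
    have "(F has_vector_derivative of_real (sin t) * ((of_nat (Suc l) * A - of_nat (l - 1) * B) / 2) + of_real (cos t) * C) (at t)"
      unfolding F_def A_def B_def C_def l by simp
    moreover have "(2 * of_nat l - of_nat (Suc l + (l - 1))) * C = (of_nat (l - 1) - of_nat (Suc l)) * of_real (cos t) * C +
        of_real (sin t) * (of_nat (Suc l) * A + of_nat (l - 1) * B)"
      using spin_fun_recurrence[of l "Suc l" "l - 1" t 0] unfolding A_def B_def C_def l .
    then have "2 * (of_real (cos t) * C) = of_real (sin t) * (of_nat (Suc l) * A + of_nat (l - 1) * B)"
      using assms by (simp add: of_nat_diff algebra_simps)
    then have "of_real (sin t) * ((of_nat (Suc l) * A - of_nat (l - 1) * B) / 2) + of_real (cos t) * C = of_nat (Suc l) * (of_real (sin t) * A)"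
      by (simp add: field_simps)
    ultimately show ?thesis by (simp add: A_def)
  qed
  then have "(LINT t|lborel. indicator {0..pi} t *\<^sub>R (of_nat (Suc l) * (of_real (sin t) * spin_fun l l l t 0))) = F pi - F 0"
    by (intro integral_FTC_Icc) (auto intro: has_vector_derivative_at_within
        intro!: continuous_intros continuous_on_subset[OF continuous_spin_fun_real] simp: spin_fun_eq)
  also have "\<dots> = 0" by (simp add: F_def)
  finally have "of_nat (Suc l) * (LINT t|lborel. indicator {0..pi} t *\<^sub>R (of_real (sin t) * spin_fun l l l t 0)) = 0"
    by (simp add: mult_scaleR_right[symmetric] del: of_nat_Suc mult_scaleR_right)
  then show ?thesis by (simp only: mult_eq_0_iff of_nat_eq_0_iff) simp
qed

text \<open>For order m other than 0 the azimuthal integral vanishes; for m = 0 the integral in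
  theta does.\<close>

lemma integral_spin_harm_ext_0:
  assumes "l > 0" "j \<le> 2 * l"
  shows "(LINT x|sph_measure. spin_harm_ext 0 l j x) = 0"
proof -
  define K where "K = complex_of_real (sqrt ((2 * real l + 1) / (4 * pi))) * of_real (sqrt (fact j * fact (2 * l - j) / (fact l * fact (2 * l - l))))"
  define m where "m = int j - int l"
  have E: "spin_harm_ext 0 l j x = K * (of_real (spin_fun_real l l j (fst x)) * cis (of_int m * snd x))" for x
  proof -
    have e: "nat (int l - 0) = l" "2 * l - l = l" "real j - real (l + l) / 2 = of_int m"
      by (auto simp: m_def)
    have "spin_harm_ext 0 l j x = K * spin_fun l l j (fst x) (snd x)"
      using spin_harm_ext_eq[of 0 l j "fst x" "snd x"]
      unfolding dmat_def spin_fun_def K_def e by simp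
    then show ?thesis unfolding spin_fun_eq e(3) by (simp only: mult_ac)
  qed
  have "(LINT x|sph_measure. of_real (spin_fun_real l l j (fst x)) * cis (of_int m * snd x)) =
     (LINT t|lborel. indicator {0..pi} t *\<^sub>R (of_real (sin t) * of_real (spin_fun_real l l j t))) *
     (LINT t|lborel. indicator {0..2 * pi} t *\<^sub>R cis (of_int m * t))"
    by (intro integral_sph_product[where g = "\<lambda>t. of_real (spin_fun_real l l j t)"] continuous_intros continuous_spin_fun_real)
  also have "\<dots> = 0"
  proof (cases "m = 0")
    case True
    then have "j = l" by (simp add: m_def)
    then show ?thesis using integral_spin_fun_middle[OF assms(1)] by (simp add: spin_fun_eq)
  next
    case False
    then show ?thesis using integral_cis_eq_0 by simp
  qed
  finally show ?thesis unfolding E by simp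
qed

section \<open>Polynomials on the sphere and the span of the harmonics\<close>

text \<open>Monomials in x + i y, x - i y and z. Unlike those in x, y, z, each of them has a
  definite azimuthal order a - b; the family is closed under products and conjugation.\<close>

definition sph_monomial :: "nat \<Rightarrow> nat \<Rightarrow> nat \<Rightarrow> real^3 \<Rightarrow> complex" where
  "sph_monomial a b c v = Complex (v $ 1) (v $ 2) ^ a * Complex (v $ 1) (- v $ 2) ^ b * of_real (v $ 3) ^ c"

lemma sph_monomial_sph_point:
  "sph_monomial a b c (sph_point x) = of_real (sin (fst x)) ^ (a + b) * cis ((real a - real b) * snd x) * of_real (cos (fst x)) ^ c"
proof -
  have "Complex (sph_point x $ 1) (sph_point x $ 2) = of_real (sin (fst x)) * cis (snd x)"
    "Complex (sph_point x $ 1) (- sph_point x $ 2) = of_real (sin (fst x)) * cis (- snd x)"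
    by (auto simp: sph_point_def split_beta complex_eq_iff)
  then show ?thesis
    by (simp add: sph_monomial_def sph_point_def split_beta power_mult_distrib power_add Complex.DeMoivre cis_mult algebra_simps)
qed

lemma continuous_sph_monomial: "continuous_on UNIV (sph_monomial a b c)"
  unfolding sph_monomial_def Complex_eq by (intro continuous_intros)

lemma sph_monomial_mult: "sph_monomial a b c v * sph_monomial a' b' c' v = sph_monomial (a + a') (b + b') (c + c') v"
  by (simp add: sph_monomial_def power_add mult_ac)

lemma cnj_sph_monomial: "cnj (sph_monomial a b c v) = sph_monomial b a c v"
proof -
  have "cnj (Complex x y) = Complex x (- y)" for x y by (simp add: complex_eq_iff)
  then show ?thesis by (simp add: sph_monomial_def mult_ac)
qed

definition bounded_borel :: "(sph \<Rightarrow> complex) set" where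
  "bounded_borel = {f \<in> borel_measurable borel. bounded (range f)}"

text \<open>Nonzero polynomials of every degree span all polynomials: subtracting a multiple of the
  one with equal degree lowers the degree.\<close>

lemma poly_functional_zero:
  fixes L :: "complex poly \<Rightarrow> complex"
  assumes add: "\<And>p q. L (p + q) = L p + L q" and smult: "\<And>c p. L (smult c p) = c * L p"
    and ex: "\<And>N. \<exists>p. degree p = N \<and> p \<noteq> 0 \<and> L p = 0"
  shows "L p = 0"
proof (induction "degree p" arbitrary: p rule: less_induct)
  case less
  obtain q where q: "degree q = degree p" "q \<noteq> 0" "L q = 0" using ex by metis
  define c r where "c = lead_coeff p / lead_coeff q" and "r = p - smult c q"
  have "coeff q (degree p) \<noteq> 0" using q by (metis leading_coeff_0_iff)
  then have "coeff r (degree p) = 0" using q by (simp add: r_def c_def)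
  moreover have "degree r \<le> degree p" unfolding r_def using q
    by (intro degree_diff_le) (auto intro: order.trans[OF degree_smult_le])
  ultimately have "r = 0 \<or> degree r < degree p"
    by (metis leading_coeff_0_iff le_neq_implies_less)
  moreover have "L 0 = 0" using smult[of 0 0] by simp
  ultimately have "L r = 0" using less by auto
  moreover have "p = r + smult c q" by (simp add: r_def)
  ultimately show ?case by (metis add smult q(3) add_0 mult_zero_right)
qed

text \<open>The factor shared by all harmonics with given s and m. For p = l + s, q = l - s, j = l +
  m the exponents |p - j| and |q - j| of the half-angle functions do not depend on l.\<close>

definition spin_weight_fun :: "int \<Rightarrow> int \<Rightarrow> sph \<Rightarrow> complex" where
  "spin_weight_fun s m x = cis (of_int m * snd x) *
     (of_real (cos (fst x / 2)) ^ nat \<bar>s - m\<bar> * of_real (sin (fst x / 2)) ^ nat \<bar>s + m\<bar>)"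

lemma spin_harm_ext_jacobi:
  assumes s: "\<bar>s\<bar> \<le> int l" and m: "\<bar>m\<bar> \<le> int l"
  obtains C where "C \<noteq> 0" "\<And>x. spin_harm_ext s l (nat (int l + m)) x = C * (spin_weight_fun s m x *
    poly (jacobi_poly (nat (int l + s)) (nat (int l - s)) (nat (int l + m))) (of_real (cos (fst x))))"
proof -
  define p q j where "p = nat (int l + s)" and "q = nat (int l - s)" and "j = nat (int l + m)"
  have e: "2 * l - q = p" "p + q = 2 * l" "j \<le> p + q" "real j - real (p + q) / 2 = of_int m"
    using s m by (auto simp: p_def q_def j_def of_nat_nat)
  have e': "(p - j) + (j - p) = nat \<bar>s - m\<bar>" "(q - j) + (j - q) = nat \<bar>s + m\<bar>"
  proof -
    have *: "(a - b) + (b - a) = nat \<bar>int a - int b\<bar>" for a b :: nat by arith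
    have "int p - int j = s - m" "int q - int j = - (s + m)" using s m by (auto simp: p_def q_def j_def)
    then show "(p - j) + (j - p) = nat \<bar>s - m\<bar>" "(q - j) + (j - q) = nat \<bar>s + m\<bar>"
      unfolding * by (simp_all only: abs_minus_cancel)
  qed
  define C where "C = complex_of_real (sqrt ((2 * real l + 1) / (4 * pi)) * sqrt (fact j * fact (2 * l - j) / (fact q * fact (2 * l - q))))"
  have "spin_harm_ext s l j x = C * (spin_weight_fun s m x * poly (jacobi_poly p q j) (of_real (cos (fst x))))" for x
  proof -
    have "spin_harm_ext s l j x = C * spin_fun p q j (fst x) (snd x)"
      using spin_harm_ext_eq[OF s, of j "fst x" "snd x"]
      unfolding dmat_def spin_fun_def C_def q_def[symmetric] e(1) by simp
    then show ?thesis
      unfolding spin_fun_eq e(4) spin_fun_real_eq_jacobi[OF e(3)] e' spin_weight_fun_def by (simp add: mult_ac)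
  qed
  moreover have "C \<noteq> 0"
    by (simp add: C_def add_nonneg_eq_0_iff)
  ultimately show ?thesis using that unfolding p_def q_def j_def by blast
qed

lemma spin_weight_poly_bounded_borel:
  "(\<lambda>x. spin_weight_fun s m x * poly p (of_real (cos (fst x)))) \<in> bounded_borel"
proof -
  have "continuous_on UNIV (\<lambda>x. spin_weight_fun s m x * poly p (of_real (cos (fst x))))"
    unfolding spin_weight_fun_def by (intro continuous_intros) simp_all
  moreover have "bounded (range (\<lambda>x :: sph. poly p (complex_of_real (cos (fst x)))))"
  proof (rule bounded_subset)
    show "bounded (poly p ` cball 0 1)"
      by (intro compact_imp_bounded compact_continuous_image continuous_intros compact_cball)
  qed auto
  then obtain B where B: "\<And>x. cmod (poly p (of_real (cos x))) \<le> B"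
    unfolding bounded_iff by (metis fst_conv rangeI)
  moreover have "cmod (spin_weight_fun s m x) \<le> 1" for x
    by (auto simp: spin_weight_fun_def norm_mult norm_power intro!: mult_le_one power_le_one)
  then have "cmod (spin_weight_fun s m x * poly p (of_real (cos (fst x)))) \<le> 1 * B" for x
    unfolding norm_mult using B by (intro mult_mono) auto
  then have "bounded (range (\<lambda>x. spin_weight_fun s m x * poly p (of_real (cos (fst x)))))"
    unfolding bounded_iff by (auto intro!: exI[of _ B])
  ultimately show ?thesis by (simp add: bounded_borel_def borel_measurable_continuous_onI)
qed

text \<open>The harmonics with fixed s, m are a fixed function times polynomials in cos of degrees 0, 1, 2, ...\<close>

lemma spin_functional_zero:
  fixes \<Lambda> :: "(sph \<Rightarrow> complex) \<Rightarrow> complex"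
  assumes add: "\<And>f g. f \<in> bounded_borel \<Longrightarrow> g \<in> bounded_borel \<Longrightarrow> \<Lambda> (\<lambda>x. f x + g x) = \<Lambda> f + \<Lambda> g"
    and cmult: "\<And>c f. f \<in> bounded_borel \<Longrightarrow> \<Lambda> (\<lambda>x. c * f x) = c * \<Lambda> f"
    and zero: "\<And>l j. \<bar>s\<bar> \<le> int l \<Longrightarrow> j \<le> 2 * l \<Longrightarrow> \<Lambda> (spin_harm_ext s l j) = 0"
  shows "\<Lambda> (\<lambda>x. spin_weight_fun s s x * sph_monomial a b c (sph_point x)) = 0"
proof -
  \<comment> \<open>Multiplication by the monomial shifts the azimuthal order from s to this
    value.\<close>
  define m where "m = s + int a - int b"
  define L where "L p = \<Lambda> (\<lambda>x. spin_weight_fun s m x * poly p (of_real (cos (fst x))))" for p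
  have L0: "L p = 0" for p
  proof (rule poly_functional_zero)
    show "L (p + q) = L p + L q" for p q
      unfolding L_def by (subst add[symmetric]) (auto intro: spin_weight_poly_bounded_borel simp: distrib_left)
    show "L (smult c p) = c * L p" for c p
      unfolding L_def by (subst cmult[symmetric]) (auto intro: spin_weight_poly_bounded_borel simp: mult_ac)
    fix N
    \<comment> \<open>The polynomial part of a harmonic has degree l - max(|s|, |m|), so this l
      yields degree N.\<close>
    define l where "l = N + max (nat \<bar>s\<bar>) (nat \<bar>m\<bar>)"
    have s: "\<bar>s\<bar> \<le> int l" and m: "\<bar>m\<bar> \<le> int l" by (auto simp: l_def)
    define J where "J = jacobi_poly (nat (int l + s)) (nat (int l - s)) (nat (int l + m))"
    obtain C where C: "C \<noteq> 0" "\<And>x. spin_harm_ext s l (nat (int l + m)) x = C * (spin_weight_fun s m x * poly J (of_real (cos (fst x))))"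
      using spin_harm_ext_jacobi[OF s m] unfolding J_def by metis
    have "0 = \<Lambda> (\<lambda>x. spin_harm_ext s l (nat (int l + m)) x)"
      using zero[OF s, of "nat (int l + m)"] m by simp
    also have "\<dots> = C * L J"
      unfolding C(2) L_def by (rule cmult[OF spin_weight_poly_bounded_borel])
    finally have "L J = 0" using C(1) by simp
    moreover have "nat (int l + m) \<le> nat (int l + s) + nat (int l - s)" using s m by auto
    from jacobi_poly_degree[OF this] have "degree J = min (nat (int l + s)) (nat (int l + m)) - (nat (int l + m) - nat (int l - s))" "J \<noteq> 0"
      unfolding J_def .
    moreover have "min (nat (int l + s)) (nat (int l + m)) - (nat (int l + m) - nat (int l - s)) = N"
    proof -
      obtain u where u: "s = int u \<or> s = - int u" by (metis abs_of_nonneg abs_of_nonpos nonneg_int_cases linear neg_0_le_iff_le add.inverse_inverse)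
      obtain v where v: "m = int v \<or> m = - int v" by (metis abs_of_nonneg abs_of_nonpos nonneg_int_cases linear neg_0_le_iff_le add.inverse_inverse)
      have nn: "nat (int l + int u) = l + u" "nat (int l + - int u) = l - u"
        "nat (int l - int u) = l - u" "nat (int l - - int u) = l + u" for u by auto
      have l: "l = N + max u v" using u v by (auto simp: l_def)
      from u v show ?thesis
        by (elim disjE) (simp_all only: nn, auto simp: l max_def min_def)
    qed
    ultimately show "\<exists>p. degree p = N \<and> p \<noteq> 0 \<and> L p = 0" by blast
  qed
  \<comment> \<open>The monomial contributes the power a + b of sin theta, hence of both half-angle
    functions. The excess over the exponents in the factor for order m is even, namely 2
    \<open>e1\<close> for the cosine and 2 \<open>e2\<close> for the sine, so it is a polynomial in
    cos theta.\<close>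
  define e1 e2 where "e1 = min a b" and "e2 = nat (if 0 \<le> s + m then \<bar>s\<bar> - s + int b else \<bar>s\<bar> + s + int a)"
  have e1: "a + b = nat \<bar>s - m\<bar> + 2 * e1" by (auto simp: e1_def m_def)
  have "int (nat \<bar>s + s\<bar> + (a + b)) = int (nat \<bar>s + m\<bar> + 2 * e2)"
    by (auto simp: e2_def m_def abs_if)
  then have e2: "nat \<bar>s + s\<bar> + (a + b) = nat \<bar>s + m\<bar> + 2 * e2"
    by (simp only: of_nat_eq_iff)
  define P :: "complex poly" where "P = smult (2 ^ (a + b)) ([:1 / 2, 1 / 2:] ^ e1 * [:1 / 2, - 1 / 2:] ^ e2 * [:0, 1:] ^ c)"
  have "spin_weight_fun s s x * sph_monomial a b c (sph_point x) = spin_weight_fun s m x * poly P (of_real (cos (fst x)))" for x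
  proof -
    define C S z where "C = complex_of_real (cos (fst x / 2))" and "S = complex_of_real (sin (fst x / 2))" and "z = complex_of_real (cos (fst x))"
    have "complex_of_real (cos (fst x)) = of_real (2 * (cos (fst x / 2))\<^sup>2 - 1)"
      and "complex_of_real (cos (fst x)) = of_real (1 - 2 * (sin (fst x / 2))\<^sup>2)"
      using cos_double_cos[of "fst x / 2"] cos_double_sin[of "fst x / 2"] by simp_all
    then have z: "z = 2 * C\<^sup>2 - 1" "z = 1 - 2 * S\<^sup>2" by (simp_all add: C_def S_def z_def)
    have ha: "poly [:1 / 2, 1 / 2:] z = C\<^sup>2" unfolding z(1) by (simp add: field_simps)
    have hb: "poly [:1 / 2, - 1 / 2:] z = S\<^sup>2" unfolding z(2) by (simp add: field_simps)
    have sn: "complex_of_real (sin (fst x)) = 2 * S * C"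
    proof -
      have "complex_of_real (sin (fst x)) = of_real (2 * sin (fst x / 2) * cos (fst x / 2))"
        using sin_double[of "fst x / 2"] by simp
      then show ?thesis by (simp add: S_def C_def)
    qed
    have ci: "cis (of_int s * snd x) * cis ((real a - real b) * snd x) = cis (of_int m * snd x)"
      by (simp add: cis_mult m_def algebra_simps)
    have "spin_weight_fun s s x * sph_monomial a b c (sph_point x) =
      (cis (of_int s * snd x) * cis ((real a - real b) * snd x)) * (2 ^ (a + b) * (S ^ nat \<bar>s + s\<bar> * S ^ (a + b)) * C ^ (a + b) * z ^ c)"
      by (simp add: spin_weight_fun_def sph_monomial_sph_point sn z_def[symmetric] S_def[symmetric] power_mult_distrib mult_ac)
    also have "\<dots> = cis (of_int m * snd x) * (C ^ nat \<bar>s - m\<bar> * S ^ nat \<bar>s + m\<bar>) * (2 ^ (a + b) * ((C\<^sup>2) ^ e1 * (S\<^sup>2) ^ e2 * z ^ c))"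
      unfolding ci power_add[symmetric] e2 unfolding e1 by (simp add: power_add power_mult power2_eq_square power_mult_distrib mult_ac)
    also have "\<dots> = spin_weight_fun s m x * poly P z"
      unfolding spin_weight_fun_def P_def poly_smult poly_mult poly_power ha hb C_def[symmetric] S_def[symmetric] by simp
    finally show ?thesis by (simp add: z_def)
  qed
  then show ?thesis using L0[of P] by (simp add: L_def)
qed

text \<open>Equal moments give equal integrals of polynomials, by Stone-Weierstrass on the compact
  sphere equal integrals of continuous functions, by approximation equal measures of closed sets,
  and these are an intersection-stable generator of the Borel sets.\<close>

lemma sph_monomial_measure_eqI:
  fixes M N :: "(real^3) measure"
  assumes sets: "sets M = sets borel" "sets N = sets borel"
    and fin: "finite_measure M" "finite_measure N"
    and AE: "AE v in M. norm v = 1" "AE v in N. norm v = 1"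
    and mom: "\<And>a b c. (LINT v|M. sph_monomial a b c v) = (LINT v|N. sph_monomial a b c v)"
  shows "M = N"
proof -
  have int_aux: "integrable L f" if "continuous_on UNIV f" "sets L = sets borel" "finite_measure L" "AE v in L. norm v = 1"
    for L and f :: "real^3 \<Rightarrow> 'b :: {banach, second_countable_topology}"
  proof -
    interpret finite_measure L by fact
    have "bounded (f ` sphere 0 1)"
      using that(1) by (intro compact_imp_bounded compact_continuous_image) (auto intro: continuous_on_subset)
    then obtain B where B: "\<And>v. norm v = 1 \<Longrightarrow> norm (f v) \<le> B"
      unfolding bounded_iff by (metis imageI mem_sphere_0)
    show ?thesis
    proof (rule integrable_const_bound[where B = B])
      show "f \<in> borel_measurable L"
        unfolding measurable_cong_sets[OF that(2) refl] using that(1) by (rule borel_measurable_continuous_onI)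
      show "AE x in L. norm (f x) \<le> B" using that(4) by eventually_elim (rule B)
    qed
  qed
  note int = int_aux[OF _ sets(1) fin(1) AE(1)] int_aux[OF _ sets(2) fin(2) AE(2)]
  \<comment> \<open>All products with monomials are included, so that the class is stable under
    multiplication by coordinates and hence under multiplication by polynomials.\<close>
  define K where "K g \<longleftrightarrow> continuous_on UNIV g \<and>
    (\<forall>a b c. (LINT v|M. g v * sph_monomial a b c v) = (LINT v|N. g v * sph_monomial a b c v))" for g
  have K_add: "K (\<lambda>v. f v + g v)" if "K f" "K g" for f g
    using that int[OF continuous_on_mult[OF _ continuous_sph_monomial]] unfolding K_def
    by (auto simp: distrib_right intro!: continuous_intros)
  have K_cmult: "K (\<lambda>v. c * f v)" if "K f" for c f
    using that unfolding K_def by (auto simp: mult.assoc intro!: continuous_intros)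
  have K_mono: "K (\<lambda>v. sph_monomial a b c v * f v)" if "K f" for a b c f
  proof -
    have e: "sph_monomial a b c v * f v * sph_monomial a' b' c' v = f v * sph_monomial (a + a') (b + b') (c + c') v" for a' b' c' v
      unfolding sph_monomial_mult[symmetric] by (simp add: mult_ac)
    show ?thesis
      using that unfolding K_def e by (auto intro!: continuous_intros continuous_sph_monomial)
  qed
  have K_poly: "K g \<Longrightarrow> K (\<lambda>v. of_real (q v) * g v)" if "real_polynomial_function q" for q :: "real^3 \<Rightarrow> real" and g
    using that
  proof (induction q arbitrary: g)
    case (linear f)
    define f1 f2 f3 where "f1 = f (axis 1 1)" and "f2 = f (axis 2 1)" and "f3 = f (axis 3 1)"
    have "f v = v $ 1 * f1 + v $ 2 * f2 + v $ 3 * f3" for v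
    proof -
      have "v = (v $ 1) *\<^sub>R axis 1 1 + (v $ 2) *\<^sub>R axis 2 1 + (v $ 3) *\<^sub>R axis 3 1"
        by (simp add: vec_eq_iff forall_3 axis_def)
      then have "f v = f ((v $ 1) *\<^sub>R axis 1 1 + (v $ 2) *\<^sub>R axis 2 1 + (v $ 3) *\<^sub>R axis 3 1)" by simp
      then show ?thesis
        using linear.hyps by (simp add: linear_simps f1_def f2_def f3_def)
    qed
    \<comment> \<open>The coordinates are x = (X + Y) / 2 and y = - i (X - Y) / 2, where X and Y
      denote x + i y and x - i y.\<close>
    then have "of_real (f v) * g v = ((of_real f1 - \<i> * of_real f2) / 2) * (sph_monomial 1 0 0 v * g v) +
      (((of_real f1 + \<i> * of_real f2) / 2) * (sph_monomial 0 1 0 v * g v) + of_real f3 * (sph_monomial 0 0 1 v * g v))" for v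
      by (simp add: sph_monomial_def Complex_eq algebra_simps) (simp add: field_simps)
    then show ?case
      by (simp only:) (intro K_add K_cmult K_mono linear.prems)
  next
    case (const c)
    then show ?case by (rule K_cmult)
  next
    case (add p q)
    then show ?case unfolding of_real_add distrib_right by (intro K_add)
  next
    case (mult p q)
    then show ?case unfolding of_real_mult mult.assoc by blast
  qed
  have K1: "K (\<lambda>_. 1)" unfolding K_def using mom by simp
  have poly: "(LINT v|M. q v) = (LINT v|N. q v)" if q: "real_polynomial_function q" for q
  proof -
    have "(LINT v|M. complex_of_real (q v)) = (LINT v|N. complex_of_real (q v))"
      using K_poly[OF q K1] unfolding K_def by (auto simp: sph_monomial_def dest!: spec[of _ 0])
    then show ?thesis by (simp add: integral_complex_of_real del: of_real_eq_iff) (simp only: of_real_eq_iff)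
  qed
  have cont: "(LINT v|M. f v) = (LINT v|N. f v)" if f: "continuous_on UNIV f" for f :: "real^3 \<Rightarrow> real"
  proof -
    define m where "m = measure M (space M) + measure N (space N)"
    have m: "m \<ge> 0" by (simp add: m_def)
    have le: "\<bar>(LINT v|M. f v) - (LINT v|N. f v)\<bar> \<le> e * m" if e: "e > 0" for e
    proof -
      obtain q where q: "real_polynomial_function q" "\<And>v. v \<in> sphere 0 1 \<Longrightarrow> \<bar>f v - q v\<bar> < e"
        using Stone_Weierstrass_real_polynomial_function[OF compact_sphere continuous_on_subset[OF f subset_UNIV] e] by metis
      have qc: "continuous_on UNIV q"
        using q(1) by (intro continuous_on_polymonial_function) (simp add: real_polynomial_function_eq)
      have *: "\<bar>(LINT v|L. f v) - (LINT v|L. q v)\<bar> \<le> e * measure L (space L)"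
        if L: "sets L = sets borel" "finite_measure L" "AE v in L. norm v = 1" for L
      proof -
        interpret finite_measure L by fact
        note i = int_aux[OF f L] int_aux[OF qc L]
        have "\<bar>(LINT v|L. f v) - (LINT v|L. q v)\<bar> = norm (LINT v|L. f v - q v)" using i by simp
        also have "\<dots> \<le> (LINT v|L. norm (f v - q v))" by (rule integral_norm_bound)
        also have "\<dots> \<le> (LINT v|L. e)"
          using i L(3) q(2) by (intro integral_mono_AE) (auto elim!: eventually_mono simp: less_imp_le)
        finally show ?thesis by (simp add: mult.commute)
      qed
      show ?thesis
        using *[OF sets(1) fin(1) AE(1)] *[OF sets(2) fin(2) AE(2)] poly[OF q(1)]
        by (simp add: m_def distrib_left)
    qed
    have "\<bar>(LINT v|M. f v) - (LINT v|N. f v)\<bar> \<le> 0"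
    proof (rule field_le_epsilon)
      fix d :: real assume "d > 0"
      have "\<bar>(LINT v|M. f v) - (LINT v|N. f v)\<bar> \<le> d / (m + 1) * m"
        using \<open>d > 0\<close> m by (intro le divide_pos_pos) auto
      also have "\<dots> \<le> d" using \<open>d > 0\<close> m by (simp add: field_simps)
      finally show "\<bar>(LINT v|M. f v) - (LINT v|N. f v)\<bar> \<le> 0 + d" by simp
    qed
    then show ?thesis by simp
  qed
  have closed: "emeasure M C = emeasure N C" if C: "closed C" for C
  proof (cases "C = {}")
    case False
    \<comment> \<open>Continuous functions with values in [0, 1], decreasing to the indicator of the
      closed set \<open>C\<close>.\<close>
    define f where "f n v = max 0 (1 - real n * infdist v C)" for n v
    have fc: "continuous_on UNIV (f n)" for n unfolding f_def by (intro continuous_intros)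
    have lim: "(\<lambda>n. f n v) \<longlonglongrightarrow> indicator C v" for v
    proof (cases "v \<in> C")
      case True
      then show ?thesis by (simp add: f_def)
    next
      case nv: False
      then have d: "infdist v C > 0" using infdist_pos_not_in_closed[OF C False] by simp
      obtain n0 where n0: "1 / infdist v C < real n0" using reals_Archimedean2 by blast
      have "f n v = 0" if "n \<ge> n0" for n
      proof -
        have "1 / infdist v C < real n" using n0 that by (meson of_nat_le_iff order_less_le_trans)
        then show ?thesis using d by (simp add: f_def field_simps)
      qed
      then have "eventually (\<lambda>n. f n v = 0) sequentially" unfolding eventually_sequentially by blast
      then show ?thesis using nv by (simp add: tendsto_eventually)
    qed
    have *: "(\<lambda>n. LINT v|L. f n v) \<longlonglongrightarrow> measure L C"
      if L: "sets L = sets borel" "finite_measure L" for L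
    proof -
      interpret finite_measure L by fact
      have "(\<lambda>n. LINT v|L. f n v) \<longlonglongrightarrow> (LINT v|L. indicator C v)"
      proof (rule integral_dominated_convergence[where w = "\<lambda>_. 1"])
        show "AE v in L. (\<lambda>n. f n v) \<longlonglongrightarrow> indicator C v" using lim by simp
        show "(\<lambda>v. indicator C v :: real) \<in> borel_measurable L"
          unfolding measurable_cong_sets[OF L(1) refl] using C by (intro borel_measurable_indicator) simp
        show "f n \<in> borel_measurable L" for n
          unfolding measurable_cong_sets[OF L(1) refl] using fc by (rule borel_measurable_continuous_onI)
        show "AE v in L. norm (f n v) \<le> 1" for n
          by (auto simp: f_def infdist_nonneg)
      qed simp
      moreover have "C \<in> sets L" using C L(1) by simp
      ultimately show ?thesis using sets.sets_into_space[of C L] by (simp add: Int_absorb2)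
    qed
    have "measure M C = measure N C"
      using LIMSEQ_unique[OF *[OF sets(1) fin(1)]] *[OF sets(2) fin(2)] cont[OF fc] by simp
    then show ?thesis
      by (simp add: finite_measure.emeasure_eq_measure[OF fin(1)] finite_measure.emeasure_eq_measure[OF fin(2)])
  qed simp
  show ?thesis
  proof (rule measure_eqI_generator_eq[of "Collect closed" UNIV M N "\<lambda>_. UNIV"])
    show "Int_stable (Collect closed :: (real^3) set set)" by (auto intro!: Int_stableI)
    show "sets M = sigma_sets UNIV (Collect closed)" "sets N = sigma_sets UNIV (Collect closed)"
      unfolding sets by (simp_all add: borel_eq_closed)
    show "emeasure M UNIV \<noteq> \<infinity>" for i :: nat
      using fin(1) by (simp add: finite_measure.emeasure_finite)
  qed (use closed in auto)
qed

section \<open>Rotation invariance of the surface measure\<close>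

lemma continuous_on_vector3:
  fixes f g h :: "'a :: topological_space \<Rightarrow> 'b :: {topological_space, zero}"
  assumes "continuous_on S f" "continuous_on S g" "continuous_on S h"
  shows "continuous_on S (\<lambda>x. vector [f x, g x, h x] :: 'b^3)"
proof -
  have e: "(vector [a, b, c] :: 'b^3) = (\<chi> i. if i = 1 then a else if i = 2 then b else c)" for a b c :: 'b
    by (simp add: vec_eq_iff forall_3)
  show ?thesis unfolding e
  proof (rule continuous_on_vec_lambda)
    show "continuous_on S (\<lambda>x. if i = 1 then f x else if i = 2 then g x else h x)" for i :: 3
      using assms by (cases "i = 1"; cases "i = 2") auto
  qed
qed

lemma sph_point_measurable [measurable]: "sph_point \<in> borel_measurable sph_measure"
  unfolding sph_point_def case_prod_unfold
  by (intro measurable_sph_measureI borel_measurable_continuous_onI continuous_on_vector3 continuous_intros)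

lemma frame_measurable [measurable]: "(\<lambda>x. frame x) \<in> measurable sph_measure SO3_borel"
proof (rule measurable_restrict_space2)
  have z: "continuous_on UNIV (\<lambda>x :: sph. rot_z (f x))" if "continuous_on UNIV f" for f
    unfolding rot_z_def using that by (intro continuous_on_vector3 continuous_intros)
  have y: "continuous_on UNIV (\<lambda>x :: sph. rot_y (f x))" if "continuous_on UNIV f" for f
    unfolding rot_y_def using that by (intro continuous_on_vector3 continuous_intros)
  have "(\<lambda>x :: sph. rot_z (f x)) \<in> borel_measurable borel" "(\<lambda>x :: sph. rot_y (f x)) \<in> borel_measurable borel"
    if "continuous_on UNIV f" for f
    using z[OF that] y[OF that] by (auto intro: borel_measurable_continuous_onI)
  moreover have "continuous_on UNIV (fst :: sph \<Rightarrow> real)" "continuous_on UNIV (snd :: sph \<Rightarrow> real)"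
    by (intro continuous_intros)+
  ultimately show "(\<lambda>x. frame x) \<in> borel_measurable sph_measure"
    unfolding euler_def by (intro measurable_sph_measureI borel_measurable_matrix_mult) auto
qed (simp add: euler_SO3)

lemma coords_formula_sph_point_AE: "AE x in sph_measure. coords_formula (sph_point x) = x"
  using AE_sph_interior
proof eventually_elim
  case (elim x)
  then have "sin (fst x) \<noteq> 0" using sin_gt_zero[of "fst x"] by simp
  then show ?case
    using sph_coords_sph_point[of x] sph_coords_eq_formula[OF norm_sph_point] elim by simp
qed

lemma coords_formula_measurable_sph: "coords_formula \<in> measurable borel sph_measure"
  using coords_formula_measurable by (simp add: measurable_cong_sets[OF refl sets_sph_measure])

text \<open>A rotation expressed in coordinates, by the total formula that is Borel measurable
  everywhere.\<close>

definition rot_coords :: "real^3^3 \<Rightarrow> sph \<Rightarrow> sph" where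
  "rot_coords A x = coords_formula (A *v sph_point x)"

lemma rot_coords_eq:
  assumes "A \<in> SO3"
  shows "rot_coords A x = sph_coords ((A ** frame x) *v north)"
    and "sph_point (rot_coords A x) = A *v sph_point x"
proof -
  have n: "norm (A *v sph_point x) = 1" by (simp add: norm_SO3_mult[OF assms] norm_sph_point)
  show "rot_coords A x = sph_coords ((A ** frame x) *v north)"
    by (simp add: rot_coords_def sph_coords_eq_formula[OF n, symmetric] matrix_vector_mul_assoc[symmetric] euler_north)
  show "sph_point (rot_coords A x) = A *v sph_point x"
    using sph_coords_props(2)[OF n] by (simp add: rot_coords_def sph_coords_eq_formula[OF n, symmetric])
qed

lemma borel_measurable_mult_vec [measurable]: "(\<lambda>v :: real^3. A *v v) \<in> borel_measurable borel" for A :: "real^3^3"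
  by (intro borel_measurable_continuous_onI matrix_vector_mult_linear_continuous_on)

lemma rot_coords_measurable [measurable]: "rot_coords A \<in> measurable sph_measure sph_measure"
proof -
  have "(\<lambda>x. A *v sph_point x) \<in> borel_measurable sph_measure"
    by (rule measurable_compose[OF sph_point_measurable borel_measurable_mult_vec])
  then show ?thesis
    unfolding rot_coords_def by (rule measurable_compose[OF _ coords_formula_measurable_sph])
qed

lemma rotate_spin_measurable [measurable]:
  assumes A: "A \<in> SO3" and f: "f \<in> borel_measurable sph_measure"
  shows "rotate_spin s A f \<in> borel_measurable sph_measure"
proof -
  have c: "(\<lambda>x. transpose A) \<in> measurable sph_measure SO3_borel"
    using SO3_transpose[OF A] by (simp add: space_restrict_space)
  show ?thesis
    unfolding rotate_spin_eq_lift[OF A]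
    by (rule measurable_compose[OF measurable_SO3_mult[OF c frame_measurable] lift_spin_measurable[OF f]])
qed

lemma bounded_borel_integrable:
  assumes "f \<in> bounded_borel"
  shows "integrable sph_measure f"
proof -
  obtain B where "\<And>x. cmod (f x) \<le> B" using assms by (auto simp: bounded_borel_def bounded_iff)
  then show ?thesis
    using assms by (intro sph.integrable_const_bound[where B = B]) (auto simp: bounded_borel_def intro: measurable_sph_measureI)
qed

lemma spin_harm_ext_bounded_borel:
  assumes "\<bar>s\<bar> \<le> int l" "j \<le> 2 * l"
  shows "spin_harm_ext s l j \<in> bounded_borel"
proof -
  have "nat (int l - s) \<le> 2 * l" using assms by auto
  then have "cmod (spin_harm_ext s l j x) \<le> sqrt ((2 * real l + 1) / (4 * pi)) * 1" for x
    unfolding spin_harm_ext_def norm_mult using assms by (intro mult_mono norm_wigner_le) auto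
  then show ?thesis
    using spin_harm_ext_measurable_borel[OF assms(1)] by (auto simp: bounded_borel_def bounded_iff)
qed

text \<open>Instead of a change of variables: consider the difference of the integrals of f after
  and before the rotation. It vanishes on constants, and on harmonics of spin weight 0 and degree l
  > 0, since both integrals are 0 because rotations stay within one degree. By
  \<open>spin_functional_zero\<close> it then vanishes on all monomials.\<close>

lemma integral_sph_monomial_rotate:
  assumes A: "A \<in> SO3"
  shows "(LINT x|sph_measure. sph_monomial a b c (A *v sph_point x)) = (LINT x|sph_measure. sph_monomial a b c (sph_point x))"
proof -
  define \<Lambda> where "\<Lambda> f = (LINT x|sph_measure. f (rot_coords A x)) - (LINT x|sph_measure. f x)" for f :: "sph \<Rightarrow> complex"
  have i1: "integrable sph_measure (\<lambda>x. f (rot_coords A x))" if f: "f \<in> bounded_borel" for f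
  proof -
    obtain B where "\<And>x. cmod (f x) \<le> B" using f by (auto simp: bounded_borel_def bounded_iff)
    moreover have "(\<lambda>x. f (rot_coords A x)) \<in> borel_measurable sph_measure"
      using f by (intro measurable_compose[OF rot_coords_measurable]) (auto simp: bounded_borel_def intro: measurable_sph_measureI)
    ultimately show ?thesis by (intro sph.integrable_const_bound[where B = B]) auto
  qed
  have "\<Lambda> (\<lambda>x. spin_weight_fun 0 0 x * sph_monomial a b c (sph_point x)) = 0"
  proof (rule spin_functional_zero)
    show "\<Lambda> (\<lambda>x. f x + g x) = \<Lambda> f + \<Lambda> g" if "f \<in> bounded_borel" "g \<in> bounded_borel" for f g
      using that by (simp add: \<Lambda>_def i1 bounded_borel_integrable)
    show "\<Lambda> (\<lambda>x. c * f x) = c * \<Lambda> f" if "f \<in> bounded_borel" for c f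
      by (simp add: \<Lambda>_def right_diff_distrib)
    fix l j :: nat assume j: "j \<le> 2 * l"
    show "\<Lambda> (spin_harm_ext 0 l j) = 0"
    proof (cases "l = 0")
      case True
      then show ?thesis
        using j by (simp add: \<Lambda>_def spin_harm_ext_def wigner_def dmat_def spin_poly_def)
    next
      case False
      have "spin_harm_ext 0 l j (rot_coords A x) = (\<Sum>i\<le>2 * l. cnj (wigner l i j (transpose A)) * spin_harm_ext 0 l i x)" for x
        using rotate_spin_harm_ext[OF SO3_transpose[OF A], of 0 l j x] j
        by (simp add: rotate_spin_eq_lift[OF SO3_transpose[OF A]] transpose_transpose lift_spin_def rot_coords_eq(1)[OF A])
      then have "(LINT x|sph_measure. spin_harm_ext 0 l j (rot_coords A x)) =
        (LINT x|sph_measure. (\<Sum>i\<le>2 * l. cnj (wigner l i j (transpose A)) * spin_harm_ext 0 l i x))"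
        by (simp only:)
      also have "\<dots> = 0"
        using False bounded_borel_integrable[OF spin_harm_ext_bounded_borel[of 0 l]]
        by (subst Bochner_Integration.integral_sum) (auto simp: integral_spin_harm_ext_0)
      finally have "(LINT x|sph_measure. spin_harm_ext 0 l j (rot_coords A x)) = 0" .
      then show ?thesis using False j by (simp add: \<Lambda>_def integral_spin_harm_ext_0)
    qed
  qed
  then show ?thesis by (simp add: \<Lambda>_def spin_weight_fun_def rot_coords_eq(2)[OF A])
qed

lemma distr_sph_point_rotate:
  assumes A: "A \<in> SO3"
  shows "distr sph_measure borel (\<lambda>x. A *v sph_point x) = distr sph_measure borel sph_point"
proof (rule sph_monomial_measure_eqI)
  have m: "(\<lambda>x. A *v sph_point x) \<in> borel_measurable sph_measure"
    by (rule measurable_compose[OF sph_point_measurable borel_measurable_mult_vec])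
  show "finite_measure (distr sph_measure borel (\<lambda>x. A *v sph_point x))" "finite_measure (distr sph_measure borel sph_point)"
    using m by (auto intro!: sph.finite_measure_distr)
  show "AE v in distr sph_measure borel (\<lambda>x. A *v sph_point x). norm v = 1"
    using m by (subst AE_distr_iff) (auto simp: norm_SO3_mult[OF A] norm_sph_point)
  show "AE v in distr sph_measure borel sph_point. norm v = 1"
    by (subst AE_distr_iff) (auto simp: norm_sph_point)
  have mm: "sph_monomial a b c \<in> borel_measurable borel" for a b c
    by (rule borel_measurable_continuous_onI[OF continuous_sph_monomial])
  show "(LINT v|distr sph_measure borel (\<lambda>x. A *v sph_point x). sph_monomial a b c v) =
      (LINT v|distr sph_measure borel sph_point. sph_monomial a b c v)" for a b c
    using m by (simp add: integral_distr mm integral_sph_monomial_rotate[OF A])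
qed simp_all

text \<open>The invariance of the image measure on the unit sphere is carried back to coordinates by
  \<open>coords_formula\<close>, which inverts \<open>sph_point\<close> off a null set.\<close>

lemma distr_rot_coords:
  assumes A: "A \<in> SO3"
  shows "distr sph_measure sph_measure (rot_coords A) = sph_measure"
proof -
  have m: "(\<lambda>x. A *v sph_point x) \<in> borel_measurable sph_measure"
    by (rule measurable_compose[OF sph_point_measurable borel_measurable_mult_vec])
  have "distr sph_measure sph_measure (rot_coords A) = distr (distr sph_measure borel (\<lambda>x. A *v sph_point x)) sph_measure coords_formula"
    by (subst distr_distr[OF coords_formula_measurable_sph m]) (simp add: rot_coords_def[abs_def] comp_def)
  also have "\<dots> = distr sph_measure sph_measure (\<lambda>x. coords_formula (sph_point x))"
    unfolding distr_sph_point_rotate[OF A] by (subst distr_distr[OF coords_formula_measurable_sph]) (auto simp: comp_def)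
  also have "\<dots> = distr sph_measure sph_measure (\<lambda>x. x)"
    by (rule distr_cong_AE[OF refl refl coords_formula_sph_point_AE])
      (auto intro: measurable_compose[OF sph_point_measurable coords_formula_measurable_sph])
  finally show ?thesis by simp
qed

lemma integral_rot_coords:
  fixes F :: "sph \<Rightarrow> 'b :: {banach, second_countable_topology}"
  assumes "A \<in> SO3" "F \<in> borel_measurable sph_measure"
  shows "(LINT x|sph_measure. F (rot_coords A x)) = (LINT x|sph_measure. F x)"
  using integral_distr[OF rot_coords_measurable assms(2)] distr_rot_coords[OF assms(1)] by metis

section \<open>Functions with vanishing moments\<close>

text \<open>The positive and the negative part of \<open>R\<close>, taken as densities, give two
  finite measures on the sphere with the same moments; hence the measures and the densities
  agree.\<close>

lemma AE_zero_of_real_moments: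
  fixes R :: "sph \<Rightarrow> real"
  assumes int: "integrable sph_measure R"
    and mom: "\<And>a b c. (LINT x|sph_measure. of_real (R x) * sph_monomial a b c (sph_point x)) = 0"
  shows "AE x in sph_measure. R x = 0"
proof -
  have [measurable]: "R \<in> borel_measurable sph_measure" using int by auto
  \<comment> \<open>For the signs 1 and -1 these are the positive and the negative part of
    \<open>R\<close>.\<close>
  define P where "P \<sigma> x = max 0 (\<sigma> * R x)" for \<sigma> :: real and x
  define M where "M \<sigma> = distr (density sph_measure (\<lambda>x. ennreal (P \<sigma> x))) borel sph_point" for \<sigma>
  have Pm [measurable]: "P \<sigma> \<in> borel_measurable sph_measure" for \<sigma> unfolding P_def by measurable
  have Pi: "integrable sph_measure (P \<sigma>)" for \<sigma>
    unfolding P_def using int by auto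
  have P0: "P \<sigma> x \<ge> 0" for \<sigma> x by (simp add: P_def)
  have iM: "(LINT v|M \<sigma>. f v) = (LINT x|sph_measure. P \<sigma> x *\<^sub>R f (sph_point x))"
    if "f \<in> borel_measurable borel" for f :: "real^3 \<Rightarrow> 'b :: {banach, second_countable_topology}" and \<sigma>
  proof -
    have "(\<lambda>x. f (sph_point x)) \<in> borel_measurable sph_measure"
      by (rule measurable_compose[OF sph_point_measurable that])
    then show ?thesis
      unfolding M_def using that by (subst integral_distr) (auto simp: integral_density P0)
  qed
  have fd: "finite_measure (density sph_measure (\<lambda>x. ennreal (P \<sigma> x)))" for \<sigma>
  proof (rule finite_measureI)
    have "emeasure (density sph_measure (\<lambda>x. ennreal (P \<sigma> x))) (space sph_measure) = (\<integral>\<^sup>+x. ennreal (P \<sigma> x) \<partial>sph_measure)"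
      by (subst emeasure_density) (auto intro!: nn_integral_cong)
    also have "\<dots> = ennreal (LINT x|sph_measure. P \<sigma> x)"
      using Pi P0 by (intro nn_integral_eq_integral) auto
    finally show "emeasure (density sph_measure (\<lambda>x. ennreal (P \<sigma> x))) (space (density sph_measure (\<lambda>x. ennreal (P \<sigma> x)))) \<noteq> \<infinity>"
      by simp
  qed
  have "M 1 = M (-1)"
  proof (rule sph_monomial_measure_eqI)
    show "finite_measure (M 1)" "finite_measure (M (-1))"
      unfolding M_def by (intro finite_measure.finite_measure_distr fd; simp)+
    show "AE v in M 1. norm v = 1" "AE v in M (-1). norm v = 1"
      unfolding M_def by (subst AE_distr_iff; auto simp: norm_sph_point)+
    show "(LINT v|M 1. sph_monomial a b c v) = (LINT v|M (-1). sph_monomial a b c v)" for a b c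
    proof -
      have mm: "sph_monomial a b c \<in> borel_measurable borel"
        by (rule borel_measurable_continuous_onI[OF continuous_sph_monomial])
      have mp: "(\<lambda>x. sph_monomial a b c (sph_point x)) \<in> borel_measurable sph_measure"
        by (rule measurable_compose[OF sph_point_measurable mm])
      have b: "cmod (sph_monomial a b c (sph_point x)) \<le> 1" for x
        by (auto simp: sph_monomial_sph_point norm_mult norm_power intro!: mult_le_one power_le_one)
      have i: "integrable sph_measure (\<lambda>x. P \<sigma> x *\<^sub>R sph_monomial a b c (sph_point x))" for \<sigma>
      proof (rule Bochner_Integration.integrable_bound[OF Pi[of \<sigma>]])
        show "(\<lambda>x. P \<sigma> x *\<^sub>R sph_monomial a b c (sph_point x)) \<in> borel_measurable sph_measure"
          using mp by measurable
        show "AE x in sph_measure. norm (P \<sigma> x *\<^sub>R sph_monomial a b c (sph_point x)) \<le> norm (P \<sigma> x)"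
          using b by (auto intro!: mult_left_le)
      qed
      have "(LINT v|M 1. sph_monomial a b c v) - (LINT v|M (-1). sph_monomial a b c v) =
        (LINT x|sph_measure. P 1 x *\<^sub>R sph_monomial a b c (sph_point x) - P (-1) x *\<^sub>R sph_monomial a b c (sph_point x))"
        using i by (simp add: iM[OF mm])
      also have "\<dots> = (LINT x|sph_measure. of_real (R x) * sph_monomial a b c (sph_point x))"
        by (intro Bochner_Integration.integral_cong refl) (auto simp: P_def max_def scaleR_conv_of_real)
      finally show ?thesis using mom by simp
    qed
  qed (simp_all add: M_def)
  have "AE x in sph_measure. P 1 x = P (-1) x"
  proof (rule density_unique_real[OF Pi Pi])
    fix A assume A: "A \<in> sets sph_measure"
    then have A': "A \<in> sets (restrict_space borel sph_dom)" by (simp add: sets_sph_measure)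
    define B where "B = coords_formula -` A"
    have B: "B \<in> sets borel"
      using measurable_sets[OF coords_formula_measurable A'] by (simp add: B_def)
    have "(LINT x:A|sph_measure. P \<sigma> x) = (LINT v|M \<sigma>. indicator B v)" for \<sigma>
    proof -
      have "(LINT v|M \<sigma>. indicator B v :: real) = (LINT x|sph_measure. P \<sigma> x *\<^sub>R indicator B (sph_point x))"
        using B by (intro iM borel_measurable_indicator)
      also have "\<dots> = (LINT x:A|sph_measure. P \<sigma> x)"
        unfolding set_lebesgue_integral_def
      proof (rule integral_cong_AE)
        show "(\<lambda>x. P \<sigma> x *\<^sub>R (indicator B (sph_point x) :: real)) \<in> borel_measurable sph_measure"
        proof -
          have "(indicator B :: real^3 \<Rightarrow> real) \<in> borel_measurable borel" using B by (intro borel_measurable_indicator)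
          from measurable_compose[OF sph_point_measurable this] show ?thesis by measurable
        qed
        show "(\<lambda>x. indicator A x *\<^sub>R P \<sigma> x) \<in> borel_measurable sph_measure" using A by measurable
        show "AE x in sph_measure. P \<sigma> x *\<^sub>R indicator B (sph_point x) = indicator A x *\<^sub>R P \<sigma> x"
          using coords_formula_sph_point_AE by eventually_elim (simp add: B_def indicator_def)
      qed
      finally show ?thesis ..
    qed
    then show "(LINT x:A|sph_measure. P 1 x) = (LINT x:A|sph_measure. P (-1) x)"
      by (simp only: \<open>M 1 = M (-1)\<close>)
  qed
  then show ?thesis by eventually_elim (auto simp: P_def max_def split: if_splits)
qed

text \<open>Real and imaginary part are combinations of \<open>G\<close> and its conjugate, whose
  moments vanish too because conjugation permutes the monomials.\<close>

lemma AE_zero_of_moments: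
  fixes G :: "sph \<Rightarrow> complex"
  assumes int: "integrable sph_measure G"
    and mom: "\<And>a b c. (LINT x|sph_measure. G x * sph_monomial a b c (sph_point x)) = 0"
  shows "AE x in sph_measure. G x = 0"
proof -
  have [measurable]: "G \<in> borel_measurable sph_measure" using int by auto
  have i: "integrable sph_measure (\<lambda>x. H x * sph_monomial a b c (sph_point x))" if H: "integrable sph_measure H" for H a b c
  proof (rule Bochner_Integration.integrable_bound[OF H])
    have "(\<lambda>x. sph_monomial a b c (sph_point x)) \<in> borel_measurable sph_measure"
      by (rule measurable_compose[OF sph_point_measurable borel_measurable_continuous_onI[OF continuous_sph_monomial]])
    then show "(\<lambda>x. H x * sph_monomial a b c (sph_point x)) \<in> borel_measurable sph_measure"
      using H by measurable
    have "cmod (sph_monomial a b c (sph_point x)) \<le> 1" for x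
      by (auto simp: sph_monomial_sph_point norm_mult norm_power intro!: mult_le_one power_le_one)
    then show "AE x in sph_measure. norm (H x * sph_monomial a b c (sph_point x)) \<le> norm (H x)"
      by (auto simp: norm_mult intro!: mult_left_le)
  qed
  have ic: "integrable sph_measure (\<lambda>x. cnj (G x))" using int by simp
  have momc: "(LINT x|sph_measure. cnj (G x) * sph_monomial a b c (sph_point x)) = 0" for a b c
  proof -
    have "(LINT x|sph_measure. cnj (G x) * sph_monomial a b c (sph_point x)) =
      (LINT x|sph_measure. cnj (G x * sph_monomial b a c (sph_point x)))"
      by (intro Bochner_Integration.integral_cong refl) (simp add: cnj_sph_monomial)
    also have "\<dots> = cnj (LINT x|sph_measure. G x * sph_monomial b a c (sph_point x))"
      by (rule Bochner_Integration.integral_cnj)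
    finally show ?thesis using mom by simp
  qed
  have "AE x in sph_measure. Re (G x) = 0"
  proof (rule AE_zero_of_real_moments)
    show "integrable sph_measure (\<lambda>x. Re (G x))" using int by (rule integrable_Re)
    have "of_real (Re (G x)) * sph_monomial a b c (sph_point x) =
       (1 / 2) * (G x * sph_monomial a b c (sph_point x)) + (1 / 2) * (cnj (G x) * sph_monomial a b c (sph_point x))" for a b c x
      unfolding distrib_left[symmetric] distrib_right[symmetric] complex_add_cnj by simp
    then show "(LINT x|sph_measure. of_real (Re (G x)) * sph_monomial a b c (sph_point x)) = 0" for a b c
      using i[OF int] i[OF ic] mom momc by simp
  qed
  moreover have "AE x in sph_measure. Im (G x) = 0"
  proof (rule AE_zero_of_real_moments)
    show "integrable sph_measure (\<lambda>x. Im (G x))" using int by (rule integrable_Im)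
    have "of_real (Im (G x)) * sph_monomial a b c (sph_point x) =
       (- \<i> / 2) * (G x * sph_monomial a b c (sph_point x)) - (- \<i> / 2) * (cnj (G x) * sph_monomial a b c (sph_point x))" for a b c x
    proof -
      have "(- \<i> / 2) * ((of_real (2 * r) * \<i>) * X) = of_real r * X" for r X by (simp add: complex_eq_iff)
      then show ?thesis
        unfolding right_diff_distrib[symmetric] left_diff_distrib[symmetric] complex_diff_cnj by simp
    qed
    then show "(LINT x|sph_measure. of_real (Im (G x)) * sph_monomial a b c (sph_point x)) = 0" for a b c
      using i[OF int] i[OF ic] mom momc by simp
  qed
  ultimately show ?thesis by eventually_elim (simp add: complex_eq_iff)
qed

section \<open>Square integrable functions\<close>

text \<open>For an arbitrary measure, because square integrable functions are needed both on the
  sphere and on the rotation group.\<close>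

definition L2_space :: "'a measure \<Rightarrow> ('a \<Rightarrow> complex) set" where
  "L2_space M = {f \<in> borel_measurable M. integrable M (\<lambda>x. (cmod (f x))\<^sup>2)}"

definition norm_L2 :: "'a measure \<Rightarrow> ('a \<Rightarrow> complex) \<Rightarrow> real" where
  "norm_L2 M f = sqrt (LINT x|M. (cmod (f x))\<^sup>2)"

lemma L2_measurable: "f \<in> L2_space M \<Longrightarrow> f \<in> borel_measurable M"
  and L2_integrable: "f \<in> L2_space M \<Longrightarrow> integrable M (\<lambda>x. (cmod (f x))\<^sup>2)"
  by (auto simp: L2_space_def)

lemma L2_mult_integrable:
  assumes f: "f \<in> L2_space M" and g: "g \<in> L2_space M"
  shows "integrable M (\<lambda>x. cnj (f x) * g x)" "integrable M (\<lambda>x. cmod (f x) * cmod (g x))"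
proof -
  have *: "cmod (f x) * cmod (g x) \<le> norm ((cmod (f x))\<^sup>2 + (cmod (g x))\<^sup>2)" for x
  proof -
    have "2 * (cmod (f x) * cmod (g x)) \<le> (cmod (f x))\<^sup>2 + (cmod (g x))\<^sup>2"
      using sum_squares_bound[of "cmod (f x)" "cmod (g x)"] by simp
    moreover have "0 \<le> cmod (f x) * cmod (g x)" by simp
    ultimately show ?thesis unfolding real_norm_def by linarith
  qed
  have i: "integrable M (\<lambda>x. (cmod (f x))\<^sup>2 + (cmod (g x))\<^sup>2)"
    by (intro Bochner_Integration.integrable_add L2_integrable f g)
  note [measurable] = L2_measurable[OF f] L2_measurable[OF g]
  show "integrable M (\<lambda>x. cnj (f x) * g x)" "integrable M (\<lambda>x. cmod (f x) * cmod (g x))"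
    by (rule Bochner_Integration.integrable_bound[OF i]; use * in \<open>auto simp: norm_mult\<close>)+
qed

lemma L2_add:
  assumes f: "f \<in> L2_space M" and g: "g \<in> L2_space M"
  shows "(\<lambda>x. f x + g x) \<in> L2_space M"
proof -
  note [measurable] = L2_measurable[OF f] L2_measurable[OF g]
  have i: "integrable M (\<lambda>x. 2 * ((cmod (f x))\<^sup>2 + (cmod (g x))\<^sup>2))"
    by (intro integrable_mult_right Bochner_Integration.integrable_add L2_integrable f g)
  have "(cmod (f x + g x))\<^sup>2 \<le> 2 * ((cmod (f x))\<^sup>2 + (cmod (g x))\<^sup>2)" for x
  proof -
    have "(cmod (f x + g x))\<^sup>2 \<le> (cmod (f x) + cmod (g x))\<^sup>2"
      by (intro power_mono norm_triangle_ineq) simp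
    also have "\<dots> \<le> 2 * ((cmod (f x))\<^sup>2 + (cmod (g x))\<^sup>2)"
      using sum_squares_bound[of "cmod (f x)" "cmod (g x)"] by (simp add: power2_sum)
    finally show ?thesis .
  qed
  then have "integrable M (\<lambda>x. (cmod (f x + g x))\<^sup>2)"
    by (intro Bochner_Integration.integrable_bound[OF i]) (auto simp: abs_of_nonneg)
  then show ?thesis unfolding L2_space_def by simp
qed

lemma L2_cmult: "f \<in> L2_space M \<Longrightarrow> (\<lambda>x. c * f x) \<in> L2_space M"
  unfolding L2_space_def by (auto simp: norm_mult power_mult_distrib)

lemma L2_diff: "f \<in> L2_space M \<Longrightarrow> g \<in> L2_space M \<Longrightarrow> (\<lambda>x. f x - g x) \<in> L2_space M"
  using L2_add[of f M "\<lambda>x. (-1) * g x"] L2_cmult[of g M "-1"] by simp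

lemma L2_zero: "(\<lambda>x. 0) \<in> L2_space M"
  by (simp add: L2_space_def)

lemma L2_sum: "(\<And>i. i \<in> I \<Longrightarrow> f i \<in> L2_space M) \<Longrightarrow> (\<lambda>x. \<Sum>i\<in>I. f i x) \<in> L2_space M"
  by (induction I rule: infinite_finite_induct) (auto simp: L2_zero L2_add)

lemma norm_L2_nonneg: "0 \<le> norm_L2 M f"
  by (simp add: norm_L2_def)

lemma norm_L2_power2: "(norm_L2 M f)\<^sup>2 = (LINT x|M. (cmod (f x))\<^sup>2)"
  by (simp add: norm_L2_def)

lemma nn_integral_L2:
  assumes "f \<in> L2_space M"
  shows "(\<integral>\<^sup>+x. ennreal ((cmod (f x))\<^sup>2) \<partial>M) = ennreal ((norm_L2 M f)\<^sup>2)"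
  unfolding norm_L2_power2 using assms by (intro nn_integral_eq_integral L2_integrable) auto

lemma norm_L2_eqI: "(\<And>x. x \<in> space M \<Longrightarrow> cmod (f x) = cmod (g x)) \<Longrightarrow> norm_L2 M f = norm_L2 M g"
  unfolding norm_L2_def by (metis (mono_tags, lifting) Bochner_Integration.integral_cong)

lemma L2_Cauchy_Schwarz_abs:
  assumes f: "f \<in> L2_space M" and g: "g \<in> L2_space M"
  shows "(LINT x|M. cmod (f x) * cmod (g x)) \<le> norm_L2 M f * norm_L2 M g"
proof -
  note [measurable] = L2_measurable[OF f] L2_measurable[OF g]
  have "(\<integral>\<^sup>+x. ennreal (cmod (f x)) * ennreal (cmod (g x)) \<partial>M)\<^sup>2 \<le>
    (\<integral>\<^sup>+x. ennreal (cmod (f x)) ^ 2 \<partial>M) * (\<integral>\<^sup>+x. ennreal (cmod (g x)) ^ 2 \<partial>M)"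
    by (rule Cauchy_Schwarz_nn_integral) measurable
  also have "\<dots> = ennreal ((norm_L2 M f * norm_L2 M g)\<^sup>2)"
    using nn_integral_L2[OF f] nn_integral_L2[OF g]
    by (simp add: ennreal_power power_mult_distrib ennreal_mult'')
  also have "(\<integral>\<^sup>+x. ennreal (cmod (f x)) * ennreal (cmod (g x)) \<partial>M) = ennreal (LINT x|M. cmod (f x) * cmod (g x))"
    using nn_integral_eq_integral[OF L2_mult_integrable(2)[OF f g]] by (simp add: ennreal_mult)
  finally have "(LINT x|M. cmod (f x) * cmod (g x))\<^sup>2 \<le> (norm_L2 M f * norm_L2 M g)\<^sup>2"
    by (simp add: ennreal_power)
  then show ?thesis by (rule power2_le_imp_le) (simp add: norm_L2_nonneg)
qed

lemma L2_Cauchy_Schwarz: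
  assumes f: "f \<in> L2_space M" and g: "g \<in> L2_space M"
  shows "cmod (LINT x|M. cnj (f x) * g x) \<le> norm_L2 M f * norm_L2 M g"
proof -
  have "cmod (LINT x|M. cnj (f x) * g x) \<le> (LINT x|M. norm (cnj (f x) * g x))" by (rule integral_norm_bound)
  also have "\<dots> = (LINT x|M. cmod (f x) * cmod (g x))" by (simp add: norm_mult)
  also have "\<dots> \<le> norm_L2 M f * norm_L2 M g" by (rule L2_Cauchy_Schwarz_abs[OF assms])
  finally show ?thesis .
qed

lemma L2_triangle:
  assumes f: "f \<in> L2_space M" and g: "g \<in> L2_space M"
  shows "norm_L2 M (\<lambda>x. f x + g x) \<le> norm_L2 M f + norm_L2 M g"
proof (rule power2_le_imp_le)
  have i: "integrable M (\<lambda>x. (cmod (f x))\<^sup>2 + (cmod (g x))\<^sup>2 + 2 * (cmod (f x) * cmod (g x)))"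
    using L2_integrable[OF f] L2_integrable[OF g] L2_mult_integrable(2)[OF f g] by auto
  have "(norm_L2 M (\<lambda>x. f x + g x))\<^sup>2 = (LINT x|M. (cmod (f x + g x))\<^sup>2)" by (rule norm_L2_power2)
  also have "\<dots> \<le> (LINT x|M. (cmod (f x))\<^sup>2 + (cmod (g x))\<^sup>2 + 2 * (cmod (f x) * cmod (g x)))"
  proof (rule integral_mono[OF L2_integrable[OF L2_add[OF f g]] i])
    fix x
    have "(cmod (f x + g x))\<^sup>2 \<le> (cmod (f x) + cmod (g x))\<^sup>2"
      by (intro power_mono norm_triangle_ineq) simp
    then show "(cmod (f x + g x))\<^sup>2 \<le> (cmod (f x))\<^sup>2 + (cmod (g x))\<^sup>2 + 2 * (cmod (f x) * cmod (g x))"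
      by (simp add: power2_sum mult.assoc)
  qed
  also have "\<dots> = (norm_L2 M f)\<^sup>2 + (norm_L2 M g)\<^sup>2 + 2 * (LINT x|M. cmod (f x) * cmod (g x))"
    using L2_integrable[OF f] L2_integrable[OF g] L2_mult_integrable(2)[OF f g] by (simp add: norm_L2_power2)
  also have "\<dots> \<le> (norm_L2 M f + norm_L2 M g)\<^sup>2"
    using L2_Cauchy_Schwarz_abs[OF f g] by (simp add: power2_sum)
  finally show "(norm_L2 M (\<lambda>x. f x + g x))\<^sup>2 \<le> (norm_L2 M f + norm_L2 M g)\<^sup>2" .
qed (simp add: norm_L2_nonneg add_nonneg_nonneg)

lemma L2_triangle_diff:
  assumes "f \<in> L2_space M" "g \<in> L2_space M" "h \<in> L2_space M"
  shows "norm_L2 M (\<lambda>x. f x - h x) \<le> norm_L2 M (\<lambda>x. f x - g x) + norm_L2 M (\<lambda>x. g x - h x)"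
  using L2_triangle[OF L2_diff[OF assms(1,2)] L2_diff[OF assms(2,3)]] by simp

lemma norm_L2_minus: "norm_L2 M (\<lambda>x. f x - g x) = norm_L2 M (\<lambda>x. g x - f x)"
  by (rule norm_L2_eqI) (rule norm_minus_commute)

lemma L2_norm_diff_le:
  assumes "f \<in> L2_space M" "g \<in> L2_space M"
  shows "\<bar>norm_L2 M f - norm_L2 M g\<bar> \<le> norm_L2 M (\<lambda>x. f x - g x)"
  using L2_triangle[OF L2_diff[OF assms] assms(2)] L2_triangle[OF L2_diff[OF assms(2,1)] assms(1)] norm_L2_minus[of M f g]
  by simp

lemma L2_inner_tendsto:
  assumes h: "h \<in> L2_space M" and u: "\<And>n. u n \<in> L2_space M" and f: "f \<in> L2_space M"
    and lim: "(\<lambda>n. norm_L2 M (\<lambda>x. u n x - f x)) \<longlonglongrightarrow> 0"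
  shows "(\<lambda>n. LINT x|M. cnj (h x) * u n x) \<longlonglongrightarrow> (LINT x|M. cnj (h x) * f x)"
proof (rule LIM_zero_cancel, rule Lim_null_comparison)
  have "(LINT x|M. cnj (h x) * u n x) - (LINT x|M. cnj (h x) * f x) = (LINT x|M. cnj (h x) * (u n x - f x))" for n
    using L2_mult_integrable(1)[OF h u] L2_mult_integrable(1)[OF h f] by (simp add: right_diff_distrib)
  then show "\<forall>\<^sub>F n in sequentially. norm ((LINT x|M. cnj (h x) * u n x) - (LINT x|M. cnj (h x) * f x)) \<le>
      norm_L2 M h * norm_L2 M (\<lambda>x. u n x - f x)"
    using L2_Cauchy_Schwarz[OF h L2_diff[OF u f]] by simp
  show "(\<lambda>n. norm_L2 M h * norm_L2 M (\<lambda>x. u n x - f x)) \<longlonglongrightarrow> 0"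
    using tendsto_mult_right_zero[OF lim] by simp
qed

lemma L2_Fatou:
  assumes u: "\<And>n. u n \<in> L2_space M" and g: "g \<in> borel_measurable M"
    and lim: "AE x in M. (\<lambda>n. u n x) \<longlonglongrightarrow> g x"
    and bound: "\<And>n. n \<ge> N \<Longrightarrow> norm_L2 M (u n) \<le> B"
  shows "g \<in> L2_space M" "norm_L2 M g \<le> B"
proof -
  have B: "B \<ge> 0" using bound[of N] norm_L2_nonneg[of M "u N"] by simp
  note [measurable] = L2_measurable[OF u] g
  have "(\<integral>\<^sup>+x. ennreal ((cmod (g x))\<^sup>2) \<partial>M) = (\<integral>\<^sup>+x. liminf (\<lambda>n. ennreal ((cmod (u n x))\<^sup>2)) \<partial>M)"
  proof (rule nn_integral_cong_AE)
    show "AE x in M. ennreal ((cmod (g x))\<^sup>2) = liminf (\<lambda>n. ennreal ((cmod (u n x))\<^sup>2))"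
      using lim
    proof eventually_elim
      case (elim x)
      then have "(\<lambda>n. ennreal ((cmod (u n x))\<^sup>2)) \<longlonglongrightarrow> ennreal ((cmod (g x))\<^sup>2)"
        by (intro tendsto_ennrealI tendsto_power tendsto_norm)
      then show ?case by (rule lim_imp_Liminf[OF trivial_limit_sequentially, symmetric])
    qed
  qed
  also have "\<dots> \<le> liminf (\<lambda>n. \<integral>\<^sup>+x. ennreal ((cmod (u n x))\<^sup>2) \<partial>M)"
    by (intro nn_integral_liminf) measurable
  also have "\<dots> \<le> ennreal (B\<^sup>2)"
  proof (rule Liminf_le)
    have "(\<integral>\<^sup>+x. ennreal ((cmod (u n x))\<^sup>2) \<partial>M) \<le> ennreal (B\<^sup>2)" if "n \<ge> N" for n
      unfolding nn_integral_L2[OF u] using bound[OF that] by (intro ennreal_leI power_mono norm_L2_nonneg)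
    then show "\<forall>\<^sub>F n in sequentially. (\<integral>\<^sup>+x. ennreal ((cmod (u n x))\<^sup>2) \<partial>M) \<le> ennreal (B\<^sup>2)"
      unfolding eventually_sequentially by blast
  qed simp
  finally have le: "(\<integral>\<^sup>+x. ennreal ((cmod (g x))\<^sup>2) \<partial>M) \<le> ennreal (B\<^sup>2)" .
  then have "integrable M (\<lambda>x. (cmod (g x))\<^sup>2)"
    by (intro integrableI_bounded) (auto intro: le_less_trans)
  then show L2: "g \<in> L2_space M" by (simp add: L2_space_def)
  show "norm_L2 M g \<le> B"
    using le B unfolding nn_integral_L2[OF L2] by (auto intro: power2_le_imp_le)
qed

text \<open>Fatou's lemma for the differences u n - f bounds the norm of g - f by every positive e.
  This identifies limits in norm with pointwise limits without passing to a subsequence.\<close>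

lemma L2_limit_unique:
  assumes u: "\<And>n. u n \<in> L2_space M" and f: "f \<in> L2_space M"
    and lim: "(\<lambda>n. norm_L2 M (\<lambda>x. u n x - f x)) \<longlonglongrightarrow> 0"
    and g: "g \<in> borel_measurable M" and AE: "AE x in M. (\<lambda>n. u n x) \<longlonglongrightarrow> g x"
  shows "AE x in M. f x = g x"
proof -
  have AE': "AE x in M. (\<lambda>n. u n x - f x) \<longlonglongrightarrow> g x - f x"
    using AE by eventually_elim (intro tendsto_intros)
  have m: "(\<lambda>x. g x - f x) \<in> borel_measurable M" using g L2_measurable[OF f] by measurable
  have gf: "(\<lambda>x. g x - f x) \<in> L2_space M \<and> norm_L2 M (\<lambda>x. g x - f x) \<le> e" if e: "e > 0" for e
  proof -
    obtain N where N: "\<And>n. n \<ge> N \<Longrightarrow> norm_L2 M (\<lambda>x. u n x - f x) \<le> e"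
      using LIMSEQ_D[OF lim e] by (auto simp: norm_L2_nonneg intro: less_imp_le)
    show ?thesis using L2_Fatou[OF L2_diff[OF u f] m AE' N] by simp
  qed
  have "norm_L2 M (\<lambda>x. g x - f x) \<le> 0"
  proof (rule field_le_epsilon)
    fix e :: real assume "0 < e"
    from gf[OF this] show "norm_L2 M (\<lambda>x. g x - f x) \<le> 0 + e" by simp
  qed
  moreover have "0 \<le> (LINT x|M. (cmod (g x - f x))\<^sup>2)" by simp
  ultimately have "(LINT x|M. (cmod (g x - f x))\<^sup>2) = 0" by (simp add: norm_L2_def)
  then have "AE x in M. (cmod (g x - f x))\<^sup>2 = 0"
    using integral_nonneg_eq_0_iff_AE[OF L2_integrable[of "\<lambda>x. g x - f x" M]] gf[of 1] by simp
  then show ?thesis by eventually_elim simp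
qed

text \<open>Riesz-Fischer: along a fast subsequence the increments are summable in L2, and since
  constants are square integrable also in L1, so the subsequence converges almost everywhere.
  Fatou's lemma turns this into convergence in norm of the whole sequence.\<close>

lemma (in finite_measure) L2_complete:
  assumes u: "\<And>n. u n \<in> L2_space M"
    and Cauchy: "\<And>e. e > 0 \<Longrightarrow> \<exists>N. \<forall>m\<ge>N. \<forall>n\<ge>N. norm_L2 M (\<lambda>x. u m x - u n x) \<le> e"
  obtains f where "f \<in> L2_space M" "(\<lambda>n. norm_L2 M (\<lambda>x. u n x - f x)) \<longlonglongrightarrow> 0"
proof -
  have "\<exists>N. \<forall>m\<ge>N. \<forall>n\<ge>N. norm_L2 M (\<lambda>x. u m x - u n x) \<le> (1 / 2) ^ k" for k by (rule Cauchy) simp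
  then obtain N where N: "\<And>k m n. m \<ge> N k \<Longrightarrow> n \<ge> N k \<Longrightarrow> norm_L2 M (\<lambda>x. u m x - u n x) \<le> (1 / 2) ^ k" by metis
  \<comment> \<open>The cumulative sum makes the indices increase and keeps them above N k; the
    summand k forces them to infinity.\<close>
  define r where "r k = (\<Sum>i\<le>k. N i) + k" for k
  have rN: "r k \<ge> N k" for k unfolding r_def by (intro trans_le_add1 member_le_sum) auto
  have r_mono: "r k \<le> r (Suc k)" for k by (simp add: r_def)
  have r_ge: "r k \<ge> k" for k by (simp add: r_def)
  note [measurable] = L2_measurable[OF u]
  have one: "(\<lambda>x. 1) \<in> L2_space M" by (simp add: L2_space_def)
  define d where "d k x = u (r (Suc k)) x - u (r k) x" for k x
  have dL: "d k \<in> L2_space M" for k unfolding d_def by (intro L2_diff u)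
  note [measurable] = L2_measurable[OF dL]
  have "(\<integral>\<^sup>+x. ennreal (cmod (d k x)) \<partial>M) \<le> ennreal (norm_L2 M (\<lambda>x. 1) * (1 / 2) ^ k)" for k
  proof -
    have i: "integrable M (\<lambda>x. cmod (d k x))" using L2_mult_integrable(2)[OF one dL] by simp
    have "(LINT x|M. cmod (d k x)) \<le> norm_L2 M (\<lambda>x. 1) * norm_L2 M (d k)"
      using L2_Cauchy_Schwarz_abs[OF one dL[of k]] by simp
    also have "\<dots> \<le> norm_L2 M (\<lambda>x. 1) * (1 / 2) ^ k"
      unfolding d_def using N[OF order.trans[OF rN r_mono] rN] by (intro mult_left_mono norm_L2_nonneg)
    finally show ?thesis using nn_integral_eq_integral[OF i] by (simp add: ennreal_leI)
  qed
  then have "(\<Sum>k. \<integral>\<^sup>+x. ennreal (cmod (d k x)) \<partial>M) \<le> (\<Sum>k. ennreal (norm_L2 M (\<lambda>x. 1) * (1 / 2) ^ k))"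
    by (intro suminf_le) auto
  also have "\<dots> = ennreal (\<Sum>k. norm_L2 M (\<lambda>x. 1) * (1 / 2) ^ k)"
    by (intro suminf_ennreal2) (auto simp: norm_L2_nonneg summable_geometric intro!: summable_mult)
  also have "\<dots> < \<infinity>" by simp
  also have "(\<Sum>k. \<integral>\<^sup>+x. ennreal (cmod (d k x)) \<partial>M) = (\<integral>\<^sup>+x. (\<Sum>k. ennreal (cmod (d k x))) \<partial>M)"
    by (rule nn_integral_suminf[symmetric]) measurable
  finally have fin: "(\<integral>\<^sup>+x. (\<Sum>k. ennreal (cmod (d k x))) \<partial>M) \<noteq> \<infinity>" by simp
  have "AE x in M. (\<Sum>k. ennreal (cmod (d k x))) \<noteq> \<infinity>"
    using fin by (intro nn_integral_noteq_infinite) auto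
  then have conv: "AE x in M. convergent (\<lambda>k. u (r k) x)"
  proof eventually_elim
    case (elim x)
    then have "summable (\<lambda>k. cmod (d k x))"
      by (intro summable_suminf_not_top) auto
    then have "summable (\<lambda>k. d k x)" by (rule summable_norm_cancel)
    then have "convergent (\<lambda>n. \<Sum>k<n. d k x)" by (simp add: summable_iff_convergent)
    moreover have "(\<Sum>k<n. d k x) = u (r n) x - u (r 0) x" for n
      unfolding d_def by (rule sum_lessThan_telescope)
    ultimately have "convergent (\<lambda>n. u (r n) x - u (r 0) x)" by simp
    then show ?case by (simp add: convergent_diff_const_right_iff)
  qed
  define f where "f x = lim (\<lambda>k. u (r k) x)" for x
  have [measurable]: "f \<in> borel_measurable M" unfolding f_def by measurable
  have lim: "AE x in M. (\<lambda>k. u (r k) x) \<longlonglongrightarrow> f x"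
    using conv by eventually_elim (simp add: f_def convergent_LIMSEQ_iff)
  have key: "(\<lambda>x. u n x - f x) \<in> L2_space M \<and> norm_L2 M (\<lambda>x. u n x - f x) \<le> (1 / 2) ^ k" if n: "n \<ge> N k" for n k
  proof -
    have "AE x in M. (\<lambda>i. u n x - u (r i) x) \<longlonglongrightarrow> u n x - f x"
      using lim by eventually_elim (intro tendsto_intros)
    moreover have "norm_L2 M (\<lambda>x. u n x - u (r i) x) \<le> (1 / 2) ^ k" if "i \<ge> N k" for i
      using n that r_ge[of i] by (intro N) auto
    ultimately show ?thesis
      using L2_Fatou[of "\<lambda>i x. u n x - u (r i) x" M "\<lambda>x. u n x - f x" "N k" "(1 / 2) ^ k"] L2_diff[OF u u] by auto
  qed
  have "f \<in> L2_space M"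
    using L2_diff[OF u[of "N 0"], of "\<lambda>x. u (N 0) x - f x"] key[of 0 "N 0"] by simp
  moreover have "(\<lambda>n. norm_L2 M (\<lambda>x. u n x - f x)) \<longlonglongrightarrow> 0"
  proof (rule LIMSEQ_I)
    fix e :: real assume "e > 0"
    then obtain k where k: "(1 / 2) ^ k < e" using real_arch_pow_inv[of e "1 / 2"] by auto
    have "norm (norm_L2 M (\<lambda>x. u n x - f x) - 0) < e" if "n \<ge> N k" for n
      using key[OF that] k norm_L2_nonneg[of M "\<lambda>x. u n x - f x"] by simp
    then show "\<exists>no. \<forall>n\<ge>no. norm (norm_L2 M (\<lambda>x. u n x - f x) - 0) < e" by blast
  qed
  ultimately show ?thesis using that by blast
qed

section \<open>Expansion in spin weighted harmonics\<close>

lemma L2_sphere_eq: "L2_sphere = L2_space sph_measure"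
  by (simp add: L2_sphere_def L2_space_def)

lemma L2_norm_eq: "L2_norm f = norm_L2 sph_measure f"
  by (simp add: L2_norm_def norm_L2_def)

lemma integral_norm_square_diff:
  assumes f: "f \<in> L2_space M" and g: "g \<in> L2_space M"
  shows "(norm_L2 M (\<lambda>x. f x - g x))\<^sup>2 =
    (norm_L2 M f)\<^sup>2 - 2 * Re (LINT x|M. cnj (f x) * g x) + (norm_L2 M g)\<^sup>2"
proof -
  have "(cmod (f x - g x))\<^sup>2 = (cmod (f x))\<^sup>2 - 2 * Re (cnj (f x) * g x) + (cmod (g x))\<^sup>2" for x
    unfolding cmod_power2 by (simp add: power2_diff algebra_simps)
  moreover have "(LINT x|M. A x - 2 * B x + C x) = (LINT x|M. A x) - 2 * (LINT x|M. B x) + (LINT x|M. C x)"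
    if "integrable M A" "integrable M B" "integrable M C" for A B C :: "'a \<Rightarrow> real"
    using that by simp
  note this[OF L2_integrable[OF f] integrable_Re[OF L2_mult_integrable(1)[OF f g]] L2_integrable[OF g]]
  ultimately show ?thesis
    unfolding norm_L2_power2 integral_Re[OF L2_mult_integrable(1)[OF f g], symmetric] by (simp only:)
qed

lemma of_real_norm_L2: "complex_of_real ((norm_L2 M f)\<^sup>2) = (LINT x|M. cnj (f x) * f x)"
proof -
  have "cnj (f x) * f x = complex_of_real ((cmod (f x))\<^sup>2)" for x
    by (simp only: complex_norm_square mult.commute)
  then show ?thesis unfolding norm_L2_power2 by (simp del: of_real_power)
qed

lemma sprod_cnj: "sprod g f = cnj (sprod f g)"
proof -
  have "cnj (sprod f g) = (LINT x|sph_measure. cnj (cnj (f x) * g x))"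
    unfolding sprod_def by (rule Bochner_Integration.integral_cnj[symmetric])
  then show ?thesis by (simp add: sprod_def mult.commute del: Bochner_Integration.integral_cnj)
qed

lemma sprod_sum_right:
  assumes "h \<in> L2_sphere" "\<And>i. i \<in> I \<Longrightarrow> f i \<in> L2_sphere"
  shows "sprod h (\<lambda>x. \<Sum>i\<in>I. c i * f i x) = (\<Sum>i\<in>I. c i * sprod h (f i))"
proof -
  have i: "integrable sph_measure (\<lambda>x. c i * (cnj (h x) * f i x))" if "i \<in> I" for i
    using assms that by (intro integrable_mult_right L2_mult_integrable) (auto simp: L2_sphere_eq)
  have "sprod h (\<lambda>x. \<Sum>i\<in>I. c i * f i x) = (LINT x|sph_measure. (\<Sum>i\<in>I. c i * (cnj (h x) * f i x)))"
    unfolding sprod_def by (simp add: sum_distrib_left mult_ac)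
  also have "\<dots> = (\<Sum>i\<in>I. LINT x|sph_measure. c i * (cnj (h x) * f i x))"
    by (rule Bochner_Integration.integral_sum[OF i])
  finally show ?thesis by (simp add: sprod_def)
qed

lemma sprod_sum_left:
  assumes "h \<in> L2_sphere" "\<And>i. i \<in> I \<Longrightarrow> f i \<in> L2_sphere"
  shows "sprod (\<lambda>x. \<Sum>i\<in>I. c i * f i x) h = (\<Sum>i\<in>I. cnj (c i) * sprod (f i) h)"
proof -
  have "sprod (\<lambda>x. \<Sum>i\<in>I. c i * f i x) h = cnj (sprod h (\<lambda>x. \<Sum>i\<in>I. c i * f i x))" by (rule sprod_cnj)
  also have "sprod h (\<lambda>x. \<Sum>i\<in>I. c i * f i x) = (\<Sum>i\<in>I. c i * sprod h (f i))"
    by (rule sprod_sum_right) (use assms in auto)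
  finally show ?thesis by (simp add: sprod_cnj[of _ h])
qed

lemma bounded_borel_L2:
  assumes "f \<in> bounded_borel"
  shows "f \<in> L2_sphere"
proof -
  have "bounded (range f)" using assms by (simp add: bounded_borel_def)
  then obtain B where B: "\<And>x. cmod (f x) \<le> B" unfolding bounded_iff by blast
  have [measurable]: "f \<in> borel_measurable sph_measure"
    using assms by (auto simp: bounded_borel_def intro: measurable_sph_measureI)
  have "norm ((cmod (f x))\<^sup>2) \<le> B\<^sup>2" for x
    using B[of x] by (auto intro: power_mono)
  then have "integrable sph_measure (\<lambda>x. (cmod (f x))\<^sup>2)"
    by (intro sph.integrable_const_bound[where B = "B\<^sup>2"] AE_I2) auto
  then show ?thesis by (simp add: L2_sphere_def)
qed

lemma spin_harm_ext_L2: "\<bar>s\<bar> \<le> int l \<Longrightarrow> j \<le> 2 * l \<Longrightarrow> spin_harm_ext s l j \<in> L2_sphere"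
  by (rule bounded_borel_L2[OF spin_harm_ext_bounded_borel])

lemma rotate_spin_eq_coords:
  assumes "A \<in> SO3"
  shows "rotate_spin s A f x = exp (- \<i> * of_int s * of_real (third_euler (transpose A ** frame x))) * f (rot_coords (transpose A) x)"
  unfolding rotate_spin_eq_lift[OF assms] lift_spin_def rot_coords_eq(1)[OF SO3_transpose[OF assms]] ..

lemma norm_exp_third_euler: "cmod (exp (- \<i> * of_int s * of_real t)) = 1"
  by (simp add: norm_exp_eq_Re)

lemma rotate_spin_L2:
  assumes A: "A \<in> SO3" and f: "f \<in> L2_sphere"
  shows "rotate_spin s A f \<in> L2_sphere" "norm_L2 sph_measure (rotate_spin s A f) = norm_L2 sph_measure f"
proof -
  have [measurable]: "f \<in> borel_measurable sph_measure" using f by (simp add: L2_sphere_def)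
  have n: "cmod (rotate_spin s A f x) = cmod (f (rot_coords (transpose A) x))" for x
    unfolding rotate_spin_eq_coords[OF A] norm_mult norm_exp_third_euler by simp
  have "integrable (distr sph_measure sph_measure (rot_coords (transpose A))) (\<lambda>x. (cmod (f x))\<^sup>2)"
    using f unfolding distr_rot_coords[OF SO3_transpose[OF A]] by (simp add: L2_sphere_def)
  then have "integrable sph_measure (\<lambda>x. (cmod (f (rot_coords (transpose A) x)))\<^sup>2)"
    by (subst (asm) integrable_distr_eq) (auto intro: rot_coords_measurable)
  then show "rotate_spin s A f \<in> L2_sphere"
    using rotate_spin_measurable[OF A] f by (simp add: L2_sphere_def n)
  show "norm_L2 sph_measure (rotate_spin s A f) = norm_L2 sph_measure f"
    unfolding norm_L2_def n using integral_rot_coords[OF SO3_transpose[OF A], of "\<lambda>x. (cmod (f x))\<^sup>2"] by simp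
qed

lemma sprod_rotate_spin:
  assumes A: "A \<in> SO3" and f: "f \<in> borel_measurable sph_measure" and g: "g \<in> borel_measurable sph_measure"
  shows "sprod (rotate_spin s A f) (rotate_spin s A g) = sprod f g"
proof -
  have "cnj (rotate_spin s A f x) * rotate_spin s A g x = cnj (f (rot_coords (transpose A) x)) * g (rot_coords (transpose A) x)" for x
  proof -
    define w where "w = exp (- \<i> * of_int s * of_real (third_euler (transpose A ** frame x)))"
    have "cmod w = 1" unfolding w_def by (rule norm_exp_third_euler)
    then have "cnj w * w = 1"
      using complex_norm_square[of w] by (simp add: mult.commute)
    then have "cnj (w * a) * (w * b) = cnj a * b" for a b
      by (metis (no_types, opaque_lifting) complex_cnj_mult mult.assoc mult.left_commute mult_1)
    then show ?thesis unfolding rotate_spin_eq_coords[OF A] w_def[symmetric] .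
  qed
  then show ?thesis
    unfolding sprod_def using f g
    by (simp only: integral_rot_coords[OF SO3_transpose[OF A], of "\<lambda>x. cnj (f x) * g x"] borel_measurable_times borel_measurable_cnj)
qed

text \<open>Applied to the scalar product with h, \<open>spin_functional_zero\<close> says that all
  moments of \<open>cnj (h x) * w x\<close> vanish. The weight \<open>w\<close> is, up to a phase, a
  power of sin(theta / 2) and nonzero in the interior.\<close>

lemma spin_harm_ext_complete:
  assumes h: "h \<in> L2_sphere"
    and orth: "\<And>l j. \<bar>s\<bar> \<le> int l \<Longrightarrow> j \<le> 2 * l \<Longrightarrow> sprod h (spin_harm_ext s l j) = 0"
  shows "AE x in sph_measure. h x = 0"
proof -
  have hm [measurable]: "h \<in> borel_measurable sph_measure" using h by (simp add: L2_sphere_def)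
  have int: "integrable sph_measure (\<lambda>x. cnj (h x) * f x)" if "f \<in> bounded_borel" for f
    using L2_mult_integrable(1)[of h sph_measure f] h bounded_borel_L2[OF that] by (simp add: L2_sphere_eq)
  define w where "w = spin_weight_fun s s"
  have wb: "w \<in> bounded_borel"
    using spin_weight_poly_bounded_borel[of s s 1] by (simp add: w_def)
  have zero: "sprod h (\<lambda>x. w x * sph_monomial a b c (sph_point x)) = 0" for a b c
    unfolding w_def
  proof (rule spin_functional_zero)
    show "sprod h (\<lambda>x. f x + g x) = sprod h f + sprod h g" if "f \<in> bounded_borel" "g \<in> bounded_borel" for f g
      using int[OF that(1)] int[OF that(2)] by (simp add: sprod_def distrib_left)
    show "sprod h (\<lambda>x. c * f x) = c * sprod h f" if "f \<in> bounded_borel" for c f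
    proof -
      have "cnj (h x) * (c * f x) = c * (cnj (h x) * f x)" for x by simp
      then show ?thesis by (simp only: sprod_def Bochner_Integration.integral_mult_right_zero)
    qed
  qed (rule orth)
  have "AE x in sph_measure. cnj (h x) * w x = 0"
  proof (rule AE_zero_of_moments)
    show "integrable sph_measure (\<lambda>x. cnj (h x) * w x)" by (rule int[OF wb])
    show "(LINT x|sph_measure. cnj (h x) * w x * sph_monomial a b c (sph_point x)) = 0" for a b c
      using zero[of a b c] by (simp add: sprod_def mult.assoc)
  qed
  then show ?thesis using AE_sph_interior
  proof eventually_elim
    case (elim x)
    have "sin (fst x / 2) > 0" using elim(2) by (intro sin_gt_zero) auto
    then have "w x \<noteq> 0" by (simp add: w_def spin_weight_fun_def)
    with elim(1) show ?case by simp
  qed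
qed

context haar
begin

text \<open>Rotations preserve scalar products, so each entry of the Gram matrix equals its average
  over SO(3). Schur orthogonality turns the average into a multiple of the identity, and the trace
  determines the multiple.\<close>

lemma spin_harm_ext_orthonormal:
  assumes s: "\<bar>s\<bar> \<le> int l" "\<bar>s\<bar> \<le> int l'" and le: "j \<le> 2 * l" "j' \<le> 2 * l'"
  shows "sprod (spin_harm_ext s l j) (spin_harm_ext s l' j') = (if l = l' \<and> j = j' then 1 else 0)"
proof -
  define G where "G i i' = sprod (spin_harm_ext s l i) (spin_harm_ext s l' i')" for i i'
  have rot: "G j j' = (\<Sum>i\<le>2 * l. \<Sum>i'\<le>2 * l'. G i i' * (cnj (wigner l' i' j' A) * wigner l i j A))" if A: "A \<in> SO3" for A
  proof -
    have "G j j' = sprod (rotate_spin s A (spin_harm_ext s l j)) (rotate_spin s A (spin_harm_ext s l' j'))"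
      unfolding G_def by (rule sprod_rotate_spin[OF A, symmetric]) (use s in \<open>auto intro: spin_harm_ext_measurable\<close>)
    also have "\<dots> = sprod (\<lambda>x. \<Sum>i\<le>2 * l. cnj (wigner l i j A) * spin_harm_ext s l i x)
        (\<lambda>x. \<Sum>i\<le>2 * l'. cnj (wigner l' i j' A) * spin_harm_ext s l' i x)"
      using rotate_spin_harm_ext[OF A s(1) le(1)] rotate_spin_harm_ext[OF A s(2) le(2)] by presburger
    also have "\<dots> = (\<Sum>i\<le>2 * l. cnj (cnj (wigner l i j A)) *
        sprod (spin_harm_ext s l i) (\<lambda>x. \<Sum>i\<le>2 * l'. cnj (wigner l' i j' A) * spin_harm_ext s l' i x))"
      using s unfolding L2_sphere_eq
      by (intro sprod_sum_left[unfolded L2_sphere_eq] L2_sum L2_cmult) (auto intro: spin_harm_ext_L2[unfolded L2_sphere_eq])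
    also have "\<dots> = (\<Sum>i\<le>2 * l. \<Sum>i'\<le>2 * l'. G i i' * (cnj (wigner l' i' j' A) * wigner l i j A))"
    proof (intro sum.cong refl)
      fix i assume "i \<in> {..2 * l}"
      then have "sprod (spin_harm_ext s l i) (\<lambda>x. \<Sum>i\<le>2 * l'. cnj (wigner l' i j' A) * spin_harm_ext s l' i x) =
          (\<Sum>i'\<le>2 * l'. cnj (wigner l' i' j' A) * G i i')"
        unfolding G_def using s by (intro sprod_sum_right) (auto intro: spin_harm_ext_L2)
      then show "cnj (cnj (wigner l i j A)) *
          sprod (spin_harm_ext s l i) (\<lambda>x. \<Sum>i\<le>2 * l'. cnj (wigner l' i j' A) * spin_harm_ext s l' i x) =
          (\<Sum>i'\<le>2 * l'. G i i' * (cnj (wigner l' i' j' A) * wigner l i j A))"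
        by (simp add: sum_distrib_left mult_ac)
    qed
    finally show ?thesis .
  qed
  have int: "integrable \<nu> (\<lambda>A. cnj (wigner l' i' j' A) * wigner l i j A)" if "i \<le> 2 * l" "i' \<le> 2 * l'" for i i'
    using integrable_wigner_mult[of i' l' j' i l j] le that by auto
  have "of_real (8 * pi\<^sup>2) * G j j' = (LINT A|\<nu>. G j j')"
    by (simp add: measure_haar scaleR_conv_of_real)
  also have "\<dots> = (LINT A|\<nu>. (\<Sum>i\<le>2 * l. \<Sum>i'\<le>2 * l'. G i i' * (cnj (wigner l' i' j' A) * wigner l i j A)))"
    by (rule Bochner_Integration.integral_cong[OF refl rot]) (simp add: space_haar)
  also have "\<dots> = (\<Sum>i\<le>2 * l. \<Sum>i'\<le>2 * l'. G i i' * (LINT A|\<nu>. cnj (wigner l' i' j' A) * wigner l i j A))"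
    using int by (subst Bochner_Integration.integral_sum, force)
      (intro sum.cong refl, subst Bochner_Integration.integral_sum, auto)
  also have "\<dots> = (\<Sum>i\<le>2 * l. \<Sum>i'\<le>2 * l'. if i' = i then (if l = l' \<and> j = j' then G i i * of_real (8 * pi\<^sup>2 / (2 * real l + 1)) else 0) else 0)"
    using le by (intro sum.cong refl) (auto simp: wigner_orthogonality)
  also have "\<dots> = (if l = l' \<and> j = j' then (\<Sum>i\<le>2 * l. G i i) * of_real (8 * pi\<^sup>2 / (2 * real l + 1)) else 0)"
    by (auto simp: sum_distrib_right sum_divide_distrib intro!: sum.neutral)
  finally have e: "of_real (8 * pi\<^sup>2) * G j j' = (if l = l' \<and> j = j' then (\<Sum>i\<le>2 * l. G i i) * of_real (8 * pi\<^sup>2 / (2 * real l + 1)) else 0)" .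
  \<comment> \<open>By the addition theorem the integrand of the trace is the constant (2 l + 1) /
    (4 pi), and the area of the sphere is 4 pi.\<close>
  have tr: "(\<Sum>i\<le>2 * l. G i i) = of_real (2 * real l + 1)" if "l = l'"
  proof -
    have "(\<Sum>i\<le>2 * l. G i i) = (\<Sum>i\<le>2 * l. complex_of_real (LINT x|sph_measure. (cmod (spin_harm_ext s l i x))\<^sup>2))"
      unfolding G_def sprod_def that[symmetric] of_real_norm_L2[symmetric] norm_L2_power2 ..
    also have "\<dots> = complex_of_real (\<Sum>i\<le>2 * l. LINT x|sph_measure. (cmod (spin_harm_ext s l i x))\<^sup>2)" by simp
    also have "(\<Sum>i\<le>2 * l. LINT x|sph_measure. (cmod (spin_harm_ext s l i x))\<^sup>2) =
       (LINT x|sph_measure. (\<Sum>i\<le>2 * l. (cmod (spin_harm_ext s l i x))\<^sup>2))"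
      using spin_harm_ext_L2[OF s(1)] by (subst Bochner_Integration.integral_sum) (auto simp: L2_sphere_def)
    also have "\<dots> = 2 * real l + 1"
      unfolding sum_norm_spin_harm_ext[OF s(1)] by (simp add: measure_sph)
    finally show ?thesis .
  qed
  have "G j j' = (if l = l' \<and> j = j' then 1 else 0)"
  proof (cases "l = l' \<and> j = j'")
    case True
    have "of_real (2 * real l + 1) * complex_of_real (8 * pi\<^sup>2 / (2 * real l + 1)) = of_real (8 * pi\<^sup>2)"
      unfolding of_real_mult[symmetric] by (simp add: add_nonneg_eq_0_iff)
    then have "of_real (8 * pi\<^sup>2) * G j j' = of_real (8 * pi\<^sup>2)"
      using e tr True by simp
    moreover have "complex_of_real (8 * pi\<^sup>2) \<noteq> 0" by simp
    ultimately have "G j j' = 1" by (metis mult_cancel_left mult.right_neutral)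
    then show ?thesis using True by simp
  next
    case False
    then show ?thesis using e by (auto split: if_splits)
  qed
  then show ?thesis by (simp only: G_def)
qed

end

section \<open>Projections to a fixed degree and Fourier multipliers\<close>

locale haar_spin = haar +
  fixes s :: int
begin

text \<open>The degrees are counted from |s| on, so that series over the degrees start at k =
  0.\<close>

definition deg :: "nat \<Rightarrow> nat" where "deg k = k + nat \<bar>s\<bar>"

definition basis_harm :: "nat \<Rightarrow> nat \<Rightarrow> sph \<Rightarrow> complex" where
  "basis_harm k j = spin_harm_ext s (deg k) j"

definition coef :: "nat \<Rightarrow> nat \<Rightarrow> (sph \<Rightarrow> complex) \<Rightarrow> complex" where
  "coef k j f = sprod (basis_harm k j) f"

definition proj :: "nat \<Rightarrow> (sph \<Rightarrow> complex) \<Rightarrow> sph \<Rightarrow> complex" where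
  "proj k f x = (\<Sum>j\<le>2 * deg k. coef k j f * basis_harm k j x)"

definition power_spec :: "nat \<Rightarrow> (sph \<Rightarrow> complex) \<Rightarrow> real" where
  "power_spec k f = (\<Sum>j\<le>2 * deg k. (cmod (coef k j f))\<^sup>2)"

definition multiplier_sum :: "(nat \<Rightarrow> complex) \<Rightarrow> nat \<Rightarrow> (sph \<Rightarrow> complex) \<Rightarrow> sph \<Rightarrow> complex" where
  "multiplier_sum c L f x = (\<Sum>k<L. c k * proj k f x)"

lemma deg_ge: "\<bar>s\<bar> \<le> int (deg k)"
  by (simp add: deg_def)

lemma basis_harm_L2: "j \<le> 2 * deg k \<Longrightarrow> basis_harm k j \<in> L2_sphere"
  unfolding basis_harm_def by (intro spin_harm_ext_L2 deg_ge)

lemma proj_L2: "proj k f \<in> L2_sphere"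
  unfolding proj_def[abs_def] L2_sphere_eq by (intro L2_sum L2_cmult) (auto simp: basis_harm_L2 L2_sphere_eq[symmetric])

lemma multiplier_sum_L2: "multiplier_sum c L f \<in> L2_sphere"
  unfolding multiplier_sum_def[abs_def] L2_sphere_eq
  by (intro L2_sum L2_cmult) (auto simp: proj_L2 L2_sphere_eq[symmetric])

lemma power_spec_nonneg: "0 \<le> power_spec k f"
  by (simp add: power_spec_def sum_nonneg)

lemma basis_harm_orthonormal:
  "j \<le> 2 * deg k \<Longrightarrow> j' \<le> 2 * deg k' \<Longrightarrow> sprod (basis_harm k j) (basis_harm k' j') = (if k = k' \<and> j = j' then 1 else 0)"
  unfolding basis_harm_def using spin_harm_ext_orthonormal[OF deg_ge deg_ge] by (auto simp: deg_def)

lemma sprod_proj: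
  assumes "h \<in> L2_sphere"
  shows "sprod h (proj k f) = (\<Sum>j\<le>2 * deg k. coef k j f * cnj (coef k j h))"
  unfolding proj_def[abs_def] using assms
  by (subst sprod_sum_right) (auto simp: basis_harm_L2 coef_def sprod_cnj[of h])

lemma coef_proj:
  assumes "j \<le> 2 * deg k"
  shows "coef k j (proj k' f) = (if k = k' then coef k j f else 0)"
proof -
  have "coef k j (proj k' f) = (\<Sum>i\<le>2 * deg k'. coef k' i f * sprod (basis_harm k j) (basis_harm k' i))"
    unfolding coef_def[of k j "proj k' f"] unfolding proj_def[abs_def]
    by (rule sprod_sum_right) (auto simp: basis_harm_L2 assms)
  also have "\<dots> = (\<Sum>i\<le>2 * deg k'. if i = j \<and> k = k' then coef k' i f else 0)"
    using assms by (intro sum.cong refl) (auto simp: basis_harm_orthonormal)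
  finally show ?thesis using assms by (auto simp: if_distrib cong: if_cong)
qed

lemma sprod_proj_proj: "sprod (proj k f) (proj k' f) = (if k = k' then of_real (power_spec k f) else 0)"
proof -
  have "sprod (proj k f) (proj k' f) = (\<Sum>j\<le>2 * deg k'. coef k' j f * cnj (coef k' j (proj k f)))"
    by (rule sprod_proj[OF proj_L2])
  also have "\<dots> = (if k = k' then (\<Sum>j\<le>2 * deg k'. coef k' j f * cnj (coef k' j f)) else 0)"
    by (auto simp: coef_proj)
  finally show ?thesis
    by (simp add: power_spec_def complex_norm_square del: of_real_power)
qed

lemma norm_proj_sum:
  assumes "finite K"
  shows "(norm_L2 sph_measure (\<lambda>x. \<Sum>k\<in>K. c k * proj k f x))\<^sup>2 = (\<Sum>k\<in>K. (cmod (c k))\<^sup>2 * power_spec k f)"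
proof -
  have L: "(\<lambda>x. \<Sum>k\<in>K. c k * proj k f x) \<in> L2_sphere"
    unfolding L2_sphere_eq by (intro L2_sum L2_cmult) (auto simp: proj_L2 L2_sphere_eq[symmetric])
  have "complex_of_real ((norm_L2 sph_measure (\<lambda>x. \<Sum>k\<in>K. c k * proj k f x))\<^sup>2) =
    sprod (\<lambda>x. \<Sum>k\<in>K. c k * proj k f x) (\<lambda>x. \<Sum>k\<in>K. c k * proj k f x)"
    unfolding sprod_def by (rule of_real_norm_L2)
  also have "\<dots> = (\<Sum>k\<in>K. cnj (c k) * (\<Sum>k'\<in>K. c k' * sprod (proj k f) (proj k' f)))"
    by (simp add: sprod_sum_left[OF L proj_L2] sprod_sum_right[OF proj_L2 proj_L2])
  also have "\<dots> = (\<Sum>k\<in>K. cnj (c k) * (c k * of_real (power_spec k f)))"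
    using assms by (intro sum.cong refl) (simp add: sprod_proj_proj if_distrib cong: if_cong)
  also have "\<dots> = complex_of_real (\<Sum>k\<in>K. (cmod (c k))\<^sup>2 * power_spec k f)"
    unfolding of_real_sum of_real_mult complex_norm_square by (simp add: mult_ac)
  finally show ?thesis by (simp only: of_real_eq_iff)
qed

lemma Bessel:
  assumes f: "f \<in> L2_sphere"
  shows "(\<Sum>k<L. power_spec k f) \<le> (norm_L2 sph_measure f)\<^sup>2"
proof -
  let ?P = "multiplier_sum (\<lambda>_. 1) L f"
  have "sprod f ?P = (\<Sum>k<L. 1 * sprod f (proj k f))"
    unfolding multiplier_sum_def[abs_def] by (rule sprod_sum_right[OF f proj_L2])
  also have "\<dots> = of_real (\<Sum>k<L. power_spec k f)"
    unfolding of_real_sum power_spec_def complex_norm_square by (simp add: sprod_proj[OF f])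
  finally have c: "Re (LINT x|sph_measure. cnj (f x) * ?P x) = (\<Sum>k<L. power_spec k f)"
    by (simp add: sprod_def)
  have "0 \<le> (norm_L2 sph_measure (\<lambda>x. f x - ?P x))\<^sup>2" by simp
  also have "\<dots> = (norm_L2 sph_measure f)\<^sup>2 - 2 * Re (LINT x|sph_measure. cnj (f x) * ?P x) + (norm_L2 sph_measure ?P)\<^sup>2"
    using f multiplier_sum_L2 by (intro integral_norm_square_diff) (simp_all add: L2_sphere_eq)
  also have "(norm_L2 sph_measure ?P)\<^sup>2 = (\<Sum>k<L. power_spec k f)"
    unfolding multiplier_sum_def[abs_def] by (subst norm_proj_sum) auto
  finally show ?thesis unfolding c by simp
qed

lemma summable_power_spec:
  assumes "f \<in> L2_sphere"
  shows "summable (\<lambda>k. power_spec k f)"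
  by (rule summableI_nonneg_bounded[OF power_spec_nonneg Bessel[OF assms]])

lemma multiplier_limit:
  assumes f: "f \<in> L2_sphere" and c: "\<And>k. cmod (c k) \<le> B"
  obtains F where "F \<in> L2_sphere" "(\<lambda>L. norm_L2 sph_measure (\<lambda>x. multiplier_sum c L f x - F x)) \<longlonglongrightarrow> 0"
proof -
  have sm: "summable (\<lambda>k. (cmod (c k))\<^sup>2 * power_spec k f)"
  proof (rule summable_comparison_test')
    show "summable (\<lambda>k. B\<^sup>2 * power_spec k f)" by (intro summable_mult summable_power_spec f)
    show "norm ((cmod (c k))\<^sup>2 * power_spec k f) \<le> B\<^sup>2 * power_spec k f" for k
      using c[of k] power_spec_nonneg[of k f] by (auto simp: abs_mult intro!: mult_mono power_mono)
  qed
  have diff: "norm_L2 sph_measure (\<lambda>x. multiplier_sum c m f x - multiplier_sum c n f x) =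
     sqrt (\<Sum>k=n..<m. (cmod (c k))\<^sup>2 * power_spec k f)" if "n \<le> m" for m n
  proof -
    have "multiplier_sum c m f x - multiplier_sum c n f x = (\<Sum>k=n..<m. c k * proj k f x)" for x
      using sum_diff_nat_ivl[of 0 n m "\<lambda>k. c k * proj k f x"] that by (simp add: multiplier_sum_def atLeast0LessThan)
    then have "(norm_L2 sph_measure (\<lambda>x. multiplier_sum c m f x - multiplier_sum c n f x))\<^sup>2 = (\<Sum>k=n..<m. (cmod (c k))\<^sup>2 * power_spec k f)"
      by (simp add: norm_proj_sum)
    then show ?thesis by (metis norm_L2_nonneg real_sqrt_unique)
  qed
  have Cauchy: "\<exists>N. \<forall>m\<ge>N. \<forall>n\<ge>N. norm_L2 sph_measure (\<lambda>x. multiplier_sum c m f x - multiplier_sum c n f x) \<le> e" if e: "e > 0" for e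
  proof -
    obtain N where N: "\<And>m n. m \<ge> N \<Longrightarrow> norm (\<Sum>k=m..<n. (cmod (c k))\<^sup>2 * power_spec k f) < e\<^sup>2"
      using sm e unfolding summable_Cauchy by (metis zero_less_power)
    have *: "norm_L2 sph_measure (\<lambda>x. multiplier_sum c m f x - multiplier_sum c n f x) \<le> e" if "n \<ge> N" "n \<le> m" for m n
    proof -
      have "(\<Sum>k=n..<m. (cmod (c k))\<^sup>2 * power_spec k f) \<le> e\<^sup>2" using N[OF that(1), of m] by simp
      then show ?thesis unfolding diff[OF that(2)] using e by (simp add: real_le_lsqrt)
    qed
    have "norm_L2 sph_measure (\<lambda>x. multiplier_sum c m f x - multiplier_sum c n f x) \<le> e" if "m \<ge> N" "n \<ge> N" for m n
      using *[of n m] *[of m n] that norm_L2_minus[of sph_measure "multiplier_sum c m f" "multiplier_sum c n f"]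
      by (cases "n \<le> m") auto
    then show ?thesis by blast
  qed
  show ?thesis
    using sph.L2_complete[of "\<lambda>L. multiplier_sum c L f", OF _ Cauchy] multiplier_sum_L2 that
    unfolding L2_sphere_eq by blast
qed

lemma multiplier_limit_sprod:
  assumes f: "f \<in> L2_sphere" and F: "F \<in> L2_sphere" and h: "h \<in> L2_sphere"
    and lim: "(\<lambda>L. norm_L2 sph_measure (\<lambda>x. multiplier_sum c L f x - F x)) \<longlonglongrightarrow> 0"
  shows "(\<lambda>k. c k * sprod h (proj k f)) sums sprod h F"
proof -
  have "(\<lambda>L. LINT x|sph_measure. cnj (h x) * multiplier_sum c L f x) \<longlonglongrightarrow> (LINT x|sph_measure. cnj (h x) * F x)"
    using assms multiplier_sum_L2 by (intro L2_inner_tendsto) (auto simp: L2_sphere_eq)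
  moreover have "(LINT x|sph_measure. cnj (h x) * multiplier_sum c L f x) = (\<Sum>k<L. c k * sprod h (proj k f))" for L
    using sprod_sum_right[OF h proj_L2] by (simp add: multiplier_sum_def sprod_def)
  ultimately show ?thesis by (simp add: sums_def sprod_def)
qed

text \<open>By Bessel's inequality the partial sums converge to some \<open>F\<close> with the same
  coefficients as f. The difference is orthogonal to all harmonics and therefore zero almost
  everywhere by completeness.\<close>

lemma expansion:
  assumes f: "f \<in> L2_sphere"
  shows "(\<lambda>L. norm_L2 sph_measure (\<lambda>x. multiplier_sum (\<lambda>_. 1) L f x - f x)) \<longlonglongrightarrow> 0"
proof -
  obtain F where F: "F \<in> L2_sphere" "(\<lambda>L. norm_L2 sph_measure (\<lambda>x. multiplier_sum (\<lambda>_. 1) L f x - F x)) \<longlonglongrightarrow> 0"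
    by (rule multiplier_limit[OF f, of "\<lambda>_. 1" 1]) auto
  have c: "coef k j F = coef k j f" if j: "j \<le> 2 * deg k" for k j
  proof -
    have "(\<lambda>k'. 1 * sprod (basis_harm k j) (proj k' f)) sums coef k j F"
      unfolding coef_def by (rule multiplier_limit_sprod[OF f F(1) basis_harm_L2[OF j] F(2)])
    moreover have "(\<lambda>k'. 1 * sprod (basis_harm k j) (proj k' f)) = (\<lambda>k'. if k' = k then coef k j f else 0)"
      using coef_proj[OF j] by (auto simp: coef_def)
    ultimately show ?thesis using sums_single[of k "\<lambda>_. coef k j f"] sums_unique2 by metis
  qed
  have d: "(\<lambda>x. F x - f x) \<in> L2_sphere" using F(1) f L2_diff by (auto simp: L2_sphere_eq)
  have "AE x in sph_measure. F x - f x = 0"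
  proof (rule spin_harm_ext_complete[OF d])
    fix l j assume l: "\<bar>s\<bar> \<le> int l" and j: "j \<le> 2 * l"
    define k where "k = l - nat \<bar>s\<bar>"
    have k: "l = deg k" using l by (simp add: k_def deg_def)
    have i: "integrable sph_measure (\<lambda>x. cnj (basis_harm k j x) * F x)" "integrable sph_measure (\<lambda>x. cnj (basis_harm k j x) * f x)"
      using L2_mult_integrable(1) basis_harm_L2[of j k] j F(1) f by (auto simp: L2_sphere_eq k)
    have "sprod (basis_harm k j) (\<lambda>x. F x - f x) = coef k j F - coef k j f"
      unfolding coef_def sprod_def using i by (simp add: right_diff_distrib)
    then have "sprod (basis_harm k j) (\<lambda>x. F x - f x) = 0" using c j k by simp
    then show "sprod (\<lambda>x. F x - f x) (spin_harm_ext s l j) = 0"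
      by (subst sprod_cnj) (simp add: basis_harm_def k)
  qed
  then have "norm_L2 sph_measure (\<lambda>x. multiplier_sum (\<lambda>_. 1) L f x - F x) = norm_L2 sph_measure (\<lambda>x. multiplier_sum (\<lambda>_. 1) L f x - f x)" for L
    unfolding norm_L2_def
    using F(1) f multiplier_sum_L2[of "\<lambda>_. 1" L f]
    by (intro arg_cong[of _ _ sqrt] integral_cong_AE) (auto simp: L2_sphere_def)
  then show ?thesis using F(2) by simp
qed

text \<open>Subtracting the expansion of f itself changes the multiplier to c - 1, and the norm of
  the partial sums is known by orthogonality.\<close>

lemma multiplier_limit_distance:
  assumes f: "f \<in> L2_sphere" and F: "F \<in> L2_sphere"
    and lim: "(\<lambda>L. norm_L2 sph_measure (\<lambda>x. multiplier_sum c L f x - F x)) \<longlonglongrightarrow> 0"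
  shows "(\<lambda>k. (cmod (c k - 1))\<^sup>2 * power_spec k f) sums (norm_L2 sph_measure (\<lambda>x. F x - f x))\<^sup>2"
proof -
  let ?n = "norm_L2 sph_measure"
  let ?u = "\<lambda>L. multiplier_sum c L f" and ?v = "\<lambda>L. multiplier_sum (\<lambda>_. 1) L f"
  have uL: "?u L \<in> L2_space sph_measure" "?v L \<in> L2_space sph_measure" for L
    using multiplier_sum_L2 by (auto simp: L2_sphere_eq)
  note fF = f[unfolded L2_sphere_eq] F[unfolded L2_sphere_eq]
  have "(\<lambda>L. ?n (\<lambda>x. ?u L x - ?v L x)) \<longlonglongrightarrow> ?n (\<lambda>x. F x - f x)"
  proof (rule LIM_zero_cancel, rule Lim_null_comparison)
    have "norm (?n (\<lambda>x. ?u L x - ?v L x) - ?n (\<lambda>x. F x - f x)) \<le> ?n (\<lambda>x. ?u L x - F x) + ?n (\<lambda>x. ?v L x - f x)" for L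
    proof -
      have "\<bar>?n (\<lambda>x. ?u L x - ?v L x) - ?n (\<lambda>x. F x - f x)\<bar> \<le> ?n (\<lambda>x. (?u L x - ?v L x) - (F x - f x))"
        using uL fF by (intro L2_norm_diff_le L2_diff)
      also have "\<dots> = ?n (\<lambda>x. (?u L x - F x) - (?v L x - f x))" by (rule norm_L2_eqI) (simp add: algebra_simps)
      also have "\<dots> \<le> ?n (\<lambda>x. (?u L x - F x) - 0) + ?n (\<lambda>x. 0 - (?v L x - f x))"
        using uL fF by (intro L2_triangle_diff L2_diff L2_zero)
      also have "?n (\<lambda>x. 0 - (?v L x - f x)) = ?n (\<lambda>x. ?v L x - f x)" by (rule norm_L2_eqI) (simp add: norm_minus_commute)
      finally show ?thesis by simp
    qed
    then show "\<forall>\<^sub>F L in sequentially. norm (?n (\<lambda>x. ?u L x - ?v L x) - ?n (\<lambda>x. F x - f x)) \<le> ?n (\<lambda>x. ?u L x - F x) + ?n (\<lambda>x. ?v L x - f x)"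
      by simp
    show "(\<lambda>L. ?n (\<lambda>x. ?u L x - F x) + ?n (\<lambda>x. ?v L x - f x)) \<longlonglongrightarrow> 0"
      using tendsto_add[OF lim expansion[OF f]] by simp
  qed
  then have "(\<lambda>L. (?n (\<lambda>x. ?u L x - ?v L x))\<^sup>2) \<longlonglongrightarrow> (?n (\<lambda>x. F x - f x))\<^sup>2" by (intro tendsto_power)
  moreover have "(?n (\<lambda>x. ?u L x - ?v L x))\<^sup>2 = (\<Sum>k<L. (cmod (c k - 1))\<^sup>2 * power_spec k f)" for L
  proof -
    have "?u L x - ?v L x = (\<Sum>k<L. (c k - 1) * proj k f x)" for x
      by (simp add: multiplier_sum_def sum_subtractf left_diff_distrib)
    then show ?thesis by (simp add: norm_proj_sum)
  qed
  ultimately show ?thesis by (simp add: sums_def)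
qed

text \<open>Absolute convergence, by |a b| at most |a|^2 + |b|^2 for the coefficients. It provides
  the majorant for exchanging the series over the degrees with the integral over the scales.\<close>

lemma summable_sprod_proj:
  assumes f: "f \<in> L2_sphere" and h: "h \<in> L2_sphere"
  shows "summable (\<lambda>k. cmod (sprod h (proj k f)))"
proof (rule summable_comparison_test')
  show "summable (\<lambda>k. power_spec k f + power_spec k h)" by (intro summable_add summable_power_spec f h)
  fix k
  have "cmod (sprod h (proj k f)) \<le> (\<Sum>j\<le>2 * deg k. cmod (coef k j f * cnj (coef k j h)))"
    unfolding sprod_proj[OF h] by (rule norm_sum)
  also have "\<dots> \<le> (\<Sum>j\<le>2 * deg k. (cmod (coef k j f))\<^sup>2 + (cmod (coef k j h))\<^sup>2)"
  proof (intro sum_mono)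
    fix j
    have "2 * (cmod (coef k j f) * cmod (coef k j h)) \<le> (cmod (coef k j f))\<^sup>2 + (cmod (coef k j h))\<^sup>2"
      using sum_squares_bound[of "cmod (coef k j f)" "cmod (coef k j h)"] by simp
    moreover have "0 \<le> cmod (coef k j f) * cmod (coef k j h)" by simp
    ultimately show "cmod (coef k j f * cnj (coef k j h)) \<le> (cmod (coef k j f))\<^sup>2 + (cmod (coef k j h))\<^sup>2"
      unfolding norm_mult complex_mod_cnj by linarith
  qed
  finally show "norm (cmod (sprod h (proj k f))) \<le> power_spec k f + power_spec k h"
    by (simp add: power_spec_def sum.distrib)
qed

end

section \<open>Reconstruction at a fixed scale\<close>

text \<open>Without a derivative, the predicate under the choice operator is constantly false, so
  the default value is the same for all such functions.\<close>

lemma vector_derivative_not_differentiable: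
  assumes "\<nexists>D. (f has_vector_derivative D) net"
  shows "vector_derivative f net = (SOME x. False)"
  using assms by (simp add: vector_derivative_def)

text \<open>Where the derivative does not exist, the value of the derivative function is a constant. For a
  fixed phi the derivative at t0 exists only if the value of H at t0 is the limit.\<close>

lemma measurable_vector_derivative_product:
  fixes H :: "real \<Rightarrow> real \<Rightarrow> complex"
  assumes V: "open V" "t0 \<in> V" and H: "\<And>t \<phi>. t \<in> V \<Longrightarrow> t \<noteq> t0 \<Longrightarrow> H t \<phi> = g t * w \<phi>"
    and w0: "\<And>\<phi>. w \<phi> \<noteq> 0" and w [measurable]: "w \<in> borel_measurable borel"
    and H0 [measurable]: "H t0 \<in> borel_measurable borel"
  shows "(\<lambda>\<phi>. vector_derivative (\<lambda>t. H t \<phi>) (at t0)) \<in> borel_measurable borel"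
proof -
  \<comment> \<open>The factor g, completed by the value v at t0. After division by w, every section
    of \<open>H\<close> near t0 is of this form.\<close>
  define G where "G v t = (if t = t0 then v else g t)" for v t
  have scale: "((\<lambda>t. H t \<phi>) has_vector_derivative d * w \<phi>) (at t0)"
    if "(G v has_vector_derivative d) (at t0)" "H t0 \<phi> = v * w \<phi>" for v d \<phi>
  proof (rule has_vector_derivative_transform_within_open[OF _ V])
    show "((\<lambda>t. G v t * w \<phi>) has_vector_derivative d * w \<phi>) (at t0)"
      using has_vector_derivative_mult[OF that(1) has_vector_derivative_const[of "w \<phi>"]] by simp
  qed (use H that in \<open>auto simp: G_def\<close>)
  have unscale: "(G (H t0 \<phi> / w \<phi>) has_vector_derivative d / w \<phi>) (at t0)"
    if "((\<lambda>t. H t \<phi>) has_vector_derivative d) (at t0)" for d \<phi>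
  proof (rule has_vector_derivative_transform_within_open[OF _ V])
    show "((\<lambda>t. H t \<phi> * (1 / w \<phi>)) has_vector_derivative d / w \<phi>) (at t0)"
      using has_vector_derivative_mult[OF that has_vector_derivative_const[of "1 / w \<phi>"]] by simp
  qed (use H w0 in \<open>auto simp: G_def\<close>)
  show ?thesis
  proof (cases "\<exists>v d. (G v has_vector_derivative d) (at t0)")
    case True
    then obtain v d where vd: "(G v has_vector_derivative d) (at t0)" by blast
    have lim: "g \<midarrow>t0\<rightarrow> u" if "(G u has_vector_derivative e) (at t0)" for u e
    proof -
      have "G u \<midarrow>t0\<rightarrow> G u t0"
        using has_vector_derivative_continuous[OF that] by (simp add: continuous_at)
      then have "G u \<midarrow>t0\<rightarrow> u" by (simp add: G_def)
      then show ?thesis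
        by (rule Lim_transform_eventually) (auto simp: G_def eventually_at_filter)
    qed
    have "vector_derivative (\<lambda>t. H t \<phi>) (at t0) = (if H t0 \<phi> = v * w \<phi> then d * w \<phi> else (SOME x. False))" for \<phi>
    proof (cases "H t0 \<phi> = v * w \<phi>")
      case True
      then show ?thesis using vector_derivative_at[OF scale[OF vd]] by simp
    next
      case False
      have "\<nexists>D. ((\<lambda>t. H t \<phi>) has_vector_derivative D) (at t0)"
      proof
        assume "\<exists>D. ((\<lambda>t. H t \<phi>) has_vector_derivative D) (at t0)"
        then obtain D where "((\<lambda>t. H t \<phi>) has_vector_derivative D) (at t0)" ..
        then have "H t0 \<phi> / w \<phi> = v"
          using LIM_unique[OF lim[OF unscale] lim[OF vd]] by simp
        then show False using False w0[of \<phi>] by (simp add: field_simps)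
      qed
      then show ?thesis using False by (simp add: vector_derivative_not_differentiable)
    qed
    then show ?thesis by simp
  next
    case False
    then have "\<nexists>D. ((\<lambda>t. H t \<phi>) has_vector_derivative D) (at t0)" for \<phi>
      using unscale by blast
    then show ?thesis by (simp add: vector_derivative_not_differentiable)
  qed
qed

text \<open>Division by zero yields zero, so at a pole both the azimuthal term and the cotangent
  term disappear.\<close>

lemma eth_pole:
  assumes "sin t0 = 0"
  shows "eth s f (t0, \<phi>) = - vector_derivative (\<lambda>t. f (t, \<phi>)) (at t0)"
    and "eth_bar s f (t0, \<phi>) = - vector_derivative (\<lambda>t. f (t, \<phi>)) (at t0)"
  using assms by (simp_all add: eth_def eth_bar_def d_theta_def cot_def)

text \<open>Near the pole all powers are products of a function of theta and the same phase w, so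
  each step is an instance of the preceding lemma on derivatives of products. The constant
  \<open>C\<close> may vary with t because the sign can change across the pole.\<close>

lemma
  assumes pole: "sin t0 = 0" and V: "open V" "t0 \<in> V"
    and loc: "\<And>t. t \<in> V \<Longrightarrow> t \<noteq> t0 \<Longrightarrow> \<exists>U C. open U \<and> t \<in> U \<and> (\<forall>\<theta>\<in>U. sin \<theta> \<noteq> 0) \<and>
      (\<forall>\<theta>\<in>U. \<forall>\<phi>. f (\<theta>, \<phi>) = C * spin_fun l l j \<theta> \<phi>)"
    and f0: "(\<lambda>\<phi>. f (t0, \<phi>)) \<in> borel_measurable borel" and k: "k \<le> l"
  shows eth_pow_measurable_pole: "(\<lambda>\<phi>. eth_pow k f (t0, \<phi>)) \<in> borel_measurable borel"
    and eth_bar_pow_measurable_pole: "(\<lambda>\<phi>. eth_bar_pow k f (t0, \<phi>)) \<in> borel_measurable borel"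
proof -
  define w where "w \<phi> = cis ((real j - real (l + l) / 2) * \<phi>)" for \<phi>
  have wm: "w \<in> borel_measurable borel" unfolding w_def
    by (intro borel_measurable_continuous_onI continuous_intros)
  have w0: "w \<phi> \<noteq> 0" for \<phi> by (simp add: w_def)
  have sep: "\<exists>g. \<forall>t\<in>V - {t0}. \<forall>\<phi>. h (t, \<phi>) = g t * w \<phi>"
    if "\<And>t U C. open U \<Longrightarrow> t \<in> U \<Longrightarrow> (\<And>\<theta>. \<theta> \<in> U \<Longrightarrow> sin \<theta> \<noteq> 0) \<Longrightarrow>
       (\<And>\<theta> \<phi>. \<theta> \<in> U \<Longrightarrow> f (\<theta>, \<phi>) = C * spin_fun l l j \<theta> \<phi>) \<Longrightarrow> \<exists>c. \<forall>\<phi>. h (t, \<phi>) = c * w \<phi>" for h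
  proof -
    have "\<forall>t\<in>V - {t0}. \<exists>c. \<forall>\<phi>. h (t, \<phi>) = c * w \<phi>"
    proof
      fix t assume "t \<in> V - {t0}"
      then have "t \<in> V" "t \<noteq> t0" by auto
      from loc[OF this] obtain U C where UC: "open U \<and> t \<in> U \<and> (\<forall>\<theta>\<in>U. sin \<theta> \<noteq> 0) \<and>
        (\<forall>\<theta>\<in>U. \<forall>\<phi>. f (\<theta>, \<phi>) = C * spin_fun l l j \<theta> \<phi>)" by blast
      show "\<exists>c. \<forall>\<phi>. h (t, \<phi>) = c * w \<phi>" by (rule that[of U t C]) (use UC in auto)
    qed
    then show ?thesis by (rule bchoice)
  qed
  have sf: "spin_fun (l + i) (l - i) j t \<phi> = of_real (spin_fun_real (l + i) (l - i) j t) * w \<phi>"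
    "spin_fun (l - i) (l + i) j t \<phi> = of_real (spin_fun_real (l - i) (l + i) j t) * w \<phi>" if "i \<le> l" for i t \<phi>
    using that by (simp_all add: spin_fun_eq w_def)
  show "(\<lambda>\<phi>. eth_pow k f (t0, \<phi>)) \<in> borel_measurable borel"
    using k
  proof (induction k)
    case 0
    then show ?case using f0 by simp
  next
    case (Suc k)
    obtain g where g: "\<forall>t\<in>V - {t0}. \<forall>\<phi>. eth_pow k f (t, \<phi>) = g t * w \<phi>"
    proof -
      have "\<exists>g. \<forall>t\<in>V - {t0}. \<forall>\<phi>. eth_pow k f (t, \<phi>) = g t * w \<phi>"
      proof (rule sep)
        fix t U C assume U: "open U" "t \<in> U" "\<And>\<theta>. \<theta> \<in> U \<Longrightarrow> sin \<theta> \<noteq> 0"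
          "\<And>\<theta> \<phi>. \<theta> \<in> U \<Longrightarrow> f (\<theta>, \<phi>) = C * spin_fun l l j \<theta> \<phi>"
        show "\<exists>c. \<forall>\<phi>. eth_pow k f (t, \<phi>) = c * w \<phi>"
          using eth_pow_spin_fun[OF U(1,3,4) _ U(2), of k] Suc.prems
          by (intro exI[of _ "C * (fact l / fact (l - k)) * of_real (spin_fun_real (l + k) (l - k) j t)"]) (simp add: sf)
      qed
      then show ?thesis using that by blast
    qed
    have "(\<lambda>\<phi>. vector_derivative (\<lambda>t. eth_pow k f (t, \<phi>)) (at t0)) \<in> borel_measurable borel"
      using measurable_vector_derivative_product[OF V, of "\<lambda>t \<phi>. eth_pow k f (t, \<phi>)" g w] g w0 wm Suc by auto
    then show ?case by (simp add: eth_pole[OF pole])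
  qed
  show "(\<lambda>\<phi>. eth_bar_pow k f (t0, \<phi>)) \<in> borel_measurable borel"
    using k
  proof (induction k)
    case 0
    then show ?case using f0 by simp
  next
    case (Suc k)
    obtain g where g: "\<forall>t\<in>V - {t0}. \<forall>\<phi>. eth_bar_pow k f (t, \<phi>) = g t * w \<phi>"
    proof -
      have "\<exists>g. \<forall>t\<in>V - {t0}. \<forall>\<phi>. eth_bar_pow k f (t, \<phi>) = g t * w \<phi>"
      proof (rule sep)
        fix t U C assume U: "open U" "t \<in> U" "\<And>\<theta>. \<theta> \<in> U \<Longrightarrow> sin \<theta> \<noteq> 0"
          "\<And>\<theta> \<phi>. \<theta> \<in> U \<Longrightarrow> f (\<theta>, \<phi>) = C * spin_fun l l j \<theta> \<phi>"
        show "\<exists>c. \<forall>\<phi>. eth_bar_pow k f (t, \<phi>) = c * w \<phi>"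
          using eth_bar_pow_spin_fun[OF U(1,3,4) _ U(2), of k] Suc.prems
          by (intro exI[of _ "(-1) ^ k * C * (fact l / fact (l - k)) * of_real (spin_fun_real (l - k) (l + k) j t)"]) (simp add: sf)
      qed
      then show ?thesis using that by blast
    qed
    have "(\<lambda>\<phi>. vector_derivative (\<lambda>t. eth_bar_pow k f (t, \<phi>)) (at t0)) \<in> borel_measurable borel"
      using measurable_vector_derivative_product[OF V, of "\<lambda>t \<phi>. eth_bar_pow k f (t, \<phi>)" g w] g w0 wm Suc by auto
    then show ?case by (simp add: eth_pole[OF pole])
  qed
qed

text \<open>Both reflections amount to t -> - t in the polynomial, up to a sign of one linear
  factor. They describe the harmonics on the far side of a pole, where the operators differentiate
  them as functions on the plane.\<close>

lemma spin_fun_real_reflection: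
  "spin_fun_real p q j (- \<theta>) = (-1) ^ (j + q) * spin_fun_real p q j \<theta>"
  "spin_fun_real p q j (2 * pi - \<theta>) = (-1) ^ (j + p) * spin_fun_real p q j \<theta>"
proof -
  define a b where "a = cos (\<theta> / 2)" and "b = sin (\<theta> / 2)"
  have h: "cos (pi - \<theta> / 2) = - a" "sin (pi - \<theta> / 2) = b" "(2 * pi - \<theta>) / 2 = pi - \<theta> / 2"
    by (simp_all add: a_def b_def diff_divide_distrib cos_diff sin_diff)
  have P: "pcompose ([:a, b:] ^ p * [:- b, a:] ^ q) [:0, -1:] = [:a, - b:] ^ p * [:- b, - a:] ^ q"
    by (simp add: pcompose_mult pcompose_power pcompose_pCons)
  have c: "coeff ([:a, - b:] ^ p * [:- b, - a:] ^ q) j = (-1) ^ j * coeff ([:a, b:] ^ p * [:- b, a:] ^ q) j"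
    unfolding P[symmetric] by (rule coeff_pcompose_linear)
  have m: "[:b, a:] = smult (-1) [:- b, - a:]" "[:- a, b:] = smult (-1) [:a, - b:]" by simp_all
  have "spin_fun_real p q j (- \<theta>) = coeff ([:a, - b:] ^ p * [:b, a:] ^ q) j"
    by (simp add: spin_fun_real_def a_def b_def)
  also have "\<dots> = (-1) ^ q * ((-1) ^ j * coeff ([:a, b:] ^ p * [:- b, a:] ^ q) j)"
    unfolding c[symmetric] m(1) smult_power by simp
  finally show "spin_fun_real p q j (- \<theta>) = (-1) ^ (j + q) * spin_fun_real p q j \<theta>"
    by (simp add: spin_fun_real_def a_def b_def power_add mult_ac)
  have "spin_fun_real p q j (2 * pi - \<theta>) = coeff ([:- a, b:] ^ p * [:- b, - a:] ^ q) j"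
    by (simp add: spin_fun_real_def h) (simp add: a_def b_def)
  also have "\<dots> = (-1) ^ p * ((-1) ^ j * coeff ([:a, b:] ^ p * [:- b, a:] ^ q) j)"
    unfolding c[symmetric] m(2) smult_power by simp
  finally show "spin_fun_real p q j (2 * pi - \<theta>) = (-1) ^ (j + p) * spin_fun_real p q j \<theta>"
    by (simp add: spin_fun_real_def a_def b_def power_add mult_ac)
qed

lemma sph_harm_reflection: "sph_harm l m (- \<theta>, \<phi>) = sph_harm l m (\<theta>, \<phi>)" "sph_harm l m (2 * pi - \<theta>, \<phi>) = sph_harm l m (\<theta>, \<phi>)"
  by (simp_all add: sph_harm_def sph_harm_nonneg_def cos_diff)

lemma sph_harm_locally_spin_fun:
  assumes m: "\<bar>m\<bar> \<le> int l" and t: "- pi < t" "t < 2 * pi" "t \<noteq> 0" "t \<noteq> pi"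
  shows "\<exists>U C. open U \<and> t \<in> U \<and> (\<forall>\<theta>\<in>U. sin \<theta> \<noteq> 0) \<and>
    (\<forall>\<theta>\<in>U. \<forall>\<phi>. sph_harm l m (\<theta>, \<phi>) = C * spin_fun l l (nat (int l + m)) \<theta> \<phi>)"
proof -
  define j where "j = nat (int l + m)"
  define K where "K = harm_sign m * of_real (sqrt ((2 * real l + 1) / (4 * pi)) *
    sqrt (fact (nat (int l + m)) * fact (nat (int l - m))) / fact l)"
  have e: "sph_harm l m (\<theta>, \<phi>) = K * spin_fun l l j \<theta> \<phi>" if "0 < \<theta>" "\<theta> < pi" for \<theta> \<phi>
    unfolding K_def j_def by (rule sph_harm_eq[OF m that])
  have s: "sin \<theta> \<noteq> 0" if "0 < \<theta>" "\<theta> < pi" for \<theta> :: real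
    using sin_gt_zero[OF that] by simp
  consider "t \<in> {-pi<..<0}" | "t \<in> {0<..<pi}" | "t \<in> {pi<..<2 * pi}" using t by fastforce
  then show ?thesis
  proof cases
    case 1
    have "sin \<theta> \<noteq> 0 \<and> sph_harm l m (\<theta>, \<phi>) = K * (-1) ^ (j + l) * spin_fun l l j \<theta> \<phi>" if "\<theta> \<in> {-pi<..<0}" for \<theta> \<phi>
      using e[of "- \<theta>" \<phi>] s[of "- \<theta>"] that
      by (simp add: sph_harm_reflection spin_fun_eq spin_fun_real_reflection)
    with 1 show ?thesis unfolding j_def[symmetric] by (intro exI[of _ "{-pi<..<0}"] exI[of _ "K * (-1) ^ (j + l)"]) auto
  next
    case 2
    then show ?thesis unfolding j_def[symmetric] using e s by (intro exI[of _ "{0<..<pi}"] exI[of _ K]) auto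
  next
    case 3
    have "sin \<theta> \<noteq> 0 \<and> sph_harm l m (\<theta>, \<phi>) = K * (-1) ^ (j + l) * spin_fun l l j \<theta> \<phi>" if "\<theta> \<in> {pi<..<2 * pi}" for \<theta> \<phi>
      using e[of "2 * pi - \<theta>" \<phi>] s[of "2 * pi - \<theta>"] that
      by (simp add: sph_harm_reflection spin_fun_eq spin_fun_real_reflection sin_diff)
    with 3 show ?thesis unfolding j_def[symmetric] by (intro exI[of _ "{pi<..<2 * pi}"] exI[of _ "K * (-1) ^ (j + l)"]) auto
  qed
qed

lemma spin_harm_measurable_pole:
  assumes s: "\<bar>s\<bar> \<le> int l" and m: "\<bar>m\<bar> \<le> int l" and t0: "t0 = 0 \<or> t0 = pi"
  shows "(\<lambda>\<phi>. spin_harm s l m (t0, \<phi>)) \<in> borel_measurable borel"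
proof -
  define V where "V = {t0 - pi<..<t0 + pi}"
  have V: "open V" "t0 \<in> V" by (auto simp: V_def)
  have pole: "sin t0 = 0" using t0 by auto
  have loc: "\<exists>U C. open U \<and> t \<in> U \<and> (\<forall>\<theta>\<in>U. sin \<theta> \<noteq> 0) \<and>
    (\<forall>\<theta>\<in>U. \<forall>\<phi>. sph_harm l m (\<theta>, \<phi>) = C * spin_fun l l (nat (int l + m)) \<theta> \<phi>)" if "t \<in> V" "t \<noteq> t0" for t
    using that t0 pi_gt_zero unfolding V_def by (intro sph_harm_locally_spin_fun[OF m]) auto
  have "(\<lambda>\<phi>. cis (c * \<phi>)) \<in> borel_measurable borel" for c
    by (intro borel_measurable_continuous_onI continuous_intros)
  then have f0: "(\<lambda>\<phi>. sph_harm l m (t0, \<phi>)) \<in> borel_measurable borel"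
    unfolding sph_harm_def sph_harm_nonneg_def prod.case by measurable
  have "nat s \<le> l" "nat (- s) \<le> l" using s by auto
  from eth_pow_measurable_pole[OF pole V loc f0 this(1)] eth_bar_pow_measurable_pole[OF pole V loc f0 this(2)]
  show ?thesis unfolding spin_harm_def by (cases "0 \<le> s") auto
qed

text \<open>The measure is not completed, so the null lines at the poles matter for measurability,
  and an integral of a nonmeasurable integrand would be 0 by convention. This makes the Fourier
  coefficients in the admissibility condition genuine ones.\<close>

lemma spin_harm_measurable:
  assumes s: "\<bar>s\<bar> \<le> int l" and m: "\<bar>m\<bar> \<le> int l"
  shows "spin_harm s l m \<in> borel_measurable sph_measure"
proof -
  define h where "h x = (if fst x = 0 then spin_harm s l m (0, snd x) else if fst x = pi then spin_harm s l m (pi, snd x)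
    else harm_sign m * spin_harm_ext s l (nat (int l + m)) x)" for x
  have [measurable]: "(\<lambda>x :: sph. spin_harm s l m (0, snd x)) \<in> borel_measurable borel"
    "(\<lambda>x :: sph. spin_harm s l m (pi, snd x)) \<in> borel_measurable borel"
    by (rule measurable_compose[OF borel_measurable_snd_sph spin_harm_measurable_pole[OF s m]]; simp)+
  have [measurable]: "spin_harm_ext s l (nat (int l + m)) \<in> borel_measurable borel"
    by (rule spin_harm_ext_measurable_borel[OF s])
  have "h \<in> borel_measurable borel" unfolding h_def by measurable
  then have "h \<in> borel_measurable sph_measure" by (rule measurable_sph_measureI)
  moreover have "spin_harm s l m x = h x" if "x \<in> space sph_measure" for x
  proof -
    have "fst x = 0 \<or> fst x = pi \<or> (0 < fst x \<and> fst x < pi)"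
      using that by (auto simp: space_sph_measure sph_dom_def mem_Times_iff)
    then show ?thesis using spin_harm_eq_ext[OF s m, of x] by (cases x) (auto simp: h_def)
  qed
  ultimately show ?thesis by (subst measurable_cong) auto
qed

section \<open>The rotated wavelet as a function of the rotation\<close>

context haar
begin

text \<open>The argument is the inverse of the product of the inverse of B and A, so left invariance
  and invariance under inversion suffice.\<close>

lemma nn_integral_transpose_mult:
  assumes F: "F \<in> borel_measurable \<nu>" and B: "B \<in> SO3"
  shows "(\<integral>\<^sup>+A. F (transpose A ** B) \<partial>\<nu>) = (\<integral>\<^sup>+A. F A \<partial>\<nu>)"
proof -
  have tr: "transpose \<in> measurable \<nu> \<nu>"
    using measurable_SO3_transpose[OF measurable_ident_sets[OF sets_haar]]
    by (simp add: measurable_cong_sets[OF refl sets_haar])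
  have G: "(\<lambda>A. F (transpose A)) \<in> borel_measurable \<nu>"
    by (rule measurable_compose[OF tr F])
  have "(\<integral>\<^sup>+A. F (transpose A ** B) \<partial>\<nu>) = (\<integral>\<^sup>+A. F (transpose (transpose B ** A)) \<partial>\<nu>)"
    by (simp add: matrix_transpose_mul)
  also have "\<dots> = (\<integral>\<^sup>+A. F (transpose A) \<partial>\<nu>)"
    by (rule nn_integral_left_mult[OF SO3_transpose[OF B] G])
  also have "\<dots> = (\<integral>\<^sup>+A. F A \<partial>\<nu>)" by (rule nn_integral_transpose[OF F])
  finally show ?thesis .
qed

lemma rotate_spin_measurable_pair:
  assumes f: "f \<in> borel_measurable sph_measure"
  shows "(\<lambda>z. rotate_spin s (fst z) f (snd z)) \<in> borel_measurable (\<nu> \<Otimes>\<^sub>M sph_measure)"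
proof (subst measurable_cong)
  show "rotate_spin s (fst z) f (snd z) = lift_spin s f (transpose (fst z) ** frame (snd z))"
    if "z \<in> space (\<nu> \<Otimes>\<^sub>M sph_measure)" for z
    using that by (intro rotate_spin_eq_lift) (auto simp: space_pair_measure space_haar)
  have "fst \<in> measurable (\<nu> \<Otimes>\<^sub>M sph_measure) SO3_borel"
    using measurable_fst[of \<nu> sph_measure] by (simp add: measurable_cong_sets[OF refl sets_haar])
  moreover have "(\<lambda>z. frame (snd z)) \<in> measurable (\<nu> \<Otimes>\<^sub>M sph_measure) SO3_borel"
    by (rule measurable_compose[OF measurable_snd frame_measurable])
  ultimately have "(\<lambda>z. transpose (fst z) ** frame (snd z)) \<in> measurable (\<nu> \<Otimes>\<^sub>M sph_measure) SO3_borel"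
    by (intro measurable_SO3_mult measurable_SO3_transpose)
  then show "(\<lambda>z. lift_spin s f (transpose (fst z) ** frame (snd z))) \<in> borel_measurable (\<nu> \<Otimes>\<^sub>M sph_measure)"
    by (rule measurable_compose[OF _ lift_spin_measurable[OF f]])
qed

lemma rotate_spin_measurable_haar:
  assumes f: "f \<in> borel_measurable sph_measure"
  shows "(\<lambda>A. rotate_spin s A f x) \<in> borel_measurable \<nu>"
proof (subst measurable_cong)
  show "rotate_spin s A f x = lift_spin s f (transpose A ** frame x)" if "A \<in> space \<nu>" for A
    using that by (intro rotate_spin_eq_lift) (simp add: space_haar)
  have "(\<lambda>A. frame x) \<in> measurable \<nu> SO3_borel" using euler_SO3 by (simp add: space_restrict_space)
  then have "(\<lambda>A. transpose A ** frame x) \<in> measurable \<nu> SO3_borel"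
    by (intro measurable_SO3_mult measurable_SO3_transpose) (rule measurable_ident_sets[OF sets_haar])
  then show "(\<lambda>A. lift_spin s f (transpose A ** frame x)) \<in> borel_measurable \<nu>"
    by (rule measurable_compose[OF _ lift_spin_measurable[OF f]])
qed

text \<open>The left-hand side does not depend on x, so it is its mean value over the sphere.\<close>

lemma nn_integral_rotate_spin:
  assumes f: "f \<in> L2_sphere"
  shows "(\<integral>\<^sup>+A. ennreal ((cmod (rotate_spin s A f x))\<^sup>2) \<partial>\<nu>) = ennreal (2 * pi * (norm_L2 sph_measure f)\<^sup>2)"
proof -
  interpret P: pair_sigma_finite \<nu> sph_measure
    by (intro pair_sigma_finite.intro) unfold_locales
  have fm [measurable]: "f \<in> borel_measurable sph_measure" using f by (simp add: L2_sphere_def)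
  define c where "c = (\<integral>\<^sup>+A. ennreal ((cmod (lift_spin s f A))\<^sup>2) \<partial>\<nu>)"
  have lm: "lift_spin s f \<in> borel_measurable \<nu>"
    using lift_spin_measurable[OF fm] by (simp add: measurable_cong_sets[OF sets_haar refl])
  have const: "(\<integral>\<^sup>+A. ennreal ((cmod (rotate_spin s A f x))\<^sup>2) \<partial>\<nu>) = c" for x
  proof -
    have "(\<integral>\<^sup>+A. ennreal ((cmod (rotate_spin s A f x))\<^sup>2) \<partial>\<nu>) = (\<integral>\<^sup>+A. ennreal ((cmod (lift_spin s f (transpose A ** frame x)))\<^sup>2) \<partial>\<nu>)"
      by (intro nn_integral_cong) (simp add: rotate_spin_eq_lift space_haar)
    also have "\<dots> = c" unfolding c_def
      using lm by (intro nn_integral_transpose_mult[where F = "\<lambda>A. ennreal ((cmod (lift_spin s f A))\<^sup>2)"] euler_SO3) measurable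
    finally show ?thesis .
  qed
  have m: "(\<lambda>z. ennreal ((cmod (rotate_spin s (fst z) f (snd z)))\<^sup>2)) \<in> borel_measurable (\<nu> \<Otimes>\<^sub>M sph_measure)"
    using rotate_spin_measurable_pair[OF fm] by measurable
  have "c * ennreal (4 * pi) = (\<integral>\<^sup>+x. c \<partial>sph_measure)"
    using measure_sph by (simp add: sph.emeasure_eq_measure)
  also have "\<dots> = (\<integral>\<^sup>+x. \<integral>\<^sup>+A. ennreal ((cmod (rotate_spin s A f x))\<^sup>2) \<partial>\<nu> \<partial>sph_measure)"
    by (simp only: const)
  also have "\<dots> = (\<integral>\<^sup>+A. \<integral>\<^sup>+x. ennreal ((cmod (rotate_spin s A f x))\<^sup>2) \<partial>sph_measure \<partial>\<nu>)"
    using P.Fubini[OF m] by simp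
  also have "\<dots> = (\<integral>\<^sup>+A. ennreal ((norm_L2 sph_measure f)\<^sup>2) \<partial>\<nu>)"
  proof (rule nn_integral_cong)
    fix A assume "A \<in> space \<nu>"
    then have A: "A \<in> SO3" by (simp add: space_haar)
    show "(\<integral>\<^sup>+x. ennreal ((cmod (rotate_spin s A f x))\<^sup>2) \<partial>sph_measure) = ennreal ((norm_L2 sph_measure f)\<^sup>2)"
      using nn_integral_L2[of "rotate_spin s A f" sph_measure] rotate_spin_L2[OF A f] by (simp add: L2_sphere_eq)
  qed
  also have "\<dots> = ennreal ((norm_L2 sph_measure f)\<^sup>2 * (8 * pi\<^sup>2))"
    by (simp add: emeasure_haar ennreal_mult')
  also have "\<dots> = ennreal (2 * pi * (norm_L2 sph_measure f)\<^sup>2) * ennreal (4 * pi)"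
    by (subst ennreal_mult[symmetric]) (auto simp: power2_eq_square mult_ac)
  finally have "c = ennreal (2 * pi * (norm_L2 sph_measure f)\<^sup>2)"
    by (simp add: ennreal_mult_cancel_left mult.commute[of _ "ennreal (4 * pi)"])
  then show ?thesis using const by simp
qed

lemma rotate_spin_L2_haar:
  assumes f: "f \<in> L2_sphere"
  shows "(\<lambda>A. rotate_spin s A f x) \<in> L2_space \<nu>"
    and "norm_L2 \<nu> (\<lambda>A. rotate_spin s A f x) = sqrt (2 * pi) * norm_L2 sph_measure f"
proof -
  have "f \<in> borel_measurable sph_measure" using f by (simp add: L2_sphere_def)
  from rotate_spin_measurable_haar[OF this]
  have [measurable]: "(\<lambda>A. rotate_spin s A f x) \<in> borel_measurable \<nu>" .
  have "integrable \<nu> (\<lambda>A. (cmod (rotate_spin s A f x))\<^sup>2)"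
    using nn_integral_rotate_spin[OF f, of s x] by (intro integrableI_bounded) auto
  then show L: "(\<lambda>A. rotate_spin s A f x) \<in> L2_space \<nu>" by (simp add: L2_space_def)
  have "(norm_L2 \<nu> (\<lambda>A. rotate_spin s A f x))\<^sup>2 = 2 * pi * (norm_L2 sph_measure f)\<^sup>2"
    using nn_integral_L2[OF L] nn_integral_rotate_spin[OF f, of s x] by simp
  then show "norm_L2 \<nu> (\<lambda>A. rotate_spin s A f x) = sqrt (2 * pi) * norm_L2 sph_measure f"
    by (metis norm_L2_nonneg real_sqrt_mult real_sqrt_unique)
qed

end

lemma rotate_spin_diff: "rotate_spin s A (\<lambda>x. f x - g x) y = rotate_spin s A f y - rotate_spin s A g y"
  unfolding rotate_spin_def by (simp add: case_prod_unfold right_diff_distrib)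

lemma rotate_spin_sum: "rotate_spin s A (\<lambda>x. \<Sum>i\<in>I. c i * f i x) y = (\<Sum>i\<in>I. c i * rotate_spin s A (f i) y)"
  unfolding rotate_spin_def case_prod_unfold sum_distrib_left by (intro sum.cong refl) (simp add: mult_ac)

section \<open>Analysis and reconstruction with a single wavelet\<close>

context haar_spin
begin

text \<open>The wavelet transform at one scale, as a function of the wavelet, so that the wavelet
  can be approximated by finite sums of harmonics.\<close>

definition analysis :: "(sph \<Rightarrow> complex) \<Rightarrow> (sph \<Rightarrow> complex) \<Rightarrow> real^3^3 \<Rightarrow> complex" where
  "analysis f \<psi> A = sprod (rotate_spin s A \<psi>) f"

definition reconstruct :: "(sph \<Rightarrow> complex) \<Rightarrow> (sph \<Rightarrow> complex) \<Rightarrow> sph \<Rightarrow> complex" where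
  "reconstruct f \<psi> x = (LINT A|\<nu>. rotate_spin s A \<psi> x * analysis f \<psi> A)"

lemma synthesis_eq: "synthesis s \<nu> \<Psi> f \<rho> = reconstruct f (\<Psi> \<rho>)"
  by (simp add: fun_eq_iff synthesis_def reconstruct_def analysis_def wavelet_transform_def sprod_def)

lemma analysis_measurable:
  assumes f: "f \<in> L2_sphere" and \<psi>: "\<psi> \<in> L2_sphere"
  shows "analysis f \<psi> \<in> borel_measurable \<nu>"
proof -
  have [measurable]: "f \<in> borel_measurable sph_measure" using f by (simp add: L2_sphere_def)
  have "\<psi> \<in> borel_measurable sph_measure" using \<psi> by (simp add: L2_sphere_def)
  from rotate_spin_measurable_pair[OF this]
  have [measurable]: "(\<lambda>z. rotate_spin s (fst z) \<psi> (snd z)) \<in> borel_measurable (\<nu> \<Otimes>\<^sub>M sph_measure)" .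
  have "(\<lambda>z. cnj (rotate_spin s (fst z) \<psi> (snd z)) * f (snd z)) \<in> borel_measurable (\<nu> \<Otimes>\<^sub>M sph_measure)"
    by measurable
  then have "(\<lambda>A. LINT x|sph_measure. cnj (rotate_spin s A \<psi> x) * f x) \<in> borel_measurable \<nu>"
    by (intro sph.borel_measurable_lebesgue_integral) (simp add: case_prod_unfold)
  then show ?thesis by (simp add: analysis_def[abs_def] sprod_def)
qed

lemma analysis_bound:
  assumes "A \<in> SO3" "f \<in> L2_sphere" "\<psi> \<in> L2_sphere"
  shows "cmod (analysis f \<psi> A) \<le> norm_L2 sph_measure \<psi> * norm_L2 sph_measure f"
  using L2_Cauchy_Schwarz[of "rotate_spin s A \<psi>" sph_measure f] rotate_spin_L2[OF assms(1,3)] assms(2)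
  by (simp add: analysis_def sprod_def L2_sphere_eq)

lemma analysis_diff:
  assumes "A \<in> SO3" "f \<in> L2_sphere" "\<psi> \<in> L2_sphere" "\<phi> \<in> L2_sphere"
  shows "analysis f (\<lambda>x. \<psi> x - \<phi> x) A = analysis f \<psi> A - analysis f \<phi> A"
proof -
  have "integrable sph_measure (\<lambda>x. cnj (rotate_spin s A \<psi> x) * f x)" "integrable sph_measure (\<lambda>x. cnj (rotate_spin s A \<phi> x) * f x)"
    using rotate_spin_L2(1)[OF assms(1)] assms by (auto intro!: L2_mult_integrable simp: L2_sphere_eq)
  then show ?thesis by (simp add: analysis_def sprod_def rotate_spin_diff left_diff_distrib)
qed

text \<open>The second factor is bounded on SO(3) by Cauchy-Schwarz on the sphere. The first one, as
  a function of the rotation, has L2 norm sqrt(2 pi) times that of the wavelet at every x.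
  Cauchy-Schwarz on SO(3) then gives a bound independent of x.\<close>

lemma rotate_spin_analysis_bound:
  assumes f: "f \<in> L2_sphere" and \<psi>: "\<psi> \<in> L2_sphere" and \<phi>: "\<phi> \<in> L2_sphere"
  shows "integrable \<nu> (\<lambda>A. rotate_spin s A \<psi> x * analysis f \<phi> A)"
    and "cmod (LINT A|\<nu>. rotate_spin s A \<psi> x * analysis f \<phi> A) \<le>
      (norm_L2 \<nu> (\<lambda>_. 1) * sqrt (2 * pi) * norm_L2 sph_measure f) * (norm_L2 sph_measure \<psi> * norm_L2 sph_measure \<phi>)"
proof -
  define C where "C = norm_L2 sph_measure \<phi> * norm_L2 sph_measure f"
  have one: "(\<lambda>_. 1) \<in> L2_space \<nu>" by (simp add: L2_space_def)
  note U = rotate_spin_L2_haar[OF \<psi>, of s x]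
  have i: "integrable \<nu> (\<lambda>A. C * cmod (rotate_spin s A \<psi> x))"
    using L2_mult_integrable(2)[OF one U(1)] by simp
  have b: "norm (rotate_spin s A \<psi> x * analysis f \<phi> A) \<le> C * cmod (rotate_spin s A \<psi> x)" if "A \<in> space \<nu>" for A
    using analysis_bound[OF _ f \<phi>, of A] that
    by (simp add: norm_mult C_def space_haar mult.commute[of "cmod (rotate_spin s A \<psi> x)"] mult_right_mono)
  show int: "integrable \<nu> (\<lambda>A. rotate_spin s A \<psi> x * analysis f \<phi> A)"
  proof (rule Bochner_Integration.integrable_bound[OF i])
    show "(\<lambda>A. rotate_spin s A \<psi> x * analysis f \<phi> A) \<in> borel_measurable \<nu>"
      using L2_measurable[OF U(1)] analysis_measurable[OF f \<phi>] by measurable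
    show "AE A in \<nu>. norm (rotate_spin s A \<psi> x * analysis f \<phi> A) \<le> norm (C * cmod (rotate_spin s A \<psi> x))"
      using b by (intro AE_I2) (metis order.trans abs_ge_self real_norm_def)
  qed
  have "cmod (LINT A|\<nu>. rotate_spin s A \<psi> x * analysis f \<phi> A) \<le> (LINT A|\<nu>. norm (rotate_spin s A \<psi> x * analysis f \<phi> A))"
    by (rule integral_norm_bound)
  also have "\<dots> \<le> (LINT A|\<nu>. C * cmod (rotate_spin s A \<psi> x))"
    using int i b by (intro integral_mono) auto
  also have "\<dots> = C * (LINT A|\<nu>. cmod 1 * cmod (rotate_spin s A \<psi> x))" by simp
  also have "\<dots> \<le> C * (norm_L2 \<nu> (\<lambda>_. 1) * norm_L2 \<nu> (\<lambda>A. rotate_spin s A \<psi> x))"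
    using L2_Cauchy_Schwarz_abs[OF one U(1)] by (intro mult_left_mono) (auto simp: C_def norm_L2_nonneg)
  finally show "cmod (LINT A|\<nu>. rotate_spin s A \<psi> x * analysis f \<phi> A) \<le>
      (norm_L2 \<nu> (\<lambda>_. 1) * sqrt (2 * pi) * norm_L2 sph_measure f) * (norm_L2 sph_measure \<psi> * norm_L2 sph_measure \<phi>)"
    by (simp add: U(2) C_def mult_ac)
qed

text \<open>The wavelet enters twice, so the difference is split into two terms, each with one copy
  of psi - phi. The bound is uniform in x and makes approximation of the wavelet in L2 visible at
  every single point.\<close>

lemma reconstruct_diff_bound:
  assumes f: "f \<in> L2_sphere" and \<psi>: "\<psi> \<in> L2_sphere" and \<phi>: "\<phi> \<in> L2_sphere"
  shows "cmod (reconstruct f \<psi> x - reconstruct f \<phi> x) \<le>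
    (norm_L2 \<nu> (\<lambda>_. 1) * sqrt (2 * pi) * norm_L2 sph_measure f) *
      (norm_L2 sph_measure (\<lambda>x. \<psi> x - \<phi> x) * (norm_L2 sph_measure \<psi> + norm_L2 sph_measure \<phi>))"
proof -
  define K where "K = norm_L2 \<nu> (\<lambda>_. 1) * sqrt (2 * pi) * norm_L2 sph_measure f"
  define \<eta> where "\<eta> = (\<lambda>x. \<psi> x - \<phi> x)"
  have \<eta>: "\<eta> \<in> L2_sphere" using L2_diff \<psi> \<phi> by (simp add: \<eta>_def L2_sphere_eq)
  note i = rotate_spin_analysis_bound(1)[OF f]
  have "reconstruct f \<psi> x - reconstruct f \<phi> x =
    (LINT A|\<nu>. rotate_spin s A \<psi> x * analysis f \<psi> A - rotate_spin s A \<phi> x * analysis f \<phi> A)"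
    using i \<psi> \<phi> by (simp add: reconstruct_def)
  also have "\<dots> = (LINT A|\<nu>. rotate_spin s A \<eta> x * analysis f \<psi> A + rotate_spin s A \<phi> x * analysis f \<eta> A)"
    using f \<psi> \<phi> by (intro Bochner_Integration.integral_cong refl)
      (simp add: \<eta>_def rotate_spin_diff analysis_diff space_haar algebra_simps)
  also have "\<dots> = (LINT A|\<nu>. rotate_spin s A \<eta> x * analysis f \<psi> A) + (LINT A|\<nu>. rotate_spin s A \<phi> x * analysis f \<eta> A)"
    using i \<psi> \<phi> \<eta> by simp
  finally have e: "reconstruct f \<psi> x - reconstruct f \<phi> x =
    (LINT A|\<nu>. rotate_spin s A \<eta> x * analysis f \<psi> A) + (LINT A|\<nu>. rotate_spin s A \<phi> x * analysis f \<eta> A)" .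
  have "cmod (reconstruct f \<psi> x - reconstruct f \<phi> x) \<le>
     K * (norm_L2 sph_measure \<eta> * norm_L2 sph_measure \<psi>) + K * (norm_L2 sph_measure \<phi> * norm_L2 sph_measure \<eta>)"
    using rotate_spin_analysis_bound(2)[OF f \<eta> \<psi>, of x] rotate_spin_analysis_bound(2)[OF f \<phi> \<eta>, of x]
    unfolding K_def[symmetric] e by (rule order.trans[OF norm_triangle_ineq add_mono])
  then show ?thesis unfolding K_def[symmetric] \<eta>_def[symmetric] by (simp add: algebra_simps)
qed

definition gain :: "nat \<Rightarrow> (sph \<Rightarrow> complex) \<Rightarrow> real" where
  "gain k \<psi> = 8 * pi\<^sup>2 / (2 * real (deg k) + 1) * power_spec k \<psi>"

lemma gain_nonneg: "0 \<le> gain k \<psi>"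
  by (simp add: gain_def power_spec_nonneg)

lemma gain_le:
  assumes "\<psi> \<in> L2_sphere"
  shows "gain k \<psi> \<le> 8 * pi\<^sup>2 * (norm_L2 sph_measure \<psi>)\<^sup>2"
proof -
  have "power_spec k \<psi> \<le> (\<Sum>i<Suc k. power_spec i \<psi>)"
    by (intro member_le_sum) (auto simp: power_spec_nonneg)
  also have "\<dots> \<le> (norm_L2 sph_measure \<psi>)\<^sup>2" by (rule Bessel[OF assms])
  finally have "gain k \<psi> \<le> 8 * pi\<^sup>2 / (2 * real (deg k) + 1) * (norm_L2 sph_measure \<psi>)\<^sup>2"
    unfolding gain_def by (intro mult_left_mono) auto
  also have "\<dots> \<le> 8 * pi\<^sup>2 / 1 * (norm_L2 sph_measure \<psi>)\<^sup>2"
    by (intro mult_right_mono divide_left_mono) auto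
  finally show ?thesis by simp
qed

text \<open>For a finite sum of harmonics, analysis and rotated wavelet are finite sums of matrix
  coefficients. Orthogonality reduces their double sum to the diagonal, which factors into the power
  of the wavelet in degree k and the component of f.\<close>

lemma reconstruct_multiplier_sum:
  assumes f: "f \<in> L2_sphere"
  shows "reconstruct f (multiplier_sum (\<lambda>_. 1) L \<psi>) x = multiplier_sum (\<lambda>k. of_real (gain k \<psi>)) L f x"
proof -
  \<comment> \<open>Multi-indices (k, j, i): the degree, the order of the wavelet coefficient, and
    the order of the harmonic after rotation, which is also that of the coefficient of f.\<close>
  define T where "T = (SIGMA k:{..<L}. {..2 * deg k} \<times> {..2 * deg k})"
  have T: "finite T" by (simp add: T_def)
  define D where "D t A = (case t of (k, j, i) \<Rightarrow> wigner (deg k) i j A)" for t A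
  define p where "p t = (case t of (k, j, i) \<Rightarrow> coef k j \<psi>)" for t :: "nat \<times> nat \<times> nat"
  define e where "e t = (case t of (k, j, i) \<Rightarrow> basis_harm k i)" for t :: "nat \<times> nat \<times> nat"
  define q where "q t = (case t of (k, j, i) \<Rightarrow> coef k i f)" for t :: "nat \<times> nat \<times> nat"
  have sumT: "(\<Sum>t\<in>T. h t) = (\<Sum>k<L. \<Sum>j\<le>2 * deg k. \<Sum>i\<le>2 * deg k. h (k, j, i))" for h :: "nat \<times> nat \<times> nat \<Rightarrow> complex"
  proof -
    have "(\<Sum>k<L. \<Sum>j\<le>2 * deg k. \<Sum>i\<le>2 * deg k. h (k, j, i)) = (\<Sum>k<L. \<Sum>z\<in>{..2 * deg k} \<times> {..2 * deg k}. h (k, z))"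
      by (simp add: sum.cartesian_product case_prod_unfold)
    also have "\<dots> = (\<Sum>t\<in>T. h t)"
      unfolding T_def by (subst sum.Sigma) (auto simp: case_prod_unfold)
    finally show ?thesis ..
  qed
  have eL: "e t \<in> L2_sphere" if "t \<in> T" for t using that by (auto simp: T_def e_def intro: basis_harm_L2)
  have rot: "rotate_spin s A (multiplier_sum (\<lambda>_. 1) L \<psi>) y = (\<Sum>t\<in>T. (p t * cnj (D t A)) * e t y)" if A: "A \<in> SO3" for A y
  proof -
    have "rotate_spin s A (multiplier_sum (\<lambda>_. 1) L \<psi>) y = (\<Sum>k<L. \<Sum>j\<le>2 * deg k. coef k j \<psi> * rotate_spin s A (basis_harm k j) y)"
      unfolding multiplier_sum_def[abs_def] rotate_spin_sum proj_def[abs_def] by simp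
    also have "\<dots> = (\<Sum>k<L. \<Sum>j\<le>2 * deg k. \<Sum>i\<le>2 * deg k. coef k j \<psi> * cnj (wigner (deg k) i j A) * basis_harm k i y)"
      unfolding basis_harm_def by (intro sum.cong refl) (simp add: rotate_spin_harm_ext[OF A deg_ge] sum_distrib_left mult_ac)
    finally show ?thesis unfolding sumT by (simp add: p_def D_def e_def)
  qed
  have an: "analysis f (multiplier_sum (\<lambda>_. 1) L \<psi>) A = (\<Sum>t\<in>T. cnj (p t) * q t * D t A)" if A: "A \<in> SO3" for A
  proof -
    have "analysis f (multiplier_sum (\<lambda>_. 1) L \<psi>) A = sprod (\<lambda>y. \<Sum>t\<in>T. (p t * cnj (D t A)) * e t y) f"
      unfolding analysis_def rot[OF A, abs_def] ..
    also have "\<dots> = (\<Sum>t\<in>T. cnj (p t * cnj (D t A)) * sprod (e t) f)"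
      by (rule sprod_sum_left[OF f eL])
    also have "\<dots> = (\<Sum>t\<in>T. cnj (p t) * q t * D t A)"
      by (intro sum.cong refl) (auto simp: e_def q_def coef_def)
    finally show ?thesis .
  qed
  have int: "integrable \<nu> (\<lambda>A. cnj (D t A) * D t' A)" if "t \<in> T" "t' \<in> T" for t t'
    using that by (auto simp: T_def D_def intro!: integrable_wigner_mult)
  have orth: "(LINT A|\<nu>. cnj (D t A) * D t' A) = (if t = t' then of_real (8 * pi\<^sup>2 / (2 * real (deg (fst t)) + 1)) else 0)"
    if "t \<in> T" "t' \<in> T" for t t'
  proof -
    obtain k j i k' j' i' where t: "t = (k, j, i)" "t' = (k', j', i')" by (metis prod_cases3)
    have "deg k = deg k' \<longleftrightarrow> k = k'" for k k' by (simp add: deg_def)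
    then show ?thesis using that unfolding t T_def D_def by (auto simp: wigner_orthogonality)
  qed
  have "reconstruct f (multiplier_sum (\<lambda>_. 1) L \<psi>) x =
    (LINT A|\<nu>. (\<Sum>t\<in>T. \<Sum>t'\<in>T. (p t * e t x * (cnj (p t') * q t')) * (cnj (D t A) * D t' A)))"
    unfolding reconstruct_def
  proof (intro Bochner_Integration.integral_cong refl)
    fix A assume "A \<in> space \<nu>"
    then have A: "A \<in> SO3" by (simp add: space_haar)
    show "rotate_spin s A (multiplier_sum (\<lambda>_. 1) L \<psi>) x * analysis f (multiplier_sum (\<lambda>_. 1) L \<psi>) A =
        (\<Sum>t\<in>T. \<Sum>t'\<in>T. (p t * e t x * (cnj (p t') * q t')) * (cnj (D t A) * D t' A))"
      unfolding rot[OF A] an[OF A] sum_product by (intro sum.cong refl) (simp only: mult_ac)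
  qed
  also have "\<dots> = (\<Sum>t\<in>T. \<Sum>t'\<in>T. (p t * e t x * (cnj (p t') * q t')) * (LINT A|\<nu>. cnj (D t A) * D t' A))"
    using int by (subst Bochner_Integration.integral_sum, force)
      (intro sum.cong refl, subst Bochner_Integration.integral_sum, auto)
  also have "\<dots> = (\<Sum>t\<in>T. (p t * e t x * (cnj (p t) * q t)) * of_real (8 * pi\<^sup>2 / (2 * real (deg (fst t)) + 1)))"
  proof (intro sum.cong refl)
    fix t assume t: "t \<in> T"
    have "(\<Sum>t'\<in>T. (p t * e t x * (cnj (p t') * q t')) * (LINT A|\<nu>. cnj (D t A) * D t' A)) =
      (\<Sum>t'\<in>T. if t' = t then (p t * e t x * (cnj (p t) * q t)) * of_real (8 * pi\<^sup>2 / (2 * real (deg (fst t)) + 1)) else 0)"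
      using t by (intro sum.cong refl) (auto simp: orth)
    then show "(\<Sum>t'\<in>T. (p t * e t x * (cnj (p t') * q t')) * (LINT A|\<nu>. cnj (D t A) * D t' A)) =
      (p t * e t x * (cnj (p t) * q t)) * of_real (8 * pi\<^sup>2 / (2 * real (deg (fst t)) + 1))"
      using t T by simp
  qed
  also have "\<dots> = (\<Sum>k<L. of_real (8 * pi\<^sup>2 / (2 * real (deg k) + 1)) *
      ((\<Sum>j\<le>2 * deg k. coef k j \<psi> * cnj (coef k j \<psi>)) * (\<Sum>i\<le>2 * deg k. coef k i f * basis_harm k i x)))"
    unfolding sumT sum_product unfolding sum_distrib_left
    by (intro sum.cong refl) (simp add: p_def e_def q_def mult_ac)
  also have "\<dots> = multiplier_sum (\<lambda>k. of_real (gain k \<psi>)) L f x"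
    unfolding multiplier_sum_def proj_def gain_def power_spec_def of_real_mult of_real_sum complex_norm_square
    by (simp only: mult.assoc)
  finally show ?thesis .
qed

text \<open>The truncated wavelets converge in L2, and the bound on differences of reconstructions
  is uniform in x. Hence this multiplier series converges at every point, not merely in
  norm.\<close>

lemma reconstruct_pointwise:
  assumes f: "f \<in> L2_sphere" and \<psi>: "\<psi> \<in> L2_sphere"
  shows "(\<lambda>L. multiplier_sum (\<lambda>k. of_real (gain k \<psi>)) L f x) \<longlonglongrightarrow> reconstruct f \<psi> x"
proof (rule LIM_zero_cancel, rule Lim_null_comparison)
  define K where "K = norm_L2 \<nu> (\<lambda>_. 1) * sqrt (2 * pi) * norm_L2 sph_measure f"
  let ?\<phi> = "\<lambda>L. multiplier_sum (\<lambda>_. 1) L \<psi>" and ?n = "norm_L2 sph_measure"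
  have n: "?n (?\<phi> L) \<le> ?n \<psi>" for L
  proof (rule power2_le_imp_le[OF _ norm_L2_nonneg])
    have "(?n (?\<phi> L))\<^sup>2 = (\<Sum>k<L. power_spec k \<psi>)"
      unfolding multiplier_sum_def[abs_def] by (subst norm_proj_sum) auto
    then show "(?n (?\<phi> L))\<^sup>2 \<le> (?n \<psi>)\<^sup>2" using Bessel[OF \<psi>] by simp
  qed
  have "norm (multiplier_sum (\<lambda>k. of_real (gain k \<psi>)) L f x - reconstruct f \<psi> x) \<le>
      K * (?n (\<lambda>x. ?\<phi> L x - \<psi> x) * (2 * ?n \<psi>))" for L
  proof -
    have "norm (multiplier_sum (\<lambda>k. of_real (gain k \<psi>)) L f x - reconstruct f \<psi> x) \<le>
       K * (?n (\<lambda>x. ?\<phi> L x - \<psi> x) * (?n (?\<phi> L) + ?n \<psi>))"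
      using reconstruct_diff_bound[OF f multiplier_sum_L2[of "\<lambda>_. 1" L \<psi>] \<psi>, of x] by (simp add: reconstruct_multiplier_sum[OF f] K_def)
    also have "\<dots> \<le> K * (?n (\<lambda>x. ?\<phi> L x - \<psi> x) * (2 * ?n \<psi>))"
      using n[of L] by (intro mult_left_mono) (auto simp: norm_L2_nonneg K_def)
    finally show ?thesis .
  qed
  then show "\<forall>\<^sub>F L in sequentially. norm (multiplier_sum (\<lambda>k. of_real (gain k \<psi>)) L f x - reconstruct f \<psi> x) \<le>
      K * (?n (\<lambda>x. ?\<phi> L x - \<psi> x) * (2 * ?n \<psi>))" by simp
  show "(\<lambda>L. K * (?n (\<lambda>x. ?\<phi> L x - \<psi> x) * (2 * ?n \<psi>))) \<longlonglongrightarrow> 0"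
    by (intro tendsto_mult_right_zero tendsto_mult_left_zero expansion[OF \<psi>])
qed

text \<open>The gains are bounded, so the series also converges in L2; the limit in norm and the
  pointwise limit agree almost everywhere.\<close>

lemma reconstruct_L2:
  assumes f: "f \<in> L2_sphere" and \<psi>: "\<psi> \<in> L2_sphere"
  shows "reconstruct f \<psi> \<in> L2_sphere"
    and "h \<in> L2_sphere \<Longrightarrow> (\<lambda>k. of_real (gain k \<psi>) * sprod h (proj k f)) sums sprod h (reconstruct f \<psi>)"
proof -
  let ?c = "\<lambda>k. complex_of_real (gain k \<psi>)"
  obtain F where F: "F \<in> L2_sphere" "(\<lambda>L. norm_L2 sph_measure (\<lambda>x. multiplier_sum ?c L f x - F x)) \<longlonglongrightarrow> 0"
  proof -
    have "cmod (?c k) \<le> 8 * pi\<^sup>2 * (norm_L2 sph_measure \<psi>)\<^sup>2" for k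
      using gain_le[OF \<psi>, of k] gain_nonneg[of k \<psi>] by simp
    then show ?thesis by (rule multiplier_limit[OF f]) (rule that)
  qed
  have [measurable]: "multiplier_sum ?c L f \<in> borel_measurable sph_measure" for L
    using multiplier_sum_L2 by (simp add: L2_sphere_def)
  have m: "reconstruct f \<psi> \<in> borel_measurable sph_measure"
    by (rule borel_measurable_LIMSEQ_metric[of "\<lambda>L. multiplier_sum ?c L f"]) (use reconstruct_pointwise[OF f \<psi>] in auto)
  have AE: "AE x in sph_measure. F x = reconstruct f \<psi> x"
    using multiplier_sum_L2 F reconstruct_pointwise[OF f \<psi>] m
    by (intro L2_limit_unique[of "\<lambda>L. multiplier_sum ?c L f"]) (auto simp: L2_sphere_eq)
  have Fm: "F \<in> borel_measurable sph_measure" using F(1) by (simp add: L2_sphere_def)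
  have "integrable sph_measure (\<lambda>x. (cmod (reconstruct f \<psi> x))\<^sup>2)"
    using F(1) AE m Fm by (subst integrable_cong_AE[of _ _ "\<lambda>x. (cmod (F x))\<^sup>2"]) (auto simp: L2_sphere_def)
  then show "reconstruct f \<psi> \<in> L2_sphere" using m by (simp add: L2_sphere_def)
  assume h: "h \<in> L2_sphere"
  then have hm: "h \<in> borel_measurable sph_measure" by (simp add: L2_sphere_def)
  have "sprod h F = sprod h (reconstruct f \<psi>)"
    unfolding sprod_def using AE m Fm hm by (intro integral_cong_AE) auto
  then show "(\<lambda>k. of_real (gain k \<psi>) * sprod h (proj k f)) sums sprod h (reconstruct f \<psi>)"
    using multiplier_limit_sprod[OF f F(1) h F(2)] by simp
qed

text \<open>The given harmonics and the extended ones differ by a sign off the poles, which does not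
  affect the modulus.\<close>

lemma norm_fourier_coeff:
  assumes "\<bar>m\<bar> \<le> int (deg k)" "f \<in> L2_sphere"
  shows "cmod (fourier_coeff s f (deg k) m) = cmod (coef k (nat (int (deg k) + m)) f)"
proof -
  define j where "j = nat (int (deg k) + m)"
  have j: "j \<le> 2 * deg k" using assms(1) by (simp add: j_def)
  have fm: "f \<in> borel_measurable sph_measure" and bm: "basis_harm k j \<in> borel_measurable sph_measure"
    using assms(2) basis_harm_L2[OF j] by (auto simp: L2_sphere_def)
  have AE: "AE x in sph_measure. spin_harm s (deg k) m x = harm_sign m * basis_harm k j x"
    using AE_sph_interior by eventually_elim (simp add: basis_harm_def j_def spin_harm_eq_ext[OF deg_ge assms(1)])
  have "fourier_coeff s f (deg k) m = (LINT x|sph_measure. cnj (harm_sign m) * (cnj (basis_harm k j x) * f x))"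
    unfolding fourier_coeff_def sprod_def
  proof (rule integral_cong_AE)
    show "(\<lambda>x. cnj (spin_harm s (deg k) m x) * f x) \<in> borel_measurable sph_measure"
      using spin_harm_measurable[OF deg_ge assms(1)] fm by measurable
    show "(\<lambda>x. cnj (harm_sign m) * (cnj (basis_harm k j x) * f x)) \<in> borel_measurable sph_measure"
      using bm fm by measurable
    show "AE x in sph_measure. cnj (spin_harm s (deg k) m x) * f x = cnj (harm_sign m) * (cnj (basis_harm k j x) * f x)"
      using AE by eventually_elim simp
  qed
  then have "fourier_coeff s f (deg k) m = cnj (harm_sign m) * coef k j f"
    by (simp add: coef_def sprod_def)
  moreover have "cmod (harm_sign m) = 1" by (simp add: harm_sign_def norm_power)
  ultimately show ?thesis by (simp add: norm_mult j_def)
qed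

end

section \<open>Integration over the scales\<close>

lemma sigma_finite_completion:
  assumes "sigma_finite_measure M"
  shows "sigma_finite_measure (completion M)"
proof -
  interpret sigma_finite_measure M by fact
  obtain A :: "nat \<Rightarrow> _" where "range A \<subseteq> sets M" "(\<Union>i. A i) = space M" "\<And>i. emeasure M (A i) \<noteq> \<infinity>"
    using sigma_finite by blast
  then show ?thesis
    by (intro sigma_finite_measure.intro exI[of _ "range A"]) (auto simp: range_subsetD intro!: sets_completionI_sets)
qed

lemma AE_weak_integral_eq_integral:
  fixes \<Gamma> :: "'a \<Rightarrow> 'b \<Rightarrow> complex"
  assumes M: "sigma_finite_measure M" and N: "finite_measure N"
    and \<Gamma>: "(\<lambda>(\<rho>, x). \<Gamma> \<rho> x) \<in> borel_measurable (M \<Otimes>\<^sub>M N)" and F: "F \<in> L2_space N"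
    and weak: "\<And>h. h \<in> L2_space N \<Longrightarrow>
      (LINT x|N. cnj (h x) * F x) = (LINT \<rho>|M. (LINT x|N. cnj (h x) * \<Gamma> \<rho> x))"
  shows "AE x in N. integrable M (\<lambda>\<rho>. \<Gamma> \<rho> x) \<longrightarrow> F x = (LINT \<rho>|M. \<Gamma> \<rho> x)"
proof -
  interpret M: sigma_finite_measure M by fact
  interpret N: finite_measure N by fact
  interpret P: pair_sigma_finite N M ..
  note [measurable] = L2_measurable[OF F]
  have \<Gamma>' [measurable]: "(\<lambda>(x, \<rho>). \<Gamma> \<rho> x) \<in> borel_measurable (N \<Otimes>\<^sub>M M)"
    using measurable_pair_swap[OF \<Gamma>] by (simp add: case_prod_unfold)
  define m where "m x = (\<integral>\<^sup>+\<rho>. norm (\<Gamma> \<rho> x) \<partial>M)" for x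
  define J where "J x = (LINT \<rho>|M. \<Gamma> \<rho> x)" for x
  have m [measurable]: "m \<in> borel_measurable N"
    unfolding m_def[abs_def] by (rule M.borel_measurable_nn_integral) measurable
  have J [measurable]: "J \<in> borel_measurable N"
    unfolding J_def[abs_def] by (rule M.borel_measurable_lebesgue_integral) measurable
  have AE_n: "AE x in N. m x \<le> of_nat n \<longrightarrow> F x = J x" for n :: nat
  proof -
    \<comment> \<open>Bounded by 1, hence square integrable; where the difference is 0, division by
      zero gives the value 0.\<close>
    define h where "h x = (if m x \<le> of_nat n then (F x - J x) / cmod (F x - J x) else 0)" for x
    have hm [measurable]: "h \<in> borel_measurable N" unfolding h_def[abs_def] by measurable
    have h1: "cmod (h x) \<le> 1" for x by (simp add: h_def norm_divide)
    have "(cmod (h x))\<^sup>2 \<le> 1" for x using h1[of x] by (simp add: abs_square_le_1)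
    then have h: "h \<in> L2_space N"
      by (auto simp: L2_space_def intro!: N.integrable_const_bound[where B = 1])
    have int: "integrable (N \<Otimes>\<^sub>M M) (\<lambda>(x, \<rho>). cnj (h x) * \<Gamma> \<rho> x)"
    proof (rule integrableI_bounded)
      have "(\<integral>\<^sup>+z. norm (case z of (x, \<rho>) \<Rightarrow> cnj (h x) * \<Gamma> \<rho> x) \<partial>(N \<Otimes>\<^sub>M M)) =
          (\<integral>\<^sup>+x. (\<integral>\<^sup>+\<rho>. ennreal (cmod (h x)) * ennreal (cmod (\<Gamma> \<rho> x)) \<partial>M) \<partial>N)"
        by (subst M.nn_integral_fst[symmetric]) (auto simp: norm_mult ennreal_mult case_prod_unfold)
      also have "\<dots> = (\<integral>\<^sup>+x. ennreal (cmod (h x)) * m x \<partial>N)"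
        unfolding m_def by (intro nn_integral_cong nn_integral_cmult) measurable
      also have "\<dots> \<le> (\<integral>\<^sup>+x. of_nat n \<partial>N)"
      proof (rule nn_integral_mono)
        fix x
        show "ennreal (cmod (h x)) * m x \<le> of_nat n"
        proof (cases "m x \<le> of_nat n")
          case True
          have "ennreal (cmod (h x)) * m x \<le> 1 * m x"
            using h1[of x] by (intro mult_right_mono) auto
          with True show ?thesis by simp
        qed (simp add: h_def)
      qed
      also have "\<dots> < \<infinity>"
        using N.emeasure_finite[of "space N"]
        by (simp add: ennreal_mult_eq_top_iff less_top[symmetric])
      finally show "(\<integral>\<^sup>+z. norm (case z of (x, \<rho>) \<Rightarrow> cnj (h x) * \<Gamma> \<rho> x) \<partial>(N \<Otimes>\<^sub>M M)) < \<infinity>" .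
    qed measurable
    have iJ: "integrable N (\<lambda>x. cnj (h x) * J x)"
      using P.integrable_fst'[OF int] by (simp add: J_def)
    have iF: "integrable N (\<lambda>x. cnj (h x) * F x)" by (rule L2_mult_integrable(1)[OF h F])
    have "(LINT x|N. cnj (h x) * F x) = (LINT \<rho>|M. (LINT x|N. cnj (h x) * \<Gamma> \<rho> x))"
      by (rule weak[OF h])
    also have "\<dots> = (LINT x|N. (LINT \<rho>|M. cnj (h x) * \<Gamma> \<rho> x))"
      by (rule P.Fubini_integral[OF int])
    also have "\<dots> = (LINT x|N. cnj (h x) * J x)" by (simp add: J_def)
    finally have "(LINT x|N. cnj (h x) * (F x - J x)) = 0"
      using iF iJ by (simp add: right_diff_distrib)
    moreover have e: "cnj (h x) * (F x - J x) = of_real (if m x \<le> of_nat n then cmod (F x - J x) else 0)" for x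
    proof -
      have "cnj (d / of_real (cmod d)) * d = of_real (cmod d)" for d :: complex
        using complex_norm_square[of d] by (cases "d = 0") (simp_all add: power2_eq_square field_simps)
      from this[of "F x - J x"] show ?thesis by (simp add: h_def)
    qed
    ultimately have "(LINT x|N. (if m x \<le> of_nat n then cmod (F x - J x) else 0)) = 0"
      by (simp del: of_real_eq_0_iff add: of_real_eq_0_iff[where 'a = complex, symmetric])
    moreover have "integrable N (\<lambda>x. if m x \<le> of_nat n then cmod (F x - J x) else 0)"
    proof -
      have "integrable N (\<lambda>x. cnj (h x) * (F x - J x))"
        using iF iJ by (simp add: right_diff_distrib)
      then have "integrable N (\<lambda>x. Re (cnj (h x) * (F x - J x)))" by (rule integrable_Re)
      then show ?thesis unfolding e by simp
    qed
    ultimately have "AE x in N. (if m x \<le> of_nat n then cmod (F x - J x) else 0) = 0"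
      by (subst (asm) integral_nonneg_eq_0_iff_AE) auto
    then show ?thesis by eventually_elim auto
  qed
  then have "AE x in N. \<forall>n :: nat. m x \<le> of_nat n \<longrightarrow> F x = J x"
    unfolding AE_all_countable ..
  then show ?thesis
  proof eventually_elim
    case (elim x)
    show ?case
    proof
      assume "integrable M (\<lambda>\<rho>. \<Gamma> \<rho> x)"
      then have "m x < \<infinity>" by (simp add: m_def integrable_iff_bounded)
      then obtain n :: nat where "m x < of_nat n" using ennreal_Ex_less_of_nat by auto
      then show "F x = (LINT \<rho>|M. \<Gamma> \<rho> x)" using elim less_imp_le[of "m x"] by (auto simp: J_def)
    qed
  qed
qed

lemma set_integral_tendsto_at_right_0:
  fixes w :: "real \<Rightarrow> 'a :: {banach, second_countable_topology}"
  assumes w: "set_integrable lebesgue {0<..} w"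
  shows "((\<lambda>R. LINT \<rho>:{R..1 / R}|lebesgue. w \<rho>) \<longlongrightarrow> (LINT \<rho>:{0<..}|lebesgue. w \<rho>)) (at_right 0)"
proof (rule tendsto_at_right_sequentially[of 0 1])
  fix S :: "nat \<Rightarrow> real" assume S: "\<And>n. 0 < S n" "\<And>n. S n < 1" "S \<longlonglongrightarrow> 0"
  have sub: "{S n..1 / S n} \<subseteq> {0<..}" for n using S(1)[of n] by auto
  show "(\<lambda>n. LINT \<rho>:{S n..1 / S n}|lebesgue. w \<rho>) \<longlonglongrightarrow> (LINT \<rho>:{0<..}|lebesgue. w \<rho>)"
    unfolding set_lebesgue_integral_def
  proof (rule integral_dominated_convergence)
    show "integrable lebesgue (\<lambda>\<rho>. norm (indicator {0<..} \<rho> *\<^sub>R w \<rho>))"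
      using w unfolding set_integrable_def by (rule integrable_norm)
    show "(\<lambda>\<rho>. indicator {0<..} \<rho> *\<^sub>R w \<rho>) \<in> borel_measurable lebesgue"
      using w by (auto simp: set_integrable_def)
    show "(\<lambda>\<rho>. indicator {S n..1 / S n} \<rho> *\<^sub>R w \<rho>) \<in> borel_measurable lebesgue" for n
      using set_integrable_subset[OF w _ sub] by (auto simp: set_integrable_def)
    show "AE \<rho> in lebesgue. norm (indicator {S n..1 / S n} \<rho> *\<^sub>R w \<rho>) \<le> norm (indicator {0<..} \<rho> *\<^sub>R w \<rho>)" for n
      using sub[of n] by (intro AE_I2) (auto simp: indicator_def)
    show "AE \<rho> in lebesgue. (\<lambda>n. indicator {S n..1 / S n} \<rho> *\<^sub>R w \<rho>) \<longlonglongrightarrow> indicator {0<..} \<rho> *\<^sub>R w \<rho>"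
    proof (intro AE_I2)
      fix \<rho> :: real
      show "(\<lambda>n. indicator {S n..1 / S n} \<rho> *\<^sub>R w \<rho>) \<longlonglongrightarrow> indicator {0<..} \<rho> *\<^sub>R w \<rho>"
      proof (cases "\<rho> > 0")
        case True
        then have "\<forall>\<^sub>F n in sequentially. S n < min \<rho> (1 / \<rho>)"
          using S(3) by (intro order_tendstoD) auto
        then have "\<forall>\<^sub>F n in sequentially. indicator {S n..1 / S n} \<rho> *\<^sub>R w \<rho> = indicator {0<..} \<rho> *\<^sub>R w \<rho>"
        proof eventually_elim
          case (elim n)
          then have "S n * \<rho> < 1" using True by (simp add: field_simps)
          then have "\<rho> \<le> 1 / S n" using S(1)[of n] by (simp add: field_simps)
          then show ?case using elim True by (simp add: indicator_def)
        qed
        then show ?thesis by (rule tendsto_eventually)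
      next
        case False
        then have "indicator {S n..1 / S n} \<rho> = (0 :: real)" for n using sub[of n] by (auto simp: indicator_def)
        then show ?thesis using False by simp
      qed
    qed
  qed
qed simp

context haar_spin
begin

lemma
  assumes adm: "admissible_wavelet s \<alpha> \<Psi>"
  shows gain_set_integrable: "set_integrable lebesgue {0<..} (\<lambda>\<rho>. gain k (\<Psi> \<rho>) * \<alpha> \<rho>)"
    and gain_set_integral: "(LINT \<rho>:{0<..}|lebesgue. gain k (\<Psi> \<rho>) * \<alpha> \<rho>) = 1"
proof -
  let ?l = "deg k"
  define u where "u m \<rho> = (cmod (fourier_coeff s (\<Psi> \<rho>) ?l m))\<^sup>2 * \<alpha> \<rho>" for m \<rho>
  \<comment> \<open>The factor in \<open>gain\<close>, reciprocal to the right-hand side of the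
    admissibility condition; hence the total gain is 1.\<close>
  define K where "K = 8 * pi\<^sup>2 / (2 * real ?l + 1)"
  have K: "K * ((2 * real ?l + 1) / (8 * pi\<^sup>2)) = 1"
  proof -
    have "2 * real ?l + 1 \<noteq> 0" by linarith
    then show ?thesis by (simp add: K_def)
  qed
  have \<Psi>: "\<Psi> \<rho> \<in> L2_sphere" if "\<rho> > 0" for \<rho> using adm that by (simp add: admissible_wavelet_def)
  have u: "set_integrable lebesgue {0<..} (u m)" if "m \<in> {- int ?l..int ?l}" for m
    using adm deg_ge[of k] that unfolding admissible_wavelet_def u_def[abs_def] by blast
  have total: "(\<Sum>m\<in>{- int ?l..int ?l}. LINT \<rho>:{0<..}|lebesgue. u m \<rho>) = (2 * real ?l + 1) / (8 * pi\<^sup>2)"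
    using adm deg_ge[of k] unfolding admissible_wavelet_def u_def by blast
  have power: "power_spec k \<psi> = (\<Sum>m\<in>{- int ?l..int ?l}. (cmod (fourier_coeff s \<psi> ?l m))\<^sup>2)"
    if "\<psi> \<in> L2_sphere" for \<psi>
    unfolding power_spec_def
    by (rule sum.reindex_bij_witness[of _ "\<lambda>m. nat (int ?l + m)" "\<lambda>j. int j - int ?l"])
      (auto simp: norm_fourier_coeff[OF _ that])
  have "indicator {0<..} \<rho> *\<^sub>R (gain k (\<Psi> \<rho>) * \<alpha> \<rho>) =
      K * (\<Sum>m\<in>{- int ?l..int ?l}. indicator {0<..} \<rho> *\<^sub>R u m \<rho>)" for \<rho>
    using power[OF \<Psi>[of \<rho>]] by (simp add: indicator_def gain_def K_def u_def sum_distrib_right)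
  then show "set_integrable lebesgue {0<..} (\<lambda>\<rho>. gain k (\<Psi> \<rho>) * \<alpha> \<rho>)"
    "(LINT \<rho>:{0<..}|lebesgue. gain k (\<Psi> \<rho>) * \<alpha> \<rho>) = 1"
    using u total K unfolding set_integrable_def set_lebesgue_integral_def
    by (simp_all only: Bochner_Integration.integral_sum Bochner_Integration.integral_mult_right_zero
        integrable_mult_right Bochner_Integration.integrable_sum)
qed

lemma gain_set_integral_bounds:
  assumes adm: "admissible_wavelet s \<alpha> \<Psi>" and \<alpha>: "weight_function \<alpha>" and I: "I \<subseteq> {0<..}" "I \<in> sets lebesgue"
  shows "0 \<le> (LINT \<rho>:I|lebesgue. gain k (\<Psi> \<rho>) * \<alpha> \<rho>)" "(LINT \<rho>:I|lebesgue. gain k (\<Psi> \<rho>) * \<alpha> \<rho>) \<le> 1"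
proof -
  have nonneg: "0 \<le> gain k (\<Psi> \<rho>) * \<alpha> \<rho>" if "\<rho> > 0" for \<rho>
    using \<alpha> that gain_nonneg by (auto simp: weight_function_def less_imp_le intro!: mult_nonneg_nonneg)
  show "0 \<le> (LINT \<rho>:I|lebesgue. gain k (\<Psi> \<rho>) * \<alpha> \<rho>)"
    unfolding set_lebesgue_integral_def using I(1) nonneg by (intro Bochner_Integration.integral_nonneg) (auto simp: indicator_def)
  have "(LINT \<rho>:I|lebesgue. gain k (\<Psi> \<rho>) * \<alpha> \<rho>) \<le> (LINT \<rho>:{0<..}|lebesgue. gain k (\<Psi> \<rho>) * \<alpha> \<rho>)"
    unfolding set_lebesgue_integral_def
  proof (rule integral_mono)
    show "integrable lebesgue (\<lambda>\<rho>. indicator I \<rho> *\<^sub>R (gain k (\<Psi> \<rho>) * \<alpha> \<rho>))"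
      using set_integrable_subset[OF gain_set_integrable[OF adm] I(2,1)] by (simp add: set_integrable_def)
    show "integrable lebesgue (\<lambda>\<rho>. indicator {0<..} \<rho> *\<^sub>R (gain k (\<Psi> \<rho>) * \<alpha> \<rho>))"
      using gain_set_integrable[OF adm] by (simp add: set_integrable_def)
    show "indicator I \<rho> *\<^sub>R (gain k (\<Psi> \<rho>) * \<alpha> \<rho>) \<le> indicator {0<..} \<rho> *\<^sub>R (gain k (\<Psi> \<rho>) * \<alpha> \<rho>)" for \<rho>
      using I(1) nonneg by (auto simp: indicator_def)
  qed
  then show "(LINT \<rho>:I|lebesgue. gain k (\<Psi> \<rho>) * \<alpha> \<rho>) \<le> 1" by (simp add: gain_set_integral[OF adm])
qed

text \<open>Tested against h, the reconstruction is the series of the scalar products of h with the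
  components of f, weighted by the gains. Each gain integrates to at most 1, so the series is
  dominated by an absolutely convergent one and may be integrated over the scales term by
  term.\<close>

lemma L2_integral_synthesis:
  assumes adm: "admissible_wavelet s \<alpha> \<Psi>" and \<alpha>: "weight_function \<alpha>" and f: "f \<in> L2_sphere"
    and I: "I \<subseteq> {0<..}" "I \<in> sets lebesgue" and F: "F \<in> L2_sphere"
    and lim: "(\<lambda>L. norm_L2 sph_measure (\<lambda>x.
      multiplier_sum (\<lambda>k. of_real (LINT \<rho>:I|lebesgue. gain k (\<Psi> \<rho>) * \<alpha> \<rho>)) L f x - F x)) \<longlonglongrightarrow> 0"
  shows "L2_integral_on I (\<lambda>\<rho> x. synthesis s \<nu> \<Psi> f \<rho> x * of_real (\<alpha> \<rho>)) F"
proof -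
  define G where "G \<rho> x = of_real (\<alpha> \<rho>) * reconstruct f (\<Psi> \<rho>) x" for \<rho> x
  define u where "u k \<rho> = indicator I \<rho> * (gain k (\<Psi> \<rho>) * \<alpha> \<rho>)" for k \<rho>
  have \<Psi>: "\<Psi> \<rho> \<in> L2_sphere" if "\<rho> \<in> I" for \<rho> using adm that I(1) by (auto simp: admissible_wavelet_def)
  have \<alpha>0: "\<alpha> \<rho> \<ge> 0" if "\<rho> \<in> I" for \<rho> using \<alpha> that I(1) by (auto simp: weight_function_def less_imp_le)
  have u0: "u k \<rho> \<ge> 0" for k \<rho> using \<alpha>0 gain_nonneg by (auto simp: u_def indicator_def)
  have ui: "integrable lebesgue (u k)" for k
    using set_integrable_subset[OF gain_set_integrable[OF adm] I(2,1)] by (simp add: u_def[abs_def] set_integrable_def)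
  have uI: "(LINT \<rho>|lebesgue. u k \<rho>) = (LINT \<rho>:I|lebesgue. gain k (\<Psi> \<rho>) * \<alpha> \<rho>)" for k
    by (simp add: u_def[abs_def] set_lebesgue_integral_def)
  have u1: "(LINT \<rho>|lebesgue. u k \<rho>) \<le> 1" for k
    unfolding uI by (rule gain_set_integral_bounds(2)[OF adm \<alpha> I])
  have um [measurable]: "u k \<in> borel_measurable lebesgue" for k using ui by auto
  have G: "G \<rho> \<in> L2_sphere" if "\<rho> \<in> I" for \<rho>
    using reconstruct_L2(1)[OF f \<Psi>[OF that]] L2_cmult unfolding G_def[abs_def] L2_sphere_eq by blast
  have sums: "(\<lambda>k. of_real (u k \<rho>) * sprod h (proj k f)) sums (indicator I \<rho> *\<^sub>R sprod h (G \<rho>))"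
    if h: "h \<in> L2_sphere" for h \<rho>
  proof (cases "\<rho> \<in> I")
    case True
    have "sprod h (G \<rho>) = of_real (\<alpha> \<rho>) * sprod h (reconstruct f (\<Psi> \<rho>))"
      unfolding sprod_def G_def
      by (simp only: mult.left_commute[of "cnj _"] Bochner_Integration.integral_mult_right_zero)
    then show ?thesis
      using sums_mult[OF reconstruct_L2(2)[OF f \<Psi>[OF True] h], of "of_real (\<alpha> \<rho>)"] True
      by (simp add: u_def mult_ac)
  qed (simp add: u_def)
  have smn: "summable (\<lambda>k. norm (complex_of_real (u k \<rho>) * sprod h (proj k f)))" if h: "h \<in> L2_sphere" for h \<rho>
  proof (cases "\<rho> \<in> I")
    case True
    show ?thesis
    proof (rule summable_comparison_test')
      let ?B = "8 * pi\<^sup>2 * (norm_L2 sph_measure (\<Psi> \<rho>))\<^sup>2 * \<alpha> \<rho>"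
      show "summable (\<lambda>k. ?B * cmod (sprod h (proj k f)))"
        by (intro summable_mult summable_sprod_proj f h)
      have "u k \<rho> \<le> ?B" for k
        using True gain_le[OF \<Psi>[OF True], of k] \<alpha>0[OF True] by (simp add: u_def mult_right_mono)
      then show "norm (norm (complex_of_real (u k \<rho>) * sprod h (proj k f))) \<le> ?B * cmod (sprod h (proj k f))" for k
        using u0[of k \<rho>] by (simp add: norm_mult mult_right_mono)
    qed
  qed (simp add: u_def)
  have sm: "summable (\<lambda>k. LINT \<rho>|lebesgue. norm (complex_of_real (u k \<rho>) * sprod h (proj k f)))" if h: "h \<in> L2_sphere" for h
  proof (rule summable_comparison_test'[OF summable_sprod_proj[OF f h]])
    fix k
    have "(LINT \<rho>|lebesgue. norm (complex_of_real (u k \<rho>) * sprod h (proj k f))) = (LINT \<rho>|lebesgue. u k \<rho>) * cmod (sprod h (proj k f))"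
      using u0 by (simp add: norm_mult)
    also have "\<dots> \<le> 1 * cmod (sprod h (proj k f))" by (intro mult_right_mono u1) simp
    finally show "norm (LINT \<rho>|lebesgue. norm (complex_of_real (u k \<rho>) * sprod h (proj k f))) \<le> cmod (sprod h (proj k f))"
      by simp
  qed
  have weak: "integrable lebesgue (\<lambda>\<rho>. indicator I \<rho> *\<^sub>R sprod h (G \<rho>))"
    "sprod h F = (LINT \<rho>|lebesgue. indicator I \<rho> *\<^sub>R sprod h (G \<rho>))" if h: "h \<in> L2_sphere" for h
  proof -
    have i: "integrable lebesgue (\<lambda>\<rho>. complex_of_real (u k \<rho>) * sprod h (proj k f))" for k
      using ui by (intro integrable_mult_left integrable_of_real)
    have e: "indicator I \<rho> *\<^sub>R sprod h (G \<rho>) = (\<Sum>k. of_real (u k \<rho>) * sprod h (proj k f))" for \<rho>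
      by (rule sums_unique[OF sums[OF h]])
    show "integrable lebesgue (\<lambda>\<rho>. indicator I \<rho> *\<^sub>R sprod h (G \<rho>))"
      unfolding e by (rule integrable_suminf[OF i AE_I2[OF smn[OF h]] sm[OF h]])
    have "(\<lambda>k. LINT \<rho>|lebesgue. complex_of_real (u k \<rho>) * sprod h (proj k f)) sums (LINT \<rho>|lebesgue. indicator I \<rho> *\<^sub>R sprod h (G \<rho>))"
      unfolding e by (rule sums_integral[OF i AE_I2[OF smn[OF h]] sm[OF h]])
    moreover have "(LINT \<rho>|lebesgue. complex_of_real (u k \<rho>) * sprod h (proj k f)) =
        of_real (LINT \<rho>:I|lebesgue. gain k (\<Psi> \<rho>) * \<alpha> \<rho>) * sprod h (proj k f)" for k
      by (simp only: uI[symmetric] integral_mult_left_zero integral_complex_of_real)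
    ultimately show "sprod h F = (LINT \<rho>|lebesgue. indicator I \<rho> *\<^sub>R sprod h (G \<rho>))"
      using sums_unique2[OF multiplier_limit_sprod[OF f F h lim]] by (simp only:)
  qed
  have "AE x in sph_measure. integrable lebesgue (\<lambda>\<rho>. indicator I \<rho> *\<^sub>R G \<rho> x) \<longrightarrow>
      F x = (LINT \<rho>|lebesgue. indicator I \<rho> *\<^sub>R G \<rho> x)"
  proof (rule AE_weak_integral_eq_integral)
    show "sigma_finite_measure (lebesgue :: real measure)"
      by (intro sigma_finite_completion) unfold_locales
    show "finite_measure sph_measure" by unfold_locales
    show "F \<in> L2_space sph_measure" using F by (simp add: L2_sphere_eq)
    have [measurable]: "proj k f \<in> borel_measurable sph_measure" for k
      using proj_L2 by (simp add: L2_sphere_def)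
    show "(\<lambda>(\<rho>, x). indicator I \<rho> *\<^sub>R G \<rho> x) \<in> borel_measurable (lebesgue \<Otimes>\<^sub>M sph_measure)"
    \<comment> \<open>No joint measurability of the wavelet in scale and point is given. The partial
      sums depend on the scale only through the gains, which are measurable by admissibility, and
      they converge at every point.\<close>
    proof (rule borel_measurable_LIMSEQ_metric)
      show "(\<lambda>(\<rho>, x). \<Sum>k<L. of_real (u k \<rho>) * proj k f x) \<in> borel_measurable (lebesgue \<Otimes>\<^sub>M sph_measure)" for L
        by measurable
      fix z :: "real \<times> sph"
      obtain \<rho> x where z: "z = (\<rho>, x)" by (cases z)
      show "(\<lambda>L. case z of (\<rho>, x) \<Rightarrow> \<Sum>k<L. of_real (u k \<rho>) * proj k f x) \<longlonglongrightarrow> (case z of (\<rho>, x) \<Rightarrow> indicator I \<rho> *\<^sub>R G \<rho> x)"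
      proof (cases "\<rho> \<in> I")
        case True
        have "(\<lambda>L. of_real (\<alpha> \<rho>) * multiplier_sum (\<lambda>k. of_real (gain k (\<Psi> \<rho>))) L f x) \<longlonglongrightarrow> G \<rho> x"
          unfolding G_def by (intro tendsto_mult_left reconstruct_pointwise f \<Psi> True)
        then show ?thesis
          using True by (simp add: z u_def multiplier_sum_def sum_distrib_left mult_ac)
      qed (simp add: z u_def)
    qed
    fix h assume "h \<in> L2_space sph_measure"
    then show "(LINT x|sph_measure. cnj (h x) * F x) = (LINT \<rho>|lebesgue. LINT x|sph_measure. cnj (h x) * (indicator I \<rho> *\<^sub>R G \<rho> x))"
      using weak(2)[of h] by (simp add: L2_sphere_eq sprod_def)
  qed
  moreover have "synthesis s \<nu> \<Psi> f \<rho> x * of_real (\<alpha> \<rho>) = G \<rho> x" for \<rho> x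
    by (simp add: G_def synthesis_eq mult.commute)
  ultimately show ?thesis
    unfolding L2_integral_on_def set_integrable_def set_lebesgue_integral_def using F G weak by simp
qed

lemma rotate_spin_wavelet_transform_integrable:
  assumes "f \<in> L2_sphere" "\<Psi> \<rho> \<in> L2_sphere"
  shows "integrable \<nu> (\<lambda>A. rotate_spin s A (\<Psi> \<rho>) x * wavelet_transform s \<Psi> f \<rho> A)"
  using rotate_spin_analysis_bound(1)[OF assms(1,2,2)] by (simp add: analysis_def wavelet_transform_def sprod_def)

lemma wavelet_inversion:
  assumes adm: "admissible_wavelet s \<alpha> \<Psi>" and \<alpha>: "weight_function \<alpha>" and f: "f \<in> L2_sphere"
  obtains F where "\<And>R. R \<in> {0<..<1} \<Longrightarrow> L2_integral_on {R..1 / R} (\<lambda>\<rho> x. synthesis s \<nu> \<Psi> f \<rho> x * of_real (\<alpha> \<rho>)) (F R)"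
    "((\<lambda>R. L2_norm (\<lambda>x. F R x - f x)) \<longlongrightarrow> 0) (at_right 0)"
proof -
  define c where "c R k = (LINT \<rho>:{R..1 / R}|lebesgue. gain k (\<Psi> \<rho>) * \<alpha> \<rho>)" for R k
  have c: "0 \<le> c R k" "c R k \<le> 1" if "R \<in> {0<..<1}" for R k
  proof -
    have "{R..1 / R} \<subseteq> {0<..}" using that by auto
    then show "0 \<le> c R k" "c R k \<le> 1"
      unfolding c_def using gain_set_integral_bounds[OF adm \<alpha>, of "{R..1 / R}"] by auto
  qed
  have c_lim: "((\<lambda>R. c R k) \<longlongrightarrow> 1) (at_right 0)" for k
    unfolding c_def using set_integral_tendsto_at_right_0[OF gain_set_integrable[OF adm]]
    by (simp add: gain_set_integral[OF adm])
  have "\<exists>F. F \<in> L2_sphere \<and> (\<lambda>L. norm_L2 sph_measure (\<lambda>x. multiplier_sum (\<lambda>k. of_real (c R k)) L f x - F x)) \<longlonglongrightarrow> 0"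
    if "R \<in> {0<..<1}" for R
    by (rule multiplier_limit[OF f, of "\<lambda>k. of_real (c R k)" 1]) (use c[OF that] in auto)
  then have "\<exists>F. \<forall>R\<in>{0<..<1}. F R \<in> L2_sphere \<and>
      (\<lambda>L. norm_L2 sph_measure (\<lambda>x. multiplier_sum (\<lambda>k. of_real (c R k)) L f x - F R x)) \<longlonglongrightarrow> 0"
    by (intro bchoice ballI)
  then obtain F where F: "F R \<in> L2_sphere"
    "(\<lambda>L. norm_L2 sph_measure (\<lambda>x. multiplier_sum (\<lambda>k. of_real (c R k)) L f x - F R x)) \<longlonglongrightarrow> 0"
    if "R \<in> {0<..<1}" for R by blast
  show ?thesis
  proof
    fix R :: real assume R: "R \<in> {0<..<1}"
    have "{R..1 / R} \<subseteq> {0<..}" using R by auto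
    then show "L2_integral_on {R..1 / R} (\<lambda>\<rho> x. synthesis s \<nu> \<Psi> f \<rho> x * of_real (\<alpha> \<rho>)) (F R)"
      using L2_integral_synthesis[OF adm \<alpha> f _ _ F[OF R, unfolded c_def]] by simp
  next
    \<comment> \<open>The terms of the squared distance between \<open>F R\<close> and f. Since c
      lies between 0 and 1, they are dominated by the power of f uniformly in R.\<close>
    define a where "a k R = (c R k - 1)\<^sup>2 * power_spec k f" for k R
    have near: "\<forall>\<^sub>F R in at_right 0. R \<in> {0<..<1 :: real}"
      by (rule eventually_at_right_real) simp
    have "((\<lambda>R. \<Sum>k. a k R) \<longlongrightarrow> (\<Sum>k. 0)) (at_right 0)"
    proof (rule tannerys_theorem[THEN conjunct2, THEN conjunct2])
      show "((\<lambda>R. a k R) \<longlongrightarrow> 0) (at_right 0)" for k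
        unfolding a_def
        by (rule tendsto_eq_rhs[OF tendsto_mult_right[OF tendsto_power[OF tendsto_diff[OF c_lim tendsto_const]]]]) simp
      have "norm (a k R) \<le> power_spec k f" if "R \<in> {0<..<1}" for k R
        using c[OF that, of k] power_spec_nonneg[of k f]
        by (auto simp: a_def abs_mult abs_square_le_1 intro!: mult_left_le_one_le)
      moreover have "\<forall>\<^sub>F (k :: nat, R) in at_top \<times>\<^sub>F at_right 0. R \<in> {0<..<1 :: real}"
        by (subst eventually_prod2) (use near in auto)
      ultimately show "\<forall>\<^sub>F (k, R) in at_top \<times>\<^sub>F at_right 0. norm (a k R) \<le> power_spec k f"
        by (auto elim!: eventually_mono simp del: real_norm_def)
      show "summable (\<lambda>k. power_spec k f)" by (rule summable_power_spec[OF f])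
    qed simp
    then have "((\<lambda>R. \<Sum>k. a k R) \<longlongrightarrow> 0) (at_right 0)" by simp
    then have "((\<lambda>R. sqrt (\<Sum>k. a k R)) \<longlongrightarrow> 0) (at_right 0)" using tendsto_real_sqrt by fastforce
    moreover have "sqrt (\<Sum>k. a k R) = L2_norm (\<lambda>x. F R x - f x)" if R: "R \<in> {0<..<1}" for R
    proof -
      have "cmod (of_real (c R k) - 1) = \<bar>c R k - 1\<bar>" for k
        by (metis norm_of_real of_real_1 of_real_diff)
      then have "(\<lambda>k. a k R) sums (norm_L2 sph_measure (\<lambda>x. F R x - f x))\<^sup>2"
        using multiplier_limit_distance[OF f F[OF R]] by (simp add: a_def)
      then show ?thesis by (simp add: sums_unique[symmetric] L2_norm_eq norm_L2_nonneg)
    qed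
    then have "\<forall>\<^sub>F R in at_right 0. sqrt (\<Sum>k. a k R) = L2_norm (\<lambda>x. F R x - f x)"
      using near by (rule eventually_mono[rotated])
    ultimately show "((\<lambda>R. L2_norm (\<lambda>x. F R x - f x)) \<longlongrightarrow> 0) (at_right 0)"
      by (rule Lim_transform_eventually)
  qed
qed

end

text \<open>The first conjunct guarantees that the inner integral over the rotations exists and is
  not 0 by convention; the second one takes the integral over the scales in L2.\<close>

theorem theorem3p3:
  fixes s :: int and \<alpha> :: "real \<Rightarrow> real" and \<Psi> :: "real \<Rightarrow> sph \<Rightarrow> complex"
    and \<nu> :: "(real^3^3) measure" and f :: "sph \<Rightarrow> complex"
  assumes "haar_SO3 \<nu>"
    and "weight_function \<alpha>"
    and "admissible_wavelet s \<alpha> \<Psi>"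
    and "f \<in> L2_sphere"
  shows "(\<forall>\<rho>>0. AE x in sph_measure.
            integrable \<nu> (\<lambda>\<Upsilon>. rotate_spin s \<Upsilon> (\<Psi> \<rho>) x * wavelet_transform s \<Psi> f \<rho> \<Upsilon>)) \<and>
         (\<exists>F. (\<forall>R\<in>{0<..<1}. L2_integral_on {R..1 / R}
                  (\<lambda>\<rho> x. synthesis s \<nu> \<Psi> f \<rho> x * of_real (\<alpha> \<rho>)) (F R)) \<and>
              ((\<lambda>R. L2_norm (\<lambda>x. F R x - f x)) \<longlongrightarrow> 0) (at_right 0))"
proof -
  interpret haar_spin \<nu> s by unfold_locales fact
  have "\<Psi> \<rho> \<in> L2_sphere" if "\<rho> > 0" for \<rho>
    using assms(3) that by (simp add: admissible_wavelet_def)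
  moreover obtain F where "\<And>R. R \<in> {0<..<1} \<Longrightarrow>
      L2_integral_on {R..1 / R} (\<lambda>\<rho> x. synthesis s \<nu> \<Psi> f \<rho> x * of_real (\<alpha> \<rho>)) (F R)"
    "((\<lambda>R. L2_norm (\<lambda>x. F R x - f x)) \<longlongrightarrow> 0) (at_right 0)"
    by (rule wavelet_inversion[OF assms(3,2,4)]) blast
  ultimately show ?thesis
    using rotate_spin_wavelet_transform_integrable[OF assms(4)] by blast
qed

end
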